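(* Let $\mathbb{G}$ be a Carnot group of step $r=2$, and let $\Omega\subset\mathbb{G}$ be a $C^2$ bounded open set such that for some $M,\alpha>0$, $$\sup_{\partial\Omega}|\mathcal H|\le M,$$ and $$\langle\mathcal Z,\boldsymbol\nu\rangle\ge\alpha\,W\quad\text{at every point of }\partial\Omega .$$ Then there exists a constant $C=C(\mathbb{G},\Omega,M,\alpha)>0$ such that for every $u\in\Gamma^3(\overline\Omega)\cap C^2(\overline\Omega)$ which is $H_2$-convex in $\Omega$ and satisfies $u=0$ on $\partial\Omega$, one has $$\sum_{i,j=1}^m\int_\Omega([X_i,X_j]u)^2\,dg\le C\int_\Omega(\Delta_Hu)^2\,dg .$$
   Context: Carnot group. $\mathbb{G}$ is a Carnot group of step $2$: a simply connected Lie group whose Lie algebra is graded, $\mathfrak g=V_1\oplus V_2$, with $[V_1,V_1]=V_2$ and $[V_1,V_2]=\{0\}$. Fix an inner product on $\mathfrak g$ for which the layers are orthogonal, and orthonormal bases of the layers; let $m=\dim V_1$ and let $X_1,\dots,X_m$ be the left-invariant vector fields associated with the orthonormal basis of $V_1$. $\mathbb{G}$ carries the left-invariant Riemannian metric $\langle\cdot,\cdot\rangle$ for which the left-invariant vector fields generated by these bases are orthonormal. $dg$ is the bi-invariant Haar measure obtained by pushing forward Lebesgue measure on $\mathfrak g$ by $\exp$. Dilations. $\delta_\lambda(\exp(\xi_1+\xi_2))=\exp(\lambda\xi_1+\lambda^2\xi_2)$ for $\xi_i\in V_i$, $\lambda>0$; $\mathcal Z$ is the infinitesimal generator of the dilations,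 i.e. the vector field $\mathcal Zf(g)=\frac{d}{d\lambda}\big|_{\lambda=1}f(\delta_\lambda g)$. Function classes. $\Gamma^k(\Omega)$ is the Folland-Stein class of continuous $u$ such that $X_{j_1}\cdots X_{j_s}u$ is continuous for all $1\le s\le k$ and $j_\ell\in\{1,\dots,m\}$; $\Gamma^k(\overline\Omega)$ is the same with continuity up to $\overline\Omega$. Operators. $\nabla^Hu=\sum_{i=1}^mX_iu\,X_i$; $\Delta_Hu=\sum_{i=1}^mX_i^2u$; $u_{,ij}=\frac12(X_iX_ju+X_jX_iu)$; $\nabla_H^2u=[u_{,ij}]_{i,j=1}^m$; $\|\nabla_H^2u\|^2=\sum_{i,j=1}^mu_{,ij}^2$; $\Delta_{H,\infty}u=\sum_{i,j=1}^mu_{,ij}X_iu\,X_ju$. $H_2$-convexity. $u$ is $H_2$-convex in $\Omega$ if the first and second elementary symmetric functions of the eigenvalues of $\nabla_H^2u$ are nonnegative in $\Omega$, i.e. $\Delta_Hu\ge0$ and $(\Delta_Hu)^2-\|\nabla_H^2u\|^2\ge0$ in $\Omega$. Boundary. $\boldsymbol\nu$ is the Riemannian outer unit normal on $\partial\Omega$, $W=\big(\sum_{j=1}^m\langle\boldsymbol\nu,X_j\rangle^2\big)^{1/2}$ is the angle function, and $\Sigma=\{g\in\partial\Omega: W(g)=0\}$ is the characteristic set. The $H$-mean curvature $\mathcal H$ of $\partial\Omega$ at a point of $\partial\Omega\setminus\Sigma$ is $$\mathcal H=\frac{|\nabla^H\phi|^2\Delta_H\phi-\Delta_{H,\infty}\phi}{|\nabla^H\phi|^3},$$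 where $\phi$ is any local $C^2$ defining function of $\Omega$ near that point ($\Omega=\{\phi<0\}$, with nonvanishing Riemannian gradient); the value does not depend on $\phi$. At $g_0\in\Sigma$, $\mathcal H(g_0)=\lim_{g\to g_0}\mathcal H(g)$ if this limit exists and is finite. The supremum of $|\mathcal H|$ is taken over the points of $\partial\Omega$ where $\mathcal H$ is defined. *)

theory Defs
  imports "HOL-Analysis.Analysis"
begin

section \<open>Carnot groups of step two\<close>

text \<open>
  A simply connected nilpotent Lie group is diffeomorphic to its Lie algebra through the
  exponential map. We identify the group with the Lie algebra by means of \<open>exp\<close>: points of the
  group are elements of the Euclidean space \<^typ>\<open>'a\<close>, \<open>exp\<close> is the identity, the inner product of
  the Lie algebra is the one of \<^typ>\<open>'a\<close>, and the Haar measure \<open>dg\<close>, the push-forward of Lebesgue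
  measure by \<open>exp\<close>, is Lebesgue measure. The field \<open>frame\<close> is an orthonormal basis of the first
  layer, indexed by \<open>1, \<dots>, m\<close>.
\<close>

record 'a carnot =
  bracket :: "'a \<Rightarrow> 'a \<Rightarrow> 'a"
  V1 :: "'a set"
  V2 :: "'a set"
  frame :: "nat \<Rightarrow> 'a"

definition hdim :: "'a::euclidean_space carnot \<Rightarrow> nat" where
  "hdim G = dim (V1 G)"

definition lie_bracket :: "('a::real_vector \<Rightarrow> 'a \<Rightarrow> 'a) \<Rightarrow> bool" where
  "lie_bracket b \<longleftrightarrow>
     (\<forall>x. linear (b x)) \<and> (\<forall>y. linear (\<lambda>x. b x y)) \<and> (\<forall>x. b x x = 0) \<and>
     (\<forall>x y z. b x (b y z) + b y (b z x) + b z (b x y) = 0)"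

definition carnot_step2 :: "'a::euclidean_space carnot \<Rightarrow> bool" where
  "carnot_step2 G \<longleftrightarrow>
     lie_bracket (bracket G) \<and>
     subspace (V1 G) \<and> subspace (V2 G) \<and> V2 G \<noteq> {0} \<and>
     (\<forall>x. \<exists>v\<in>V1 G. \<exists>w\<in>V2 G. x = v + w) \<and>
     (\<forall>v\<in>V1 G. \<forall>w\<in>V2 G. v \<bullet> w = 0) \<and>
     span {bracket G v v' | v v'. v \<in> V1 G \<and> v' \<in> V1 G} = V2 G \<and>
     (\<forall>v\<in>V1 G. \<forall>w\<in>V2 G. bracket G v w = 0) \<and>
     (\<forall>i\<in>{1..hdim G}. frame G i \<in> V1 G) \<and>
     (\<forall>i\<in>{1..hdim G}. \<forall>j\<in>{1..hdim G}. frame G i \<bullet> frame G j = (if i = j then 1 else 0))"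

text \<open>The group law, given by the Baker-Campbell-Hausdorff formula, which terminates in step two.\<close>

definition gmul :: "'a::euclidean_space carnot \<Rightarrow> 'a \<Rightarrow> 'a \<Rightarrow> 'a" where
  "gmul G x y = x + y + (1/2) *\<^sub>R bracket G x y"

text \<open>
  Left-invariant vector fields: as a map from points to tangent vectors (\<open>lfield\<close>), and, for
  the fields \<open>X\<^sub>i\<close>, acting on functions by differentiation along \<open>t \<mapsto> g exp(t e\<^sub>i)\<close>. The
  operator \<open>X\<close> is total; \<open>X_exists\<close> says that the derivative exists.
\<close>

definition lfield :: "'a::euclidean_space carnot \<Rightarrow> 'a \<Rightarrow> 'a \<Rightarrow> 'a" where
  "lfield G \<xi> g = vector_derivative (\<lambda>t. gmul G g (t *\<^sub>R \<xi>)) (at 0)"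

definition X :: "'a::euclidean_space carnot \<Rightarrow> nat \<Rightarrow> ('a \<Rightarrow> real) \<Rightarrow> 'a \<Rightarrow> real" where
  "X G i f g = deriv (\<lambda>t::real. f (gmul G g (t *\<^sub>R frame G i))) 0"

definition X_exists :: "'a::euclidean_space carnot \<Rightarrow> nat \<Rightarrow> ('a \<Rightarrow> real) \<Rightarrow> 'a \<Rightarrow> bool" where
  "X_exists G i f g \<longleftrightarrow> (\<lambda>t::real. f (gmul G g (t *\<^sub>R frame G i))) differentiable (at 0)"

fun X_iter :: "'a::euclidean_space carnot \<Rightarrow> nat list \<Rightarrow> ('a \<Rightarrow> real) \<Rightarrow> 'a \<Rightarrow> real" where
  "X_iter G [] f = f"
| "X_iter G (j # js) f = X G j (X_iter G js f)"

text \<open>The left-invariant Riemannian metric; \<open>\<xi> \<mapsto> lfield G \<xi> g\<close> is a linear bijection.\<close>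

definition riem :: "'a::euclidean_space carnot \<Rightarrow> 'a \<Rightarrow> 'a \<Rightarrow> 'a \<Rightarrow> real" where
  "riem G g v w = inv (\<lambda>\<xi>. lfield G \<xi> g) v \<bullet> inv (\<lambda>\<xi>. lfield G \<xi> g) w"

definition rnorm :: "'a::euclidean_space carnot \<Rightarrow> 'a \<Rightarrow> 'a \<Rightarrow> real" where
  "rnorm G g v = sqrt (riem G g v v)"

definition rgrad :: "'a::euclidean_space carnot \<Rightarrow> ('a \<Rightarrow> real) \<Rightarrow> 'a \<Rightarrow> 'a" where
  "rgrad G f g = (THE v. \<forall>w. riem G g v w = frechet_derivative f (at g) w)"

definition dilation :: "'a::euclidean_space carnot \<Rightarrow> real \<Rightarrow> 'a \<Rightarrow> 'a" where
  "dilation G l g = (THE h. \<exists>v\<in>V1 G. \<exists>w\<in>V2 G. g = v + w \<and> h = l *\<^sub>R v + l\<^sup>2 *\<^sub>R w)"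

definition Zfield :: "'a::euclidean_space carnot \<Rightarrow> 'a \<Rightarrow> 'a" where
  "Zfield G g = vector_derivative (\<lambda>l. dilation G l g) (at 1)"


section \<open>Horizontal operators\<close>

definition hgrad :: "'a::euclidean_space carnot \<Rightarrow> ('a \<Rightarrow> real) \<Rightarrow> 'a \<Rightarrow> 'a" where
  "hgrad G u g = (\<Sum>i=1..hdim G. X G i u g *\<^sub>R lfield G (frame G i) g)"

definition hlap :: "'a::euclidean_space carnot \<Rightarrow> ('a \<Rightarrow> real) \<Rightarrow> 'a \<Rightarrow> real" where
  "hlap G u g = (\<Sum>i=1..hdim G. X G i (X G i u) g)"

definition hhess :: "'a::euclidean_space carnot \<Rightarrow> nat \<Rightarrow> nat \<Rightarrow> ('a \<Rightarrow> real) \<Rightarrow> 'a \<Rightarrow> real" where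
  "hhess G i j u g = (X G i (X G j u) g + X G j (X G i u) g) / 2"

definition hhess_sqnorm :: "'a::euclidean_space carnot \<Rightarrow> ('a \<Rightarrow> real) \<Rightarrow> 'a \<Rightarrow> real" where
  "hhess_sqnorm G u g = (\<Sum>i=1..hdim G. \<Sum>j=1..hdim G. (hhess G i j u g)\<^sup>2)"

definition hinflap :: "'a::euclidean_space carnot \<Rightarrow> ('a \<Rightarrow> real) \<Rightarrow> 'a \<Rightarrow> real" where
  "hinflap G u g = (\<Sum>i=1..hdim G. \<Sum>j=1..hdim G. hhess G i j u g * X G i u g * X G j u g)"

definition X_comm :: "'a::euclidean_space carnot \<Rightarrow> nat \<Rightarrow> nat \<Rightarrow> ('a \<Rightarrow> real) \<Rightarrow> 'a \<Rightarrow> real" where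
  "X_comm G i j u g = X G i (X G j u) g - X G j (X G i u) g"

definition H2_convex_on :: "'a::euclidean_space carnot \<Rightarrow> 'a set \<Rightarrow> ('a \<Rightarrow> real) \<Rightarrow> bool" where
  "H2_convex_on G \<Omega> u \<longleftrightarrow>
     (\<forall>g\<in>\<Omega>. hlap G u g \<ge> 0 \<and> (hlap G u g)\<^sup>2 - hhess_sqnorm G u g \<ge> 0)"


section \<open>Function classes\<close>

definition C2_on :: "'a::euclidean_space set \<Rightarrow> ('a \<Rightarrow> real) \<Rightarrow> bool" where
  "C2_on U f \<longleftrightarrow>
     (\<exists>(D :: 'a \<Rightarrow> 'a \<Rightarrow>\<^sub>L real) (D2 :: 'a \<Rightarrow> 'a \<Rightarrow>\<^sub>L 'a \<Rightarrow>\<^sub>L real).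
        (\<forall>x\<in>U. (f has_derivative blinfun_apply (D x)) (at x)) \<and>
        (\<forall>x\<in>U. (D has_derivative blinfun_apply (D2 x)) (at x)) \<and>
        continuous_on U D2)"

text \<open>
  The classes \<open>C\<^sup>2\<close> and \<open>\<Gamma>\<^sup>k\<close> up to the boundary, for open \<open>\<Omega>\<close>: the derivatives are taken in
  \<open>\<Omega>\<close> only and extend continuously to the closure.
\<close>

definition C2_closure :: "'a::euclidean_space set \<Rightarrow> ('a \<Rightarrow> real) \<Rightarrow> bool" where
  "C2_closure \<Omega> f \<longleftrightarrow>
     continuous_on (closure \<Omega>) f \<and>
     (\<exists>(D :: 'a \<Rightarrow> 'a \<Rightarrow>\<^sub>L real) (D2 :: 'a \<Rightarrow> 'a \<Rightarrow>\<^sub>L 'a \<Rightarrow>\<^sub>L real).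
        (\<forall>x\<in>\<Omega>. (f has_derivative blinfun_apply (D x)) (at x)) \<and>
        (\<forall>x\<in>\<Omega>. (D has_derivative blinfun_apply (D2 x)) (at x)) \<and>
        continuous_on (closure \<Omega>) D \<and> continuous_on (closure \<Omega>) D2)"

definition Gamma_closure ::
    "'a::euclidean_space carnot \<Rightarrow> nat \<Rightarrow> 'a set \<Rightarrow> ('a \<Rightarrow> real) \<Rightarrow> bool" where
  "Gamma_closure G k \<Omega> u \<longleftrightarrow>
     continuous_on (closure \<Omega>) u \<and>
     (\<forall>j js. j \<in> {1..hdim G} \<and> set js \<subseteq> {1..hdim G} \<and> length (j # js) \<le> k \<longrightarrow>
        (\<forall>g\<in>\<Omega>. X_exists G j (X_iter G js u) g) \<and>
        (\<exists>f. continuous_on (closure \<Omega>) f \<and> (\<forall>g\<in>\<Omega>. f g = X_iter G (j # js) u g)))"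


section \<open>Geometry of the boundary\<close>

text \<open>
  Nonvanishing of the differential is the same as nonvanishing of the Riemannian gradient.
\<close>

definition local_defining :: "'a::euclidean_space set \<Rightarrow> 'a \<Rightarrow> 'a set \<Rightarrow> ('a \<Rightarrow> real) \<Rightarrow> bool" where
  "local_defining \<Omega> p U \<phi> \<longleftrightarrow>
     open U \<and> p \<in> U \<and> C2_on U \<phi> \<and>
     (\<forall>x\<in>U. frechet_derivative \<phi> (at x) \<noteq> (\<lambda>v. 0)) \<and>
     \<Omega> \<inter> U = {x\<in>U. \<phi> x < 0}"

definition C2_open_set :: "'a::euclidean_space set \<Rightarrow> bool" where
  "C2_open_set \<Omega> \<longleftrightarrow> open \<Omega> \<and> (\<forall>p\<in>frontier \<Omega>. \<exists>U \<phi>. local_defining \<Omega> p U \<phi>)"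

definition outer_normal :: "'a::euclidean_space carnot \<Rightarrow> 'a set \<Rightarrow> 'a \<Rightarrow> 'a" where
  "outer_normal G \<Omega> p =
     (THE n. \<exists>U \<phi>. local_defining \<Omega> p U \<phi> \<and> n = rgrad G \<phi> p /\<^sub>R rnorm G p (rgrad G \<phi> p))"

definition angle_fun :: "'a::euclidean_space carnot \<Rightarrow> 'a set \<Rightarrow> 'a \<Rightarrow> real" where
  "angle_fun G \<Omega> p =
     sqrt (\<Sum>j=1..hdim G. (riem G p (outer_normal G \<Omega> p) (lfield G (frame G j) p))\<^sup>2)"

definition char_set :: "'a::euclidean_space carnot \<Rightarrow> 'a set \<Rightarrow> 'a set" where
  "char_set G \<Omega> = {p\<in>frontier \<Omega>. angle_fun G \<Omega> p = 0}"

definition Hcurv_of :: "'a::euclidean_space carnot \<Rightarrow> ('a \<Rightarrow> real) \<Rightarrow> 'a \<Rightarrow> real" where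
  "Hcurv_of G \<phi> p =
     ((rnorm G p (hgrad G \<phi> p))\<^sup>2 * hlap G \<phi> p - hinflap G \<phi> p) / (rnorm G p (hgrad G \<phi> p)) ^ 3"

text \<open>
  Off the characteristic set the value of \<open>Hcurv_of G \<phi> p\<close> is the same for all defining functions
  \<open>\<phi>\<close> near \<open>p\<close>, so the choice below is immaterial.
\<close>

definition Hcurv_nonchar :: "'a::euclidean_space carnot \<Rightarrow> 'a set \<Rightarrow> 'a \<Rightarrow> real" where
  "Hcurv_nonchar G \<Omega> p = (SOME h. \<exists>U \<phi>. local_defining \<Omega> p U \<phi> \<and> h = Hcurv_of G \<phi> p)"

text \<open>
  At a characteristic point the curvature is the finite limit along the noncharacteristic boundary
  points, if there is one; \<open>Hcurv_dom\<close> is the set of boundary points where it is defined.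
\<close>

definition Hcurv_dom :: "'a::euclidean_space carnot \<Rightarrow> 'a set \<Rightarrow> 'a set" where
  "Hcurv_dom G \<Omega> =
     (frontier \<Omega> - char_set G \<Omega>) \<union>
     {p\<in>char_set G \<Omega>. p islimpt (frontier \<Omega> - char_set G \<Omega>) \<and>
        (\<exists>h. (Hcurv_nonchar G \<Omega> \<longlongrightarrow> h) (at p within frontier \<Omega> - char_set G \<Omega>))}"

definition Hcurv :: "'a::euclidean_space carnot \<Rightarrow> 'a set \<Rightarrow> 'a \<Rightarrow> real" where
  "Hcurv G \<Omega> p =
     (if p \<in> char_set G \<Omega>
      then Lim (at p within frontier \<Omega> - char_set G \<Omega>) (Hcurv_nonchar G \<Omega>)
      else Hcurv_nonchar G \<Omega> p)"

end

theory Submission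
  imports Defs
begin

text \<open>
  Let \<open>n\<close> denote the horizontal conormal of \<open>\<partial>\<Omega>\<close>. In step two, \<open>(\<Delta>\<^sub>H u)\<^sup>2 - \<parallel>\<nabla>\<^sub>H\<^sup>2 u\<parallel>\<^sup>2 + 3/4 \<Sum> ([X\<^sub>i,X\<^sub>j] u)\<^sup>2\<close> is the
  divergence of the horizontal field with components
  \<open>X\<^sub>i u \<Delta>\<^sub>H u - \<Sum>\<^sub>j X\<^sub>j u (2 X\<^sub>j X\<^sub>i u - X\<^sub>i X\<^sub>j u)\<close>. If \<open>u = 0\<close> on \<open>\<partial>\<Omega>\<close>, its boundary flux is
  \<open>(\<partial>\<^sub>\<nu> u)\<^sup>2 \<bar>n\<bar>\<^sup>3 \<H>\<close>, at most \<open>M (\<partial>\<^sub>\<nu> u)\<^sup>2 \<bar>n\<bar>\<^sup>3\<close>, while the Rellich field \<open>\<bar>\<nabla>\<^sup>H u\<bar>\<^sup>2 \<Z> - 2 \<Z>u \<nabla>\<^sup>H u\<close>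
  has the flux \<open>- (\<partial>\<^sub>\<nu> u)\<^sup>2 \<bar>n\<bar>\<^sup>2 \<langle>\<Z>,\<nu>\<rangle>\<close>, which is at most \<open>- \<alpha> (\<partial>\<^sub>\<nu> u)\<^sup>2 \<bar>n\<bar>\<^sup>3\<close>, and the divergence
  \<open>(Q - 2) \<bar>\<nabla>\<^sup>H u\<bar>\<^sup>2 - 2 \<Z>u \<Delta>\<^sub>H u\<close>. Adding \<open>M/\<alpha>\<close> times the second field to the first thus makes the
  flux nonpositive. The \<open>H\<^sub>2\<close>-convexity discards the first two terms of the divergence, and
  \<open>\<Z>u \<Delta>\<^sub>H u\<close> is absorbed because \<open>(\<Z>u)\<^sup>2\<close> is bounded by \<open>\<bar>\<nabla>\<^sup>H u\<bar>\<^sup>2 + \<Sum> ([X\<^sub>i,X\<^sub>j] u)\<^sup>2\<close>, with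
  \<open>\<integral> \<bar>\<nabla>\<^sup>H u\<bar>\<^sup>2\<close> controlled by the energy identity and the Poincare inequality.

  Since \<open>u\<close> has third derivatives only in horizontal directions, these fields need not be \<open>C\<^sup>1\<close>. Only
  the implication from a nonpositive flux to a nonpositive integral of the divergence is needed; it
  follows from cutoffs near the boundary and the invariance of Lebesgue measure under the flows of
  left-invariant fields, without surface measure.
\<close>

section \<open>Lebesgue measure under linear maps\<close>

text \<open>The weights 2 and -1 in the first field are dictated by step two: with them the third
  derivatives of u in the divergence combine into double commutators [[X_j,X_i],X_i]u, which vanish.
  The symmetrised Hessian in their place would leave products of first derivatives of u with
  derivatives of its commutators. The price is an asymmetric quadratic form. Writing X_i X_j u as s
  + a/2 and X_j X_i u as s - a/2, it becomes s^2 - 3a^2/4 after summation, which is where 3/4 comes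
  from and why the commutators enter with a favourable sign.

  On the boundary the gradient of u is parallel to the conormal, so the antisymmetric part drops out
  of the flux and only tangential second derivatives remain; these are where curvature appears. The
  obstacle is that u is differentiable inside \<Omega> only, and its derivatives on the boundary are
  limits. Every boundary relation is therefore extracted from difference quotients on short segments
  placed just inside \<Omega>, at a depth quadratic in their length.\<close>

lemma nn_integral_lborel_translate:
  fixes h :: "'a::euclidean_space \<Rightarrow> ennreal"
  assumes [measurable]: "h \<in> borel_measurable borel"
  shows "(\<integral>\<^sup>+x. h (x + a) \<partial>lborel) = (\<integral>\<^sup>+x. h x \<partial>lborel)"
proof -
  have "(\<integral>\<^sup>+x. h x \<partial>lborel) = (\<integral>\<^sup>+x. h x \<partial>distr lborel borel ((+) a))"
    by (simp add: lborel_distr_plus)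
  also have "\<dots> = (\<integral>\<^sup>+x. h (a + x) \<partial>lborel)"
    by (subst nn_integral_distr) auto
  finally show ?thesis by (simp add: add.commute)
qed

text \<open>
  Uniqueness of Haar measure: the two evaluations of the double integral of
  \<open>\<beta> (f x) h (y)\<close>, before and after moving the translation from \<open>y\<close> to \<open>x\<close>.
\<close>

lemma nn_integral_linear_image_symmetric:
  fixes f f' :: "'a::euclidean_space \<Rightarrow> 'a" and \<beta> h :: "'a \<Rightarrow> ennreal"
  assumes lin: "linear f" and inv: "\<And>x. f (f' x) = x"
    and [measurable]: "\<beta> \<in> borel_measurable borel" "h \<in> borel_measurable borel"
    and even: "\<And>x. \<beta> (- x) = \<beta> x"
  shows "(\<integral>\<^sup>+x. \<beta> (f x) \<partial>lborel) * (\<integral>\<^sup>+y. h y \<partial>lborel)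
       = (\<integral>\<^sup>+x. \<beta> x \<partial>lborel) * (\<integral>\<^sup>+x. h (f x) \<partial>lborel)"
proof -
  have [measurable]: "f \<in> borel_measurable borel"
    using lin by (intro borel_measurable_continuous_onI linear_continuous_on linear_conv_bounded_linear[THEN iffD1])
  have "(\<integral>\<^sup>+x. \<beta> (f x) \<partial>lborel) * (\<integral>\<^sup>+y. h y \<partial>lborel)
      = (\<integral>\<^sup>+x. (\<integral>\<^sup>+y. \<beta> (f x) * h (y + f x) \<partial>lborel) \<partial>lborel)"
    by (simp add: nn_integral_cmult nn_integral_multc nn_integral_lborel_translate)
  also have "\<dots> = (\<integral>\<^sup>+y. (\<integral>\<^sup>+x. \<beta> (f x) * h (y + f x) \<partial>lborel) \<partial>lborel)"
    by (rule lborel_pair.Fubini') measurable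
  also have "\<dots> = (\<integral>\<^sup>+y. (\<integral>\<^sup>+x. \<beta> (f x - y) * h (f x) \<partial>lborel) \<partial>lborel)"
  proof (rule nn_integral_cong)
    fix y :: 'a
    have "(\<integral>\<^sup>+x. \<beta> (f x) * h (y + f x) \<partial>lborel)
        = (\<integral>\<^sup>+x. \<beta> (f (x + f' (- y))) * h (y + f (x + f' (- y))) \<partial>lborel)"
      by (rule nn_integral_lborel_translate[symmetric]) measurable
    also have "\<dots> = (\<integral>\<^sup>+x. \<beta> (f x - y) * h (f x) \<partial>lborel)"
      by (simp add: linear_add[OF lin] inv)
    finally show "(\<integral>\<^sup>+x. \<beta> (f x) * h (y + f x) \<partial>lborel) = (\<integral>\<^sup>+x. \<beta> (f x - y) * h (f x) \<partial>lborel)" .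
  qed
  also have "\<dots> = (\<integral>\<^sup>+x. (\<integral>\<^sup>+y. \<beta> (f x - y) * h (f x) \<partial>lborel) \<partial>lborel)"
    by (rule lborel_pair.Fubini'[symmetric]) measurable
  also have "\<dots> = (\<integral>\<^sup>+x. (\<integral>\<^sup>+y. \<beta> (y + - f x) \<partial>lborel) * h (f x) \<partial>lborel)"
  proof (intro nn_integral_cong)
    fix x
    have *: "\<beta> (f x - y) = \<beta> (y + - f x)" for y
      using even[of "f x - y"] by simp
    show "(\<integral>\<^sup>+y. \<beta> (f x - y) * h (f x) \<partial>lborel) = (\<integral>\<^sup>+y. \<beta> (y + - f x) \<partial>lborel) * h (f x)"
      unfolding * by (rule nn_integral_multc) measurable
  qed
  also have "\<dots> = (\<integral>\<^sup>+x. \<beta> x \<partial>lborel) * (\<integral>\<^sup>+x. h (f x) \<partial>lborel)"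
    unfolding nn_integral_lborel_translate[OF assms(3)] by (rule nn_integral_cmult) measurable
  finally show ?thesis .
qed

text \<open>The indicator of the unit ball serves as the even weight in the previous identity. Its
  integral is positive and finite, so it may be divided out, and the scaling factor appears as a
  ratio of two volumes without any determinant.\<close>

lemma nn_integral_linear_image:
  fixes f f' :: "'a::euclidean_space \<Rightarrow> 'a"
  assumes lin: "linear f" and inv: "\<And>x. f (f' x) = x" and h: "h \<in> borel_measurable borel"
  shows "(\<integral>\<^sup>+x. h (f x) \<partial>lborel)
       = emeasure lborel (f -` cball 0 1) / emeasure lborel (cball (0::'a) 1) * (\<integral>\<^sup>+x. h x \<partial>lborel)"
proof -
  let ?B = "cball (0::'a) 1"
  let ?b = "indicator ?B :: 'a \<Rightarrow> ennreal"
  have fm: "f \<in> borel_measurable borel"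
    using lin by (intro borel_measurable_continuous_onI linear_continuous_on linear_conv_bounded_linear[THEN iffD1])
  have B: "emeasure lborel ?B \<noteq> 0" "emeasure lborel ?B \<noteq> top"
    using unit_ball_vol_pos[of "real DIM('a)"] by (auto simp: emeasure_cball simp del: unit_ball_vol_pos)
  have fB: "f -` ?B \<in> sets lborel"
    using measurable_sets[OF fm, of ?B] by simp
  have "(\<integral>\<^sup>+x. ?b (f x) \<partial>lborel) = (\<integral>\<^sup>+x. indicator (f -` ?B) x \<partial>lborel)"
    by (intro nn_integral_cong) (auto simp: indicator_def)
  also have "\<dots> = emeasure lborel (f -` ?B)" using fB by (rule nn_integral_indicator)
  finally have b2: "(\<integral>\<^sup>+x. ?b (f x) \<partial>lborel) = emeasure lborel (f -` ?B)" .
  have "(\<integral>\<^sup>+x. ?b (f x) \<partial>lborel) * (\<integral>\<^sup>+x. h x \<partial>lborel)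
      = (\<integral>\<^sup>+x. ?b x \<partial>lborel) * (\<integral>\<^sup>+x. h (f x) \<partial>lborel)"
    by (rule nn_integral_linear_image_symmetric[OF lin inv _ h]) (auto simp: indicator_def)
  then have *: "(\<integral>\<^sup>+x. h (f x) \<partial>lborel) * emeasure lborel ?B
      = emeasure lborel (f -` ?B) * (\<integral>\<^sup>+x. h x \<partial>lborel)"
    unfolding b2 by (simp add: mult.commute)
  have "(\<integral>\<^sup>+x. h (f x) \<partial>lborel) = (\<integral>\<^sup>+x. h (f x) \<partial>lborel) * emeasure lborel ?B / emeasure lborel ?B"
    using B by (intro mult_divide_eq_ennreal[symmetric]) auto
  also have "\<dots> = emeasure lborel (f -` ?B) * (\<integral>\<^sup>+x. h x \<partial>lborel) / emeasure lborel ?B"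
    unfolding * ..
  finally show ?thesis by (simp add: divide_ennreal_def mult_ac)
qed

lemma nn_integral_involutive_isometry:
  fixes f :: "'a::euclidean_space \<Rightarrow> 'a"
  assumes lin: "linear f" and inv: "\<And>x. f (f x) = x" and iso: "\<And>x. norm (f x) = norm x"
    and h: "h \<in> borel_measurable borel"
  shows "(\<integral>\<^sup>+x. h (f x) \<partial>lborel) = (\<integral>\<^sup>+x. h x \<partial>lborel)"
proof -
  have "f -` cball 0 1 = cball 0 1" by (auto simp: iso)
  moreover have "emeasure lborel (cball (0::'a) 1) \<noteq> 0" "emeasure lborel (cball (0::'a) 1) \<noteq> top"
    using unit_ball_vol_pos[of "real DIM('a)"] by (auto simp: emeasure_cball simp del: unit_ball_vol_pos)
  ultimately show ?thesis
    unfolding nn_integral_linear_image[OF lin inv h]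
    by (simp add: ennreal_divide_self less_top)
qed

text \<open>
  The reflection \<open>\<sigma>\<close> conjugates the shear \<open>I + N\<close> to its inverse \<open>I - N\<close>, so the scaling factor of
  the shear is its own inverse.
\<close>

lemma nn_integral_shear:
  fixes N \<sigma> :: "'a::euclidean_space \<Rightarrow> 'a"
  assumes N: "linear N" "\<And>x. N (N x) = 0"
    and \<sigma>: "linear \<sigma>" "\<And>x. \<sigma> (\<sigma> x) = x" "\<And>x. norm (\<sigma> x) = norm x"
    and N\<sigma>: "\<And>x. N (\<sigma> x) = N x" "\<And>x. \<sigma> (N x) = - N x"
    and h: "h \<in> borel_measurable borel"
  shows "(\<integral>\<^sup>+x. h (x + N x) \<partial>lborel) = (\<integral>\<^sup>+x. h x \<partial>lborel)"
proof -
  define c where "c = emeasure lborel ((\<lambda>x. x + N x) -` cball 0 1) / emeasure lborel (cball (0::'a) 1)"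
  have lin: "linear (\<lambda>x. x + N x)"
    using N(1) by (intro linear_compose_add linear_ident)
  have inv: "(x - N x) + N (x - N x) = x" for x
    using N by (simp add: linear_diff)
  note cont = borel_measurable_continuous_onI linear_continuous_on linear_conv_bounded_linear[THEN iffD1]
  have m: "\<sigma> \<in> borel_measurable borel" "N \<in> borel_measurable borel"
    using \<sigma>(1) N(1) by (auto intro!: cont)
  have L: "(\<integral>\<^sup>+x. k (x + N x) \<partial>lborel) = c * (\<integral>\<^sup>+x. k x \<partial>lborel)"
    if "k \<in> borel_measurable borel" for k
    unfolding c_def by (rule nn_integral_linear_image[OF lin inv that])
  have L': "(\<integral>\<^sup>+x. k (x - N x) \<partial>lborel) = c * (\<integral>\<^sup>+x. k x \<partial>lborel)"
    if [measurable]: "k \<in> borel_measurable borel" for k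
  proof -
    note [measurable] = m
    have "(\<integral>\<^sup>+x. k (x - N x) \<partial>lborel) = (\<integral>\<^sup>+x. k (\<sigma> x - N (\<sigma> x)) \<partial>lborel)"
      by (rule nn_integral_involutive_isometry[OF \<sigma>, symmetric]) measurable
    also have "\<dots> = (\<integral>\<^sup>+x. k (\<sigma> (x + N x)) \<partial>lborel)"
      using \<sigma>(1) N\<sigma> by (simp add: linear_add)
    also have "\<dots> = c * (\<integral>\<^sup>+x. k (\<sigma> x) \<partial>lborel)"
      by (rule L) measurable
    also have "(\<integral>\<^sup>+x. k (\<sigma> x) \<partial>lborel) = (\<integral>\<^sup>+x. k x \<partial>lborel)"
      by (rule nn_integral_involutive_isometry[OF \<sigma>]) measurable
    finally show ?thesis .
  qed
  have c2: "(\<integral>\<^sup>+x. k x \<partial>lborel) = c * (c * (\<integral>\<^sup>+x. k x \<partial>lborel))"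
    if [measurable]: "k \<in> borel_measurable borel" for k :: "'a \<Rightarrow> ennreal"
  proof -
    note [measurable] = m
    have "(\<integral>\<^sup>+x. k x \<partial>lborel) = (\<integral>\<^sup>+x. k ((x + N x) - N (x + N x)) \<partial>lborel)"
      using N by (simp add: linear_add)
    also have "\<dots> = c * (\<integral>\<^sup>+x. k (x - N x) \<partial>lborel)"
      by (rule L) measurable
    also have "\<dots> = c * (c * (\<integral>\<^sup>+x. k x \<partial>lborel))"
      by (simp add: L')
    finally show ?thesis .
  qed
  obtain b where b: "0 < b" "emeasure lborel (cball (0::'a) 1) = ennreal b"
    by (rule that[of "unit_ball_vol (real DIM('a))"]) (simp_all add: emeasure_cball)
  \<comment> \<open>Shearing forth and back scales by \<open>c * c\<close>. The ball has positive
    finite measure, so this forces \<open>c = 1\<close> once the value \<open>top\<close> is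
    excluded.\<close>
  have "ennreal b = c * (c * ennreal b)"
    unfolding b(2)[symmetric] using c2[of "indicator (cball 0 1)", OF borel_measurable_indicator] by simp
  then have "c = 1"
  proof (cases c rule: ennreal_cases)
    case (real r)
    then have "b = r * (r * b)"
      using \<open>ennreal b = c * (c * ennreal b)\<close> b by (simp flip: ennreal_mult)
    then have "r * r = 1" using b by simp
    then have "r = 1" using real by (metis abs_of_nonneg real_sqrt_abs2 real_sqrt_one)
    then show ?thesis using real by simp
  next
    case top
    then show ?thesis using \<open>ennreal b = c * (c * ennreal b)\<close> b
      by (simp add: ennreal_top_mult split: if_splits)
  qed
  then show ?thesis using L[OF h] by simp
qed

section \<open>The group structure\<close>

locale carnot2 =
  fixes G :: "'a::euclidean_space carnot"
  assumes carnot: "carnot_step2 G"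
begin

abbreviation br :: "'a \<Rightarrow> 'a \<Rightarrow> 'a" where "br \<equiv> bracket G"
abbreviation e :: "nat \<Rightarrow> 'a" where "e \<equiv> frame G"
definition I :: "nat set" where "I = {1..hdim G}"

lemma finite_I [simp]: "finite I" by (simp add: I_def)

text \<open>Closed form of \<open>lfield\<close>: the group law is affine in its second factor, so
  the derivative along \<open>t *\<^sub>R \<xi>\<close> can be read off. Vertical
  \<open>\<xi>\<close> are included.\<close>

definition lf :: "'a \<Rightarrow> 'a \<Rightarrow> 'a" where
  "lf \<xi> g = \<xi> + (1/2) *\<^sub>R br g \<xi>"

definition hproj :: "'a \<Rightarrow> 'a" where
  "hproj g = (\<Sum>i\<in>I. (g \<bullet> e i) *\<^sub>R e i)"

lemma linear_br_right: "linear (br x)" and linear_br_left: "linear (\<lambda>x. br x y)"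
  using carnot by (auto simp: carnot_step2_def lie_bracket_def)

lemma bounded_linear_br_left: "bounded_linear (\<lambda>x. br x y)"
  and bounded_linear_br_right: "bounded_linear (br x)"
  using linear_br_left linear_br_right linear_conv_bounded_linear by blast+

lemma br_self [simp]: "br x x = 0"
  and jacobi: "br x (br y z) + br y (br z x) + br z (br x y) = 0"
  using carnot by (auto simp: carnot_step2_def lie_bracket_def)

lemmas br_lin [simp] =
  linear_add[OF linear_br_right] linear_add[OF linear_br_left]
  linear_diff[OF linear_br_right] linear_diff[OF linear_br_left]
  linear_scale[OF linear_br_right] linear_scale[OF linear_br_left]
  linear_0[OF linear_br_right] linear_0[OF linear_br_left]
  linear_neg[OF linear_br_right] linear_neg[OF linear_br_left]

lemma br_antisym: "br x y = - br y x"
proof -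
  have "br (x + y) (x + y) = br x y + br y x" by (simp del: br_self add: br_self[of x] br_self[of y])
  then have "br x y + br y x = 0" unfolding br_self by simp
  then show ?thesis by (simp add: eq_neg_iff_add_eq_0)
qed

lemma layers_decomp: obtains v w where "v \<in> V1 G" "w \<in> V2 G" "x = v + w"
  using carnot unfolding carnot_step2_def by blast

lemma layers:
  shows subspace_V1: "subspace (V1 G)" and subspace_V2: "subspace (V2 G)" and V2_nontrivial: "V2 G \<noteq> {0}"
    and V1_V2_orth: "\<And>v w. v \<in> V1 G \<Longrightarrow> w \<in> V2 G \<Longrightarrow> v \<bullet> w = 0"
    and V2_span: "span {br v v' | v v'. v \<in> V1 G \<and> v' \<in> V1 G} = V2 G"
    and br_V1_V2: "\<And>v w. v \<in> V1 G \<Longrightarrow> w \<in> V2 G \<Longrightarrow> br v w = 0"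
    and frame_V1: "\<And>i. i \<in> I \<Longrightarrow> e i \<in> V1 G"
    and frame_orth: "\<And>i j. i \<in> I \<Longrightarrow> j \<in> I \<Longrightarrow> e i \<bullet> e j = (if i = j then 1 else 0)"
  using carnot unfolding carnot_step2_def I_def by simp_all

text \<open>\<open>V2 G\<close> is spanned by brackets of horizontal vectors, and the Jacobi
  identity expresses the bracket of w with such a bracket through brackets of w with horizontal
  vectors, which vanish by the grading.\<close>

lemma br_V2_V2: assumes "w \<in> V2 G" "w' \<in> V2 G" shows "br w w' = 0"
proof -
  have "w' \<in> span {br v v' | v v'. v \<in> V1 G \<and> v' \<in> V1 G}" using assms V2_span by simp
  then show ?thesis
  proof (induction rule: span_induct_alt)
    case base then show ?case by simp
  next
    case (step c x y)
    then obtain v v' where x: "x = br v v'" "v \<in> V1 G" "v' \<in> V1 G" by auto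
    have "br w x = 0"
      using jacobi[of w v v'] br_V1_V2[of v w] br_V1_V2[of v' w] assms x br_antisym[of w v] by simp
    with step show ?case by simp
  qed
qed

lemma br_V2 [simp]: assumes "w \<in> V2 G" shows "br x w = 0" "br w x = 0"
proof -
  show "br x w = 0"
    using assms by (rule_tac layers_decomp[of x]) (simp add: br_V1_V2 br_V2_V2)
  then show "br w x = 0" using br_antisym[of w x] by simp
qed

lemma br_in_V2: "br x y \<in> V2 G"
proof -
  obtain v w where x: "v \<in> V1 G" "w \<in> V2 G" "x = v + w" by (rule layers_decomp)
  obtain v' w' where y: "v' \<in> V1 G" "w' \<in> V2 G" "y = v' + w'" by (rule layers_decomp)
  have "br x y = br v v'" using x y by simp
  also have "\<dots> \<in> V2 G" using x y V2_span by (metis (mono_tags, lifting) mem_Collect_eq span_base)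
  finally show ?thesis .
qed

lemma br_br [simp]: "br x (br y z) = 0" "br (br y z) x = 0"
  using br_in_V2 by simp_all

text \<open>The axioms only place an orthonormal family inside \<open>V1 G\<close>. That it spans
  follows by counting: orthonormal vectors are independent, and there are \<open>dim (V1 G)\<close>
  of them.\<close>

lemma frame_expand:
  assumes "v \<in> V1 G" shows "hproj v = v"
proof -
  have inj: "inj_on e I"
    by (rule inj_onI) (metis frame_orth zero_neq_one)
  have po: "pairwise orthogonal (e ` I)"
    unfolding pairwise_def orthogonal_def using frame_orth by auto
  have n1: "norm x = 1" if "x \<in> e ` I" for x
    using that frame_orth by (auto simp: norm_eq_sqrt_inner)
  have ind: "independent (e ` I)"
    by (rule pairwise_orthogonal_independent[OF po]) (use n1 in force)
  have "V1 G \<subseteq> span (e ` I)"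
    by (rule card_ge_dim_independent[OF _ ind]) (use frame_V1 inj in \<open>auto simp: card_image I_def hdim_def\<close>)
  then have "(\<Sum>b\<in>e ` I. (v \<bullet> b) *\<^sub>R b) = v"
    using assms by (intro orthonormal_basis_expand po n1) auto
  then show ?thesis unfolding hproj_def by (simp add: sum.reindex[OF inj])
qed

lemma linear_hproj: "linear hproj"
  unfolding hproj_def
  by (intro linear_compose_sum ballI linearI) (auto simp: inner_add_left scaleR_add_left)

lemma hproj_V2: "w \<in> V2 G \<Longrightarrow> hproj w = 0"
  unfolding hproj_def by (intro sum.neutral ballI) (metis V1_V2_orth frame_V1 inner_commute scaleR_zero_left)

lemma hproj_decomp: assumes "v \<in> V1 G" "w \<in> V2 G" shows "hproj (v + w) = v"
  using assms frame_expand hproj_V2 by (simp add: linear_add[OF linear_hproj])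

lemma hproj_V1: "hproj g \<in> V1 G" and vproj_V2: "g - hproj g \<in> V2 G"
  by (rule layers_decomp[of g]; simp add: hproj_decomp)+

lemma br_hproj [simp]: "br (hproj g) x = br g x" "br x (hproj g) = br x g"
proof -
  have "br (g - hproj g) x = 0" "br x (g - hproj g) = 0" by (intro br_V2 vproj_V2)+
  then show "br (hproj g) x = br g x" "br x (hproj g) = br x g" by simp_all
qed

text \<open>The double bracket vanishes, so the velocity is constant along the line: in step two the
  integral curves of left-invariant fields are straight lines in these coordinates. All later flows
  are written as such lines.\<close>

lemma lf_flow [simp]: "lf \<xi> (g + t *\<^sub>R lf \<xi> g) = lf \<xi> g"
  by (simp add: lf_def)

lemma lf_lin: "lf (x + y) g = lf x g + lf y g" "lf (c *\<^sub>R x) g = c *\<^sub>R lf x g"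
   "lf (- x) g = - lf x g" "lf (x - y) g = lf x g - lf y g" "lf 0 g = 0"
  by (simp_all add: lf_def algebra_simps)

lemma lf_sum: "lf (\<Sum>i\<in>A. c i *\<^sub>R x i) g = (\<Sum>i\<in>A. c i *\<^sub>R lf (x i) g)"
  by (induction A rule: infinite_finite_induct) (simp_all add: lf_lin)

lemma lf_inverse: "lf (v - (1/2) *\<^sub>R br g v) g = v" "lf v g - (1/2) *\<^sub>R br g (lf v g) = v"
  by (simp_all add: lf_def)

lemma lf_V2 [simp]: "w \<in> V2 G \<Longrightarrow> lf w g = w"
  by (simp add: lf_def)

lemma gmul_flow: "gmul G g (t *\<^sub>R \<xi>) = g + t *\<^sub>R lf \<xi> g"
  by (simp add: gmul_def lf_def algebra_simps)

lemma lfield_eq: "lfield G \<xi> g = lf \<xi> g"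
  unfolding lfield_def gmul_flow
  by (rule vector_derivative_at) (auto intro!: derivative_eq_intros)

lemma continuous_lf [continuous_intros]: "continuous_on S f \<Longrightarrow> continuous_on S (\<lambda>x. lf \<xi> (f x))"
  unfolding lf_def using bounded_linear.continuous_on[OF bounded_linear_br_left]
  by (intro continuous_intros) auto

text \<open>The flow at time t is the shear \<open>g + (t/2) *\<^sub>R br g \<xi>\<close> followed
  by a translation. The reflection that fixes the horizontal layer and reverses the vertical one
  meets the requirements of the shear lemma, because brackets are vertical and see only horizontal
  parts.\<close>

lemma nn_integral_flow:
  assumes h: "h \<in> borel_measurable borel"
  shows "(\<integral>\<^sup>+g. h (g + t *\<^sub>R lf \<xi> g) \<partial>lborel) = (\<integral>\<^sup>+g. h g \<partial>lborel)"
proof -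
  let ?N = "\<lambda>g. (t/2) *\<^sub>R br g \<xi>" and ?\<sigma> = "\<lambda>g. hproj g - (g - hproj g)"
  have norm: "norm (?\<sigma> x) = norm x" for x
  proof -
    let ?v = "hproj x" and ?w = "x - hproj x"
    have o: "?v \<bullet> ?w = 0" by (rule V1_V2_orth[OF hproj_V1 vproj_V2])
    have "norm (?v - ?w) = norm (?v + ?w)"
      unfolding norm_eq_sqrt_inner using o by (simp add: inner_diff inner_add inner_commute)
    then show ?thesis by simp
  qed
  have hh: "hproj (hproj x) = hproj x" for x by (rule frame_expand[OF hproj_V1])
  have "(\<integral>\<^sup>+g. h (g + t *\<^sub>R lf \<xi> g) \<partial>lborel) = (\<integral>\<^sup>+g. h ((g + ?N g) + t *\<^sub>R \<xi>) \<partial>lborel)"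
    by (simp add: lf_def algebra_simps)
  also have "\<dots> = (\<integral>\<^sup>+g. h (g + t *\<^sub>R \<xi>) \<partial>lborel)"
  proof (rule nn_integral_shear[where N="?N" and \<sigma>="?\<sigma>" and h="\<lambda>g. h (g + t *\<^sub>R \<xi>)"])
    show "linear ?N" by (rule linearI) (simp_all add: algebra_simps)
    show "linear ?\<sigma>" using linear_hproj
      by (intro linear_compose_sub linear_ident)
    show "(\<lambda>g. h (g + t *\<^sub>R \<xi>)) \<in> borel_measurable borel" using h by measurable
  qed (auto simp: norm hh linear_diff[OF linear_hproj] linear_scale[OF linear_hproj] hproj_V2 br_in_V2)
  also have "\<dots> = (\<integral>\<^sup>+g. h g \<partial>lborel)" by (rule nn_integral_lborel_translate[OF h])
  finally show ?thesis .
qed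

lemma flow_measurable: "(\<lambda>g. g + t *\<^sub>R lf \<xi> g) \<in> borel_measurable borel"
  by (intro borel_measurable_continuous_onI continuous_intros)

lemma integral_flow:
  fixes f :: "'a \<Rightarrow> real"
  assumes f: "f \<in> borel_measurable borel"
  shows "(\<integral>g. f (g + t *\<^sub>R lf \<xi> g) \<partial>lborel) = (\<integral>g. f g \<partial>lborel)"
proof -
  have "distr lborel borel (\<lambda>g. g + t *\<^sub>R lf \<xi> g) = lborel"
  proof (rule measure_eqI)
    fix A assume "A \<in> sets (distr lborel borel (\<lambda>g. g + t *\<^sub>R lf \<xi> g))"
    then have A: "A \<in> sets borel" by simp
    have "emeasure (distr lborel borel (\<lambda>g. g + t *\<^sub>R lf \<xi> g)) A = (\<integral>\<^sup>+g. indicator A (g + t *\<^sub>R lf \<xi> g) \<partial>lborel)"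
      using A flow_measurable by (subst nn_integral_distr[symmetric]) auto
    also have "\<dots> = (\<integral>\<^sup>+g. indicator A g \<partial>lborel)"
      using A by (intro nn_integral_flow) auto
    finally show "emeasure (distr lborel borel (\<lambda>g. g + t *\<^sub>R lf \<xi> g)) A = emeasure lborel A"
      using A by simp
  qed simp
  then have "(\<integral>g. f g \<partial>lborel) = (\<integral>g. f g \<partial>distr lborel borel (\<lambda>g. g + t *\<^sub>R lf \<xi> g))" by simp
  also have "\<dots> = (\<integral>g. f (g + t *\<^sub>R lf \<xi> g) \<partial>lborel)"
    using f flow_measurable by (intro integral_distr) auto
  finally show ?thesis by simp
qed

section \<open>Integration by parts along left-invariant fields\<close>

text \<open>A relational derivative, carrying existence and value together, for every
  \<open>\<xi>\<close> of the Lie algebra and not only for the frame. Nothing is asked of f in other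
  directions.\<close>

definition has_X :: "'a \<Rightarrow> ('a \<Rightarrow> real) \<Rightarrow> real \<Rightarrow> 'a \<Rightarrow> bool" where
  "has_X \<xi> f d g \<longleftrightarrow> ((\<lambda>t. f (g + t *\<^sub>R lf \<xi> g)) has_real_derivative d) (at 0)"

lemma has_X_flow:
  assumes "has_X \<xi> f d (g + t *\<^sub>R lf \<xi> g)"
  shows "((\<lambda>t. f (g + t *\<^sub>R lf \<xi> g)) has_real_derivative d) (at t)"
proof -
  have "((\<lambda>s. f (g + (s + t) *\<^sub>R lf \<xi> g)) has_real_derivative d) (at 0)"
    using assms by (simp add: has_X_def algebra_simps)
  then show ?thesis using DERIV_shift[of "\<lambda>t. f (g + t *\<^sub>R lf \<xi> g)" d 0 t] by simp
qed

lemma has_X_unique: "has_X \<xi> f d g \<Longrightarrow> has_X \<xi> f d' g \<Longrightarrow> d = d'"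
  unfolding has_X_def by (rule DERIV_unique)

lemma has_X_X: "has_X (e i) f d g \<Longrightarrow> X G i f g = d"
  unfolding has_X_def X_def gmul_flow by (rule DERIV_imp_deriv)

lemma eventually_flow:
  assumes "open U" "g \<in> U" shows "eventually (\<lambda>t. g + t *\<^sub>R lf \<xi> g \<in> U) (nhds 0)"
proof -
  have "((\<lambda>t. g + t *\<^sub>R lf \<xi> g) \<longlongrightarrow> g + 0 *\<^sub>R lf \<xi> g) (at 0)" by (intro tendsto_intros)
  then have "eventually (\<lambda>t. g + t *\<^sub>R lf \<xi> g \<in> U) (at 0)"
    using assms by (simp add: topological_tendstoD)
  then show ?thesis using assms by (auto simp: eventually_at_filter elim: eventually_mono)
qed

lemma has_X_cong_open:
  assumes "open U" "g \<in> U" "\<And>x. x \<in> U \<Longrightarrow> f x = f' x"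
  shows "has_X \<xi> f d g \<longleftrightarrow> has_X \<xi> f' d g"
  unfolding has_X_def
  by (rule DERIV_cong_ev[OF refl _ refl], rule eventually_mono[OF eventually_flow[OF assms(1,2)]]) (rule assms(3))

lemma has_X_const: "has_X \<xi> (\<lambda>_. c) 0 g"
  and has_X_add: "has_X \<xi> f d g \<Longrightarrow> has_X \<xi> f' d' g \<Longrightarrow> has_X \<xi> (\<lambda>x. f x + f' x) (d + d') g"
  and has_X_diff: "has_X \<xi> f d g \<Longrightarrow> has_X \<xi> f' d' g \<Longrightarrow> has_X \<xi> (\<lambda>x. f x - f' x) (d - d') g"
  and has_X_mult: "has_X \<xi> f d g \<Longrightarrow> has_X \<xi> f' d' g \<Longrightarrow> has_X \<xi> (\<lambda>x. f x * f' x) (d * f' g + d' * f g) g"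
  and has_X_cmult: "has_X \<xi> f d g \<Longrightarrow> has_X \<xi> (\<lambda>x. c * f x) (c * d) g"
  unfolding has_X_def
  using DERIV_mult[of "\<lambda>t. f (g + t *\<^sub>R lf \<xi> g)" d 0 UNIV "\<lambda>t. f' (g + t *\<^sub>R lf \<xi> g)" d']
  by (simp_all add: DERIV_add DERIV_diff DERIV_cmult)

lemma has_X_sum:
  "(\<And>i. i \<in> A \<Longrightarrow> has_X \<xi> (f i) (d i) g) \<Longrightarrow> has_X \<xi> (\<lambda>x. \<Sum>i\<in>A. f i x) (\<Sum>i\<in>A. d i) g"
  unfolding has_X_def by (rule DERIV_sum)

lemma has_X_has_derivative:
  assumes "(f has_derivative D) (at g)" shows "has_X \<xi> f (D (lf \<xi> g)) g"
proof -
  have "((\<lambda>t. g + t *\<^sub>R lf \<xi> g) has_derivative (\<lambda>t. t *\<^sub>R lf \<xi> g)) (at 0)"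
    by (auto intro!: derivative_eq_intros)
  then have "((\<lambda>t. f (g + t *\<^sub>R lf \<xi> g)) has_derivative (\<lambda>t. D (t *\<^sub>R lf \<xi> g))) (at 0)"
    by (rule has_derivative_compose) (use assms in simp)
  moreover have "D (t *\<^sub>R lf \<xi> g) = D (lf \<xi> g) * t" for t
    using has_derivative_linear[OF assms] by (simp add: linear_scale mult.commute)
  ultimately show ?thesis by (simp add: has_X_def has_field_derivative_def)
qed

lemma flow_mvt:
  assumes "0 < h" "\<And>t. 0 \<le> t \<Longrightarrow> t \<le> h \<Longrightarrow> has_X \<xi> f (f' (g + t *\<^sub>R lf \<xi> g)) (g + t *\<^sub>R lf \<xi> g)"
  obtains t where "0 < t" "t < h" "f (g + h *\<^sub>R lf \<xi> g) - f g = h * f' (g + t *\<^sub>R lf \<xi> g)"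
proof -
  have "\<exists>t>0. t < h \<and> f (g + h *\<^sub>R lf \<xi> g) - f (g + 0 *\<^sub>R lf \<xi> g) = (h - 0) * f' (g + t *\<^sub>R lf \<xi> g)"
    by (rule MVT2) (use assms(1) has_X_flow[OF assms(2)] in auto)
  then show ?thesis using that by auto
qed

text \<open>By flow invariance every difference quotient along the flow has integral zero. The
  quotients converge to the derivative and are dominated through the mean value theorem, so that
  differentiability along the single direction \<open>\<xi>\<close> is all that is used.\<close>

lemma integral_X_eq_0:
  assumes K: "compact K" and f0: "\<And>g. g \<notin> K \<Longrightarrow> f g = 0"
    and f: "continuous_on UNIV f" and f': "continuous_on UNIV f'"
    and X: "\<And>g. has_X \<xi> f (f' g) g"
  shows "integrable lborel f'" "(\<integral>g. f' g \<partial>lborel) = 0"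
proof -
  have f'0: "f' g = 0" if "g \<notin> K" for g
  proof -
    have "has_X \<xi> f 0 g \<longleftrightarrow> has_X \<xi> (\<lambda>_. 0) 0 g"
      by (rule has_X_cong_open[of "- K"]) (use K that f0 in \<open>auto simp: compact_imp_closed open_Compl\<close>)
    then show ?thesis using X has_X_unique has_X_const by blast
  qed
  have int: "integrable lborel h" if "continuous_on UNIV h" "\<And>g. g \<notin> K \<Longrightarrow> h g = 0" for h :: "'a \<Rightarrow> real"
  proof -
    have "integrable lborel (\<lambda>x. indicator K x *\<^sub>R h x)"
      by (rule borel_integrable_compact[OF K]) (use that continuous_on_subset in blast)
    moreover have "(\<lambda>x. indicator K x *\<^sub>R h x) = h" using that(2) by (force simp: indicator_def)
    ultimately show ?thesis by simp
  qed
  show if': "integrable lborel f'" by (rule int[OF f' f'0])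
  have fm [measurable]: "f \<in> borel_measurable borel" "f' \<in> borel_measurable borel"
    using f f' by (auto intro: borel_measurable_continuous_onI)
  note flm [measurable] = flow_measurable
  obtain B where B: "\<And>g. \<bar>f' g\<bar> \<le> B" 
  proof -
    have "bounded (f' ` K)"
      by (intro compact_imp_bounded compact_continuous_image K continuous_on_subset[OF f']) auto
    then obtain B where "\<And>g. g \<in> K \<Longrightarrow> \<bar>f' g\<bar> \<le> B" by (auto simp: bounded_iff)
    then have "\<bar>f' g\<bar> \<le> \<bar>B\<bar>" for g using f'0[of g] by (cases "g \<in> K") (simp_all add: order_trans[OF _ abs_ge_self])
    then show ?thesis by (rule that)
  qed
  \<comment> \<open>Contains every starting point from which the flow meets \<open>K\<close> within
    time one. This compact set carries the dominating function for all difference quotients at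
    once.\<close>
  define K' where "K' = (\<lambda>(t, g). g - t *\<^sub>R lf \<xi> g) ` ({0..1} \<times> K)"
  have K': "compact K'" unfolding K'_def split_beta
    by (intro compact_continuous_image compact_Times K continuous_intros) auto
  have inK': "g \<in> K'" if "0 \<le> t" "t \<le> 1" "g + t *\<^sub>R lf \<xi> g \<in> K" for g t
  proof -
    show ?thesis unfolding K'_def
      by (rule image_eqI[of _ _ "(t, g + t *\<^sub>R lf \<xi> g)"]) (use that in simp_all)
  qed
  define h where "h n = 1 / (real n + 1)" for n
  have h: "0 < h n" "h n \<le> 1" for n by (auto simp: h_def)
  have h_lim: "h \<longlonglongrightarrow> 0" unfolding h_def using LIMSEQ_inverse_real_of_nat by (simp add: inverse_eq_divide add.commute)
  define q where "q n g = (f (g + h n *\<^sub>R lf \<xi> g) - f g) / h n" for n g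
  have [measurable]: "q n \<in> borel_measurable borel" for n
    unfolding q_def by (intro borel_measurable_divide borel_measurable_diff borel_measurable_const fm
        measurable_compose[OF flow_measurable fm(1)])
  have qmvt: "\<exists>t. 0 < t \<and> t < h n \<and> q n g = f' (g + t *\<^sub>R lf \<xi> g)" for n g
  proof -
    obtain t where "0 < t" "t < h n" "f (g + h n *\<^sub>R lf \<xi> g) - f g = h n * f' (g + t *\<^sub>R lf \<xi> g)"
      by (rule flow_mvt[OF h(1)[of n] X])
    moreover have "q n g = f' (g + t *\<^sub>R lf \<xi> g)"
      unfolding q_def calculation(3) using h(1)[of n] by simp
    ultimately show ?thesis by blast
  qed
  have intf: "integrable lborel f" by (rule int[OF f f0])
  have intfl: "integrable lborel (\<lambda>g. f (g + h n *\<^sub>R lf \<xi> g))" for n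
  proof (rule integrableI_bounded)
    have "(\<integral>\<^sup>+g. ennreal (norm (f (g + h n *\<^sub>R lf \<xi> g))) \<partial>lborel) = (\<integral>\<^sup>+g. ennreal (norm (f g)) \<partial>lborel)"
      by (rule nn_integral_flow[where h="\<lambda>g. ennreal (norm (f g))"]) measurable
    then show "(\<integral>\<^sup>+g. ennreal (norm (f (g + h n *\<^sub>R lf \<xi> g))) \<partial>lborel) < \<infinity>"
      using intf by (simp add: integrable_iff_bounded)
  qed (use measurable_compose[OF flow_measurable fm(1)] in simp)
  have q0: "(\<integral>g. q n g \<partial>lborel) = 0" for n
    unfolding q_def using intf intfl by (simp add: integral_flow fm)
  have "(\<lambda>n. \<integral>g. q n g \<partial>lborel) \<longlonglongrightarrow> (\<integral>g. f' g \<partial>lborel)"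
  proof (rule integral_dominated_convergence)
    show "integrable lborel (\<lambda>g. indicator K' g *\<^sub>R \<bar>B\<bar>)"
      by (rule borel_integrable_compact[OF K']) auto
    show "AE g in lborel. (\<lambda>n. q n g) \<longlonglongrightarrow> f' g"
    proof (rule AE_I2)
      fix g
      have "((\<lambda>t. (f (g + t *\<^sub>R lf \<xi> g) - f g) / t) \<longlongrightarrow> f' g) (at 0)"
        using X[of g] by (simp add: has_X_def DERIV_def)
      moreover have "filterlim h (at 0) sequentially"
        unfolding filterlim_at using h h_lim by (auto intro!: always_eventually simp: less_imp_neq[symmetric])
      ultimately show "(\<lambda>n. q n g) \<longlonglongrightarrow> f' g"
        unfolding q_def by (rule filterlim_compose)
    qed
    show "AE g in lborel. norm (q n g) \<le> indicator K' g *\<^sub>R \<bar>B\<bar>" for n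
    proof (rule AE_I2)
      fix g
      obtain t where t: "0 < t" "t < h n" "q n g = f' (g + t *\<^sub>R lf \<xi> g)" using qmvt by blast
      show "norm (q n g) \<le> indicator K' g *\<^sub>R \<bar>B\<bar>"
      proof (cases "g + t *\<^sub>R lf \<xi> g \<in> K")
        case True
        then have "g \<in> K'" using inK'[of t g] t h(2)[of n] by simp
        then show ?thesis using t B[of "g + t *\<^sub>R lf \<xi> g"] by simp
      next
        case False
        then show ?thesis using t f'0 by simp
      qed
    qed
  qed measurable
  then have "(\<lambda>n::nat. 0) \<longlonglongrightarrow> (\<integral>g. f' g \<partial>lborel)"
    unfolding q0 .
  then show "(\<integral>g. f' g \<partial>lborel) = 0"
    using LIMSEQ_unique[OF _ tendsto_const[of "0::real"]] by blast
qed

text \<open>Extension by zero is regular because the open sets \<open>\<Omega>\<close> and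
  \<open>- K\<close> cover the space, and on the second one the extension vanishes.\<close>

lemma set_integral_X_eq_0:
  assumes \<Omega>: "open \<Omega>" and K: "compact K" "K \<subseteq> \<Omega>" and f0: "\<And>g. g \<in> \<Omega> \<Longrightarrow> g \<notin> K \<Longrightarrow> f g = 0"
    and f: "continuous_on \<Omega> f" and f': "continuous_on \<Omega> f'"
    and X: "\<And>g. g \<in> \<Omega> \<Longrightarrow> has_X \<xi> f (f' g) g"
  shows "set_integrable lborel \<Omega> f'" "(LINT g:\<Omega>|lborel. f' g) = 0"
proof -
  let ?f = "\<lambda>g. if g \<in> \<Omega> then f g else 0" and ?f' = "\<lambda>g. if g \<in> \<Omega> then f' g else 0"
  have oK: "open (- K)" using K by (simp add: compact_imp_closed open_Compl)
  have U: "\<Omega> \<union> - K = UNIV" using K by auto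
  have f'0: "f' g = 0" if "g \<in> \<Omega>" "g \<notin> K" for g
  proof -
    have "has_X \<xi> f 0 g \<longleftrightarrow> has_X \<xi> (\<lambda>_. 0) 0 g"
      by (rule has_X_cong_open[of "\<Omega> - K"]) (use K that f0 \<Omega> in \<open>auto simp: compact_imp_closed open_Diff\<close>)
    then show ?thesis using X that has_X_unique has_X_const by blast
  qed
  have glue: "continuous_on UNIV (\<lambda>g. if g \<in> \<Omega> then h g else 0)"
    if "continuous_on \<Omega> h" "\<And>g. g \<in> \<Omega> \<Longrightarrow> g \<notin> K \<Longrightarrow> h g = 0" for h :: "'a \<Rightarrow> real"
  proof -
    have "continuous_on \<Omega> (\<lambda>g. if g \<in> \<Omega> then h g else 0)"
      using that(1) by (rule continuous_on_eq) simp
    moreover have "continuous_on (- K) (\<lambda>g. if g \<in> \<Omega> then h g else 0)"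
      by (rule continuous_on_eq[of _ "\<lambda>_. 0"]) (use that(2) in auto)
    ultimately show ?thesis
      using continuous_on_open_Un[OF \<Omega> oK] U by metis
  qed
  have X': "has_X \<xi> ?f (?f' g) g" for g
  proof (cases "g \<in> \<Omega>")
    case True
    then show ?thesis using X has_X_cong_open[OF \<Omega> True, of ?f f] by simp
  next
    case False
    then have "g \<in> - K" using K by auto
    then show ?thesis using False has_X_cong_open[OF oK, of g ?f "\<lambda>_. 0"] f0 has_X_const by auto
  qed
  have *: "integrable lborel ?f'" "(\<integral>g. ?f' g \<partial>lborel) = 0"
    using integral_X_eq_0[of K ?f ?f' \<xi>] X' glue[OF f f0] glue[OF f' f'0] K f0 by auto
  have eq: "(\<lambda>g. indicator \<Omega> g *\<^sub>R f' g) = ?f'" by (auto simp: indicator_def)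
  show "set_integrable lborel \<Omega> f'" "(LINT g:\<Omega>|lborel. f' g) = 0"
    unfolding set_integrable_def set_lebesgue_integral_def eq using * by auto
qed

end

section \<open>Cutoff functions\<close>

lemma DERIV_max_square: "((\<lambda>t::real. (max 0 t)\<^sup>2) has_real_derivative 2 * max 0 t) (at t)"
proof -
  consider "t < 0" | "t > 0" | "t = 0" by linarith
  then show ?thesis
  proof cases
    case 1
    have "((\<lambda>t::real. (max 0 t)\<^sup>2) has_real_derivative 0) (at t)"
      by (rule DERIV_cong_ev[THEN iffD2, OF refl _ refl DERIV_const[of 0]])
         (rule eventually_mono[OF eventually_nhds_in_open[of "{..<0}"]], use 1 in auto)
    then show ?thesis using 1 by simp
  next
    case 2
    have "((\<lambda>t::real. t\<^sup>2) has_real_derivative 2 * t) (at t)"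
      by (auto intro!: derivative_eq_intros)
    then have "((\<lambda>t::real. (max 0 t)\<^sup>2) has_real_derivative 2 * t) (at t)"
      by (rule DERIV_cong_ev[THEN iffD2, OF refl _ refl, rotated])
         (rule eventually_mono[OF eventually_nhds_in_open[of "{0<..}"]], use 2 in auto)
    then show ?thesis using 2 by simp
  next
    case 3
    have "((\<lambda>h::real. ((max 0 (0 + h))\<^sup>2 - (max 0 0)\<^sup>2) / h) \<longlongrightarrow> 0) (at 0)"
    proof (rule Lim_null_comparison[where g="\<lambda>h. \<bar>h\<bar>"])
      show "eventually (\<lambda>h::real. norm (((max 0 (0 + h))\<^sup>2 - (max 0 0)\<^sup>2) / h) \<le> \<bar>h\<bar>) (at 0)"
        by (rule always_eventually) (auto simp: max_def power2_eq_square)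
    qed (auto intro!: tendsto_eq_intros)
    then show ?thesis using 3 by (simp add: DERIV_def)
  qed
qed

text \<open>A transition from 0 to 1 over the unit interval that is just C1, which is what
  integration by parts asks for. Squared positive parts are C1, and the denominator is positive
  since t and 1 - t are never both nonpositive.\<close>

definition ramp :: "real \<Rightarrow> real" where
  "ramp t = (max 0 t)\<^sup>2 / ((max 0 t)\<^sup>2 + (max 0 (1 - t))\<^sup>2)"

definition ramp' :: "real \<Rightarrow> real" where
  "ramp' t = 2 * (max 0 t * (max 0 (1 - t))\<^sup>2 + (max 0 t)\<^sup>2 * max 0 (1 - t)) / ((max 0 t)\<^sup>2 + (max 0 (1 - t))\<^sup>2)\<^sup>2"

lemma ramp_denom: "(max 0 t)\<^sup>2 + (max 0 (1 - t))\<^sup>2 > (0::real)"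
  by (cases "t > 0") (auto simp: max_def add_pos_nonneg add_nonneg_pos)

lemma DERIV_ramp: "(ramp has_real_derivative ramp' t) (at t)"
proof -
  have 1: "((\<lambda>t::real. (max 0 (1 - t))\<^sup>2) has_real_derivative - 2 * max 0 (1 - t)) (at t)"
  proof -
    have "((\<lambda>t::real. 1 - t) has_real_derivative - 1) (at t)"
      by (auto intro!: derivative_eq_intros)
    from DERIV_chain2[OF DERIV_max_square this] show ?thesis by simp
  qed
  have "(ramp has_real_derivative
      (2 * max 0 t * ((max 0 t)\<^sup>2 + (max 0 (1 - t))\<^sup>2) - (max 0 t)\<^sup>2 * (2 * max 0 t + - 2 * max 0 (1 - t))) /
      (((max 0 t)\<^sup>2 + (max 0 (1 - t))\<^sup>2) * ((max 0 t)\<^sup>2 + (max 0 (1 - t))\<^sup>2))) (at t)"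
    unfolding ramp_def[abs_def]
    by (intro DERIV_divide DERIV_add DERIV_max_square 1 less_imp_neq[OF ramp_denom, symmetric])
  also have "(2 * max 0 t * ((max 0 t)\<^sup>2 + (max 0 (1 - t))\<^sup>2) - (max 0 t)\<^sup>2 * (2 * max 0 t + - 2 * max 0 (1 - t)))
    = 2 * (max 0 t * (max 0 (1 - t))\<^sup>2 + (max 0 t)\<^sup>2 * max 0 (1 - t))"
    by (simp add: algebra_simps power2_eq_square)
  finally show ?thesis by (simp add: ramp'_def power2_eq_square)
qed

lemma continuous_ramp' [continuous_intros]: "continuous_on A f \<Longrightarrow> continuous_on A (\<lambda>x. ramp' (f x))"
  unfolding ramp'_def
  by (intro continuous_intros) (use ramp_denom in \<open>auto simp: less_imp_neq[symmetric]\<close>)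

lemma continuous_ramp [continuous_intros]: "continuous_on A f \<Longrightarrow> continuous_on A (\<lambda>x. ramp (f x))"
  unfolding ramp_def
  by (intro continuous_intros) (use ramp_denom in \<open>auto simp: less_imp_neq[symmetric]\<close>)

lemma ramp_bounds: "0 \<le> ramp t" "ramp t \<le> 1" "t \<le> 0 \<Longrightarrow> ramp t = 0" "t \<ge> 1 \<Longrightarrow> ramp t = 1" "0 \<le> ramp' t"
  using ramp_denom[of t] by (auto simp: ramp_def ramp'_def divide_simps max_def)

lemma ramp'_nonzero: "ramp' t \<noteq> 0 \<Longrightarrow> 0 < t \<and> t < 1"
proof (rule ccontr)
  assume "ramp' t \<noteq> 0" "\<not> (0 < t \<and> t < 1)"
  then have "max 0 t = 0 \<or> max 0 (1 - t) = 0" by (auto simp: max_def)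
  then have "ramp' t = 0" by (auto simp: ramp'_def)
  with \<open>ramp' t \<noteq> 0\<close> show False by simp
qed

text \<open>The squared positive part of a polynomial, hence C1 with an explicit differential. It is
  not normalised; a division in the partition argument takes care of that.\<close>

definition bump :: "'a::euclidean_space \<Rightarrow> real \<Rightarrow> 'a \<Rightarrow> real" where
  "bump p r x = (max 0 (r\<^sup>2 - (x - p) \<bullet> (x - p)))\<^sup>2"

definition bump' :: "'a::euclidean_space \<Rightarrow> real \<Rightarrow> 'a \<Rightarrow> 'a \<Rightarrow>\<^sub>L real" where
  "bump' p r x = (- 4 * max 0 (r\<^sup>2 - (x - p) \<bullet> (x - p))) *\<^sub>R blinfun_inner_left (x - p)"

lemma bump_has_derivative: "(bump p r has_derivative bump' p r x) (at x)"
proof -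
  have "((\<lambda>x. r\<^sup>2 - (x - p) \<bullet> (x - p)) has_derivative (\<lambda>h. - (2 * ((x - p) \<bullet> h)))) (at x)"
    by (auto intro!: derivative_eq_intros simp: inner_commute)
  from DERIV_compose_FDERIV[OF DERIV_max_square this]
  show ?thesis
    unfolding bump_def[abs_def] bump'_def
    by (rule has_derivative_eq_rhs) (simp add: fun_eq_iff blinfun.scaleR_left blinfun.minus_left inner_commute mult_ac)
qed

lemma continuous_bump': "continuous_on A (bump' p r)"
  unfolding bump'_def by (intro continuous_intros bounded_linear.continuous_on[OF bounded_linear_blinfun_inner_left])

lemma bump_nonneg: "0 \<le> bump p r x"
  and bump_pos: "0 < r \<Longrightarrow> x \<in> ball p r \<Longrightarrow> 0 < bump p r x"
  and bump_outside: "0 < r \<Longrightarrow> x \<notin> cball p r \<Longrightarrow> bump p r x = 0"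
proof -
  show "0 \<le> bump p r x" by (simp add: bump_def)
  have eq: "(x - p) \<bullet> (x - p) = (dist p x)\<^sup>2" by (simp add: dist_norm power2_norm_eq_inner inner_diff inner_commute)
  show "0 < bump p r x" if "0 < r" "x \<in> ball p r"
  proof -
    have "(dist p x)\<^sup>2 < r\<^sup>2" using that by (intro power_strict_mono) auto
    then have "0 < max 0 (r\<^sup>2 - (dist p x)\<^sup>2)" by simp
    then show ?thesis unfolding bump_def eq by (rule zero_less_power)
  qed
  show "bump p r x = 0" if "0 < r" "x \<notin> cball p r"
  proof -
    have "r\<^sup>2 < (dist p x)\<^sup>2" using that by (intro power_strict_mono) auto
    then have "max 0 (r\<^sup>2 - (dist p x)\<^sup>2) = 0" by simp
    then show ?thesis unfolding bump_def eq by simp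
  qed
qed

section \<open>Local defining functions\<close>

lemma continuous_on_has_derivative:
  "(\<And>x. x \<in> A \<Longrightarrow> (f has_derivative f' x) (at x)) \<Longrightarrow> continuous_on A f"
  by (rule continuous_at_imp_continuous_on, rule ballI, rule has_derivative_continuous)

text \<open>Names the derivatives that \<open>local_defining\<close> only asserts to exist, and
  states nonvanishing for the bounded linear map itself, so that differentials of different defining
  functions can be compared.\<close>

definition defining_derivs ::
    "'a::euclidean_space set \<Rightarrow> 'a set \<Rightarrow> ('a \<Rightarrow> real) \<Rightarrow> ('a \<Rightarrow> 'a \<Rightarrow>\<^sub>L real) \<Rightarrow> ('a \<Rightarrow> 'a \<Rightarrow>\<^sub>L 'a \<Rightarrow>\<^sub>L real) \<Rightarrow> bool" where
  "defining_derivs \<Omega> U \<phi> D D2 \<longleftrightarrow> open U \<and> continuous_on U D2 \<and>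
     (\<forall>x\<in>U. (\<phi> has_derivative blinfun_apply (D x)) (at x) \<and> (D has_derivative blinfun_apply (D2 x)) (at x) \<and>
        D x \<noteq> 0 \<and> (x \<in> \<Omega> \<longleftrightarrow> \<phi> x < 0))"

lemma defining_derivsD:
  assumes "defining_derivs \<Omega> U \<phi> D D2"
  shows "open U" "continuous_on U D" "continuous_on U D2" "continuous_on U \<phi>"
    and "\<And>x. x \<in> U \<Longrightarrow> (\<phi> has_derivative blinfun_apply (D x)) (at x)"
    and "\<And>x. x \<in> U \<Longrightarrow> (D has_derivative blinfun_apply (D2 x)) (at x)"
    and "\<And>x. x \<in> U \<Longrightarrow> D x \<noteq> 0"
    and "\<And>x. x \<in> U \<Longrightarrow> x \<in> \<Omega> \<longleftrightarrow> \<phi> x < 0"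
    and "\<And>x. x \<in> U \<Longrightarrow> frechet_derivative \<phi> (at x) = blinfun_apply (D x)"
proof -
  show *: "open U" "continuous_on U D2" "\<And>x. x \<in> U \<Longrightarrow> (\<phi> has_derivative blinfun_apply (D x)) (at x)"
    "\<And>x. x \<in> U \<Longrightarrow> (D has_derivative blinfun_apply (D2 x)) (at x)"
    "\<And>x. x \<in> U \<Longrightarrow> D x \<noteq> 0" "\<And>x. x \<in> U \<Longrightarrow> x \<in> \<Omega> \<longleftrightarrow> \<phi> x < 0"
    using assms by (simp_all add: defining_derivs_def)
  show "continuous_on U D" "continuous_on U \<phi>"
    by (rule continuous_on_has_derivative, erule *)+
  show "frechet_derivative \<phi> (at x) = blinfun_apply (D x)" if "x \<in> U" for x
    using frechet_derivative_at[OF *(3)[OF that]] by simp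
qed

lemma local_defining_derivs:
  assumes "local_defining \<Omega> p U \<phi>"
  obtains D D2 where "p \<in> U" "defining_derivs \<Omega> U \<phi> D D2"
proof -
  from assms obtain D :: "'a \<Rightarrow> 'a \<Rightarrow>\<^sub>L real" and D2 :: "'a \<Rightarrow> 'a \<Rightarrow>\<^sub>L 'a \<Rightarrow>\<^sub>L real" where
    *: "\<And>x. x \<in> U \<Longrightarrow> (\<phi> has_derivative blinfun_apply (D x)) (at x)"
    "\<And>x. x \<in> U \<Longrightarrow> (D has_derivative blinfun_apply (D2 x)) (at x)" "continuous_on U D2"
    unfolding local_defining_def C2_on_def by blast
  have "D x \<noteq> 0" if "x \<in> U" for x
    using assms frechet_derivative_at[OF *(1)[OF that]] that by (auto simp: local_defining_def zero_blinfun.rep_eq)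
  then show ?thesis
    using assms * by (intro that[of D D2]) (auto simp: local_defining_def defining_derivs_def)
qed

lemma local_defining_mono: "local_defining \<Omega> p U \<phi> \<Longrightarrow> q \<in> U \<Longrightarrow> local_defining \<Omega> q U \<phi>"
  by (simp add: local_defining_def)

text \<open>Negative values are reserved for points of \<Omega>, and a positive value would persist
  on a neighbourhood disjoint from \<Omega>, keeping the point out of the closure.\<close>

lemma local_defining_frontier_eq_0:
  assumes "open \<Omega>" "local_defining \<Omega> p U \<phi>" "p \<in> frontier \<Omega>" shows "\<phi> p = 0"
proof -
  obtain D D2 where pU: "p \<in> U" and dd: "defining_derivs \<Omega> U \<phi> D D2"
    using local_defining_derivs[OF assms(2)] by blast
  note oU = defining_derivsD(1)[OF dd] and cD = defining_derivsD(2)[OF dd] and c\<phi> = defining_derivsD(4)[OF dd]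
    and \<phi> = defining_derivsD(5)[OF dd] and in\<Omega> = defining_derivsD(8)[OF dd] and fr = defining_derivsD(9)[OF dd]
  have "p \<notin> \<Omega>" using assms(1,3) by (simp add: frontier_def interior_open)
  then have "\<not> \<phi> p < 0" using in\<Omega> pU by simp
  moreover have "\<not> \<phi> p > 0"
  proof
    assume "\<phi> p > 0"
    have "open {x \<in> U. \<phi> x \<in> {0<..}}"
      using continuous_open_preimage[OF c\<phi> oU, of "{0<..}"] by (simp add: vimage_def Int_def)
    moreover have "p \<in> {x \<in> U. \<phi> x \<in> {0<..}}" using pU \<open>\<phi> p > 0\<close> by simp
    moreover have "p \<in> closure \<Omega>" using assms(3) by (simp add: frontier_def)
    ultimately have "{x \<in> U. \<phi> x \<in> {0<..}} \<inter> closure \<Omega> \<noteq> {}" by blast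
    then have "{x \<in> U. \<phi> x \<in> {0<..}} \<inter> \<Omega> \<noteq> {}"
      using open_Int_closure_eq_empty[OF \<open>open {x \<in> U. \<phi> x \<in> {0<..}}\<close>] by blast
    then obtain y where "y \<in> U" "\<phi> y > 0" "y \<in> \<Omega>" by auto
    then show False using in\<Omega>[of y] by simp
  qed
  ultimately show ?thesis by simp
qed

lemma closure_cases: "open \<Omega> \<Longrightarrow> x \<in> closure \<Omega> \<Longrightarrow> x \<in> \<Omega> \<or> x \<in> frontier \<Omega>"
  by (simp add: frontier_def interior_open)

lemma set_integrable_closure:
  fixes h :: "'a::euclidean_space \<Rightarrow> real"
  assumes "open \<Omega>" "bounded \<Omega>" "continuous_on (closure \<Omega>) h"
  shows "set_integrable lborel \<Omega> h"
proof -
  have "set_integrable lborel (closure \<Omega>) h"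
    unfolding set_integrable_def using assms by (intro borel_integrable_compact) auto
  then show ?thesis by (rule set_integrable_subset) (use assms closure_subset[of \<Omega>] in auto)
qed

lemma set_integral_finite_sum:
  fixes f :: "'i \<Rightarrow> 'a \<Rightarrow> real"
  assumes "\<And>i. i \<in> S \<Longrightarrow> set_integrable M A (f i)"
  shows "set_integrable M A (\<lambda>x. \<Sum>i\<in>S. f i x)"
    and "(LINT x:A|M. (\<Sum>i\<in>S. f i x)) = (\<Sum>i\<in>S. LINT x:A|M. f i x)"
  using assms unfolding set_integrable_def set_lebesgue_integral_def scaleR_sum_right
  by (auto intro: Bochner_Integration.integrable_sum Bochner_Integration.integral_sum)

lemma compact_preimage:
  fixes C :: "'a::euclidean_space set"
  assumes "compact C" "continuous_on C f" "closed T"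
  shows "compact {x \<in> C. f x \<in> T}"
proof -
  have "closed (C \<inter> f -` T)"
    using assms by (intro continuous_closed_preimage compact_imp_closed)
  then have "compact (C \<inter> (C \<inter> f -` T))" using assms(1) by (rule compact_Int_closed[rotated])
  moreover have "C \<inter> (C \<inter> f -` T) = {x \<in> C. f x \<in> T}" by auto
  ultimately show ?thesis by simp
qed

lemma continuous_on_glue:
  assumes "open \<Omega>" "open U" "closed C" "C \<subseteq> U" "continuous_on (\<Omega> \<inter> U) f" "\<And>x. x \<notin> C \<Longrightarrow> f x = 0"
  shows "continuous_on \<Omega> f"
proof -
  have "continuous_on (\<Omega> - C) f" by (rule continuous_on_eq[of _ "\<lambda>_. 0"]) (use assms in auto)
  moreover have "\<Omega> \<inter> U \<union> (\<Omega> - C) = \<Omega>" using assms by auto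
  ultimately show ?thesis
    using continuous_on_open_Un[of "\<Omega> \<inter> U" "\<Omega> - C" f] assms by (simp add: open_Int open_Diff)
qed

section \<open>The divergence inequality\<close>

context carnot2
begin

text \<open>A divergence differentiates each component only along its own vector, and no more is
  demanded here: components built from second derivatives of u need have no vertical
  derivative.\<close>

definition X_regular :: "'a set \<Rightarrow> 'a \<Rightarrow> ('a \<Rightarrow> real) \<Rightarrow> ('a \<Rightarrow> real) \<Rightarrow> bool" where
  "X_regular \<Omega> \<xi> f f' \<longleftrightarrow>
     continuous_on (closure \<Omega>) f \<and> continuous_on (closure \<Omega>) f' \<and> (\<forall>g\<in>\<Omega>. has_X \<xi> f (f' g) g)"

text \<open>The field with components F is paired with the differential of a defining function, a
  positive multiple of the outer unit covector. Only the sign is recorded, so neither normalisation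
  nor surface measure enters.\<close>

definition inward_flux :: "'a set \<Rightarrow> 'a set \<Rightarrow> ('a \<Rightarrow> 'a \<Rightarrow> real) \<Rightarrow> bool" where
  "inward_flux \<Omega> S F \<longleftrightarrow> (\<forall>p\<in>frontier \<Omega>. \<forall>U \<phi>. local_defining \<Omega> p U \<phi> \<longrightarrow>
     (\<Sum>\<xi>\<in>S. F \<xi> p * frechet_derivative \<phi> (at p) (lf \<xi> p)) \<le> 0)"

text \<open>After multiplication by a cutoff that vanishes near the boundary the divergence
  integrates to zero. The derivative of the cutoff contributes a term of order 1/\<epsilon> that is
  not small but has a sign: it lives in a thin layer where, by strictness and compactness, the
  pairing \<open>P\<close> is still negative. Discarding it leaves an inequality that survives the
  limit.\<close>

lemma divergence_local_strict:
  assumes \<Omega>: "open \<Omega>" "bounded \<Omega>" and S: "finite S" and loc: "local_defining \<Omega> p U \<phi>" and r: "cball p r \<subseteq> U"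
    and F: "\<And>\<xi>. \<xi> \<in> S \<Longrightarrow> X_regular \<Omega> \<xi> (F \<xi>) (F' \<xi>)"
    and b: "\<And>x. (b has_derivative blinfun_apply (Db x)) (at x)" and Db: "continuous_on UNIV Db"
    and b0: "\<And>x. 0 \<le> b x" and bout: "\<And>x. x \<notin> cball p r \<Longrightarrow> b x = 0"
    and strict: "\<And>x. x \<in> frontier \<Omega> \<Longrightarrow> x \<in> cball p r \<Longrightarrow>
       (\<Sum>\<xi>\<in>S. F \<xi> x * frechet_derivative \<phi> (at x) (lf \<xi> x)) < 0"
  shows "(LINT g:\<Omega>|lborel. (\<Sum>\<xi>\<in>S. b g * F' \<xi> g + F \<xi> g * Db g (lf \<xi> g))) \<le> 0"
proof -
  obtain D D2 where pU: "p \<in> U" and dd: "defining_derivs \<Omega> U \<phi> D D2"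
    using local_defining_derivs[OF loc] by blast
  note oU = defining_derivsD(1)[OF dd] and cD = defining_derivsD(2)[OF dd] and c\<phi> = defining_derivsD(4)[OF dd]
    and \<phi> = defining_derivsD(5)[OF dd] and in\<Omega> = defining_derivsD(8)[OF dd] and fr = defining_derivsD(9)[OF dd]
  have cF: "continuous_on (closure \<Omega>) (F \<xi>)" "continuous_on (closure \<Omega>) (F' \<xi>)"
    and XF: "\<And>g. g \<in> \<Omega> \<Longrightarrow> has_X \<xi> (F \<xi>) (F' \<xi> g) g" if "\<xi> \<in> S" for \<xi>
    using F[OF that] by (auto simp: X_regular_def)
  have Dbout: "Db x = 0" if "x \<notin> cball p r" for x
  proof -
    have "(b has_derivative (\<lambda>h. 0)) (at x)"
      by (rule has_derivative_transform_within_open[of "\<lambda>_. 0" _ _ _ "- cball p r"]) (use that bout in auto)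
    then have "blinfun_apply (Db x) = (\<lambda>h. 0)" using b has_derivative_unique by blast
    then show ?thesis by (intro blinfun_eqI) simp
  qed
  define P where "P x = (\<Sum>\<xi>\<in>S. F \<xi> x * D x (lf \<xi> x))" for x
  define H where "H x = (\<Sum>\<xi>\<in>S. b x * F' \<xi> x + F \<xi> x * Db x (lf \<xi> x))" for x
  define C where "C = closure \<Omega> \<inter> cball p r"
  have C: "compact C" "C \<subseteq> U" unfolding C_def using \<Omega> r by (auto simp: compact_Int)
  have cP: "continuous_on C P" unfolding P_def
    using C by (intro continuous_intros continuous_on_sum continuous_on_mult blinfun.continuous_on continuous_on_subset[OF cF(1)] continuous_on_subset[OF cD])
       (auto simp: C_def)
  have cb: "continuous_on A b" for A
    by (rule continuous_on_has_derivative, rule b)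
  have cH: "continuous_on (closure \<Omega>) H" unfolding H_def
    by (intro continuous_intros blinfun.continuous_on cF cb continuous_on_subset[OF Db]) auto
  have Hout: "H x = 0" if "x \<notin> cball p r" for x
    using bout[OF that] Dbout[OF that] by (simp add: H_def)
  \<comment> \<open>The part of the patch on which the sign of \<open>P\<close> fails. It is compact
    and misses the boundary, so it keeps a positive depth \<open>\<epsilon>0\<close> as measured by
    \<open>\<phi>\<close>.\<close>
  define Bad where "Bad = {x \<in> C. 0 \<le> P x}"
  have "compact Bad"
    unfolding Bad_def using compact_preimage[OF C(1) cP, of "{0..}"] by simp
  have Bad: "\<phi> x < 0" if "x \<in> Bad" for x
  proof -
    have "x \<in> U" "x \<in> closure \<Omega>" "x \<in> cball p r" "0 \<le> P x" using that C by (auto simp: Bad_def C_def)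
    then have "x \<notin> frontier \<Omega>" using strict[of x] fr unfolding P_def by force
    then show ?thesis using closure_cases \<Omega> in\<Omega> \<open>x \<in> U\<close> \<open>x \<in> closure \<Omega>\<close> by blast
  qed
  obtain \<epsilon>0 where \<epsilon>0: "\<epsilon>0 > 0" "\<And>x. x \<in> Bad \<Longrightarrow> \<phi> x \<le> - \<epsilon>0"
  proof (cases "Bad = {}")
    case True then show ?thesis using that[of 1] by simp
  next
    case False
    have "continuous_on Bad \<phi>" by (rule continuous_on_subset[OF c\<phi>]) (use C in \<open>auto simp: Bad_def\<close>)
    then obtain y where y: "y \<in> Bad" "\<And>x. x \<in> Bad \<Longrightarrow> \<phi> x \<le> \<phi> y"
      using continuous_attains_sup[OF \<open>compact Bad\<close> False] by blast
    then show ?thesis using that[of "- \<phi> y"] Bad by auto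
  qed
  \<comment> \<open>The derivative of the cutoff lives where \<open>- \<phi>\<close> lies between
    \<open>\<epsilon> n\<close> and \<open>2 * \<epsilon> n\<close>. The offset 3 keeps this layer
    away from \<open>Bad\<close> for every n, including 0.\<close>
  define \<epsilon> where "\<epsilon> n = \<epsilon>0 / (real n + 3)" for n
  have \<epsilon>: "\<epsilon> n > 0" "2 * \<epsilon> n < \<epsilon>0" for n using \<epsilon>0(1) by (auto simp: \<epsilon>_def field_simps intro: add_pos_nonneg)
  \<comment> \<open>The shift by 1 makes the cutoff vanish up to depth \<open>\<epsilon> n\<close>,
    which gives it the compact support \<open>Kn n\<close> inside \<open>\<Omega>\<close>.\<close>
  define s where "s n x = - \<phi> x / \<epsilon> n - 1" for n x
  have cs: "continuous_on U (s n)" for n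
    unfolding s_def by (intro continuous_intros c\<phi> ballI less_imp_neq[OF \<epsilon>(1), symmetric])
  define \<kappa> where "\<kappa> n x = (if x \<in> cball p r then ramp (s n x) * b x else 0)" for n x
  define D\<kappa> where "D\<kappa> n x = (if x \<in> cball p r then ramp (s n x) *\<^sub>R Db x + (- (b x * ramp' (s n x)) / \<epsilon> n) *\<^sub>R D x else 0)" for n x
  have \<kappa>U: "\<kappa> n x = ramp (s n x) * b x"
    and D\<kappa>U: "D\<kappa> n x = ramp (s n x) *\<^sub>R Db x + (- (b x * ramp' (s n x)) / \<epsilon> n) *\<^sub>R D x" for n x
    using bout[of x] Dbout[of x] by (auto simp: \<kappa>_def D\<kappa>_def)
  have D\<kappa>: "(\<kappa> n has_derivative blinfun_apply (D\<kappa> n x)) (at x)" for n x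
  proof (cases "x \<in> U")
    case True
    have "(s n has_derivative (\<lambda>h. - D x h / \<epsilon> n)) (at x)"
      unfolding s_def using \<epsilon>(1)[of n] by (auto intro!: derivative_eq_intros \<phi>[OF True])
    then have "((\<lambda>x. ramp (s n x)) has_derivative (\<lambda>h. - D x h / \<epsilon> n * ramp' (s n x))) (at x)"
      by (rule DERIV_compose_FDERIV[OF DERIV_ramp])
    then have "((\<lambda>x. ramp (s n x) * b x) has_derivative
        (\<lambda>h. ramp (s n x) * Db x h + - D x h / \<epsilon> n * ramp' (s n x) * b x)) (at x)"
      by (rule has_derivative_mult[OF _ b])
    then show ?thesis unfolding \<kappa>U[abs_def] D\<kappa>U
      by (rule has_derivative_eq_rhs) (auto simp: blinfun.add_left blinfun.diff_left blinfun.scaleR_left fun_eq_iff field_simps)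
  next
    case False
    then have x: "x \<notin> cball p r" using r by auto
    have "(\<kappa> n has_derivative (\<lambda>h. 0)) (at x)"
      by (rule has_derivative_transform_within_open[of "\<lambda>_. 0" _ _ _ "- cball p r"]) (use x in \<open>auto simp: \<kappa>_def\<close>)
    moreover have "D\<kappa> n x = 0" using x by (auto simp: D\<kappa>_def)
    ultimately show ?thesis by (simp add: zero_blinfun.rep_eq)
  qed
  have cD\<kappa>: "continuous_on \<Omega> (D\<kappa> n)" for n
  proof (rule continuous_on_glue[OF \<Omega>(1) oU closed_cball r])
    show "continuous_on (\<Omega> \<inter> U) (D\<kappa> n)"
      unfolding D\<kappa>U[abs_def]
      by (intro continuous_intros continuous_on_subset[OF cD] continuous_on_subset[OF Db] cb continuous_on_subset[OF cs]
             ballI less_imp_neq[OF \<epsilon>(1), symmetric]) auto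
  qed (auto simp: D\<kappa>_def)
  have c\<kappa>: "continuous_on \<Omega> (\<kappa> n)" for n
    by (rule continuous_on_has_derivative, rule D\<kappa>)
  define Kn where "Kn n = {x \<in> C. \<phi> x \<le> - \<epsilon> n}" for n
  have Kn: "compact (Kn n)" "Kn n \<subseteq> \<Omega>" for n
  proof -
    show "compact (Kn n)"
      unfolding Kn_def using compact_preimage[OF C(1) continuous_on_subset[OF c\<phi> C(2)], of "{..- \<epsilon> n}"] by simp
    show "Kn n \<subseteq> \<Omega>"
    proof
      fix x assume "x \<in> Kn n"
      then have "x \<in> U" "\<phi> x \<le> - \<epsilon> n" using C(2) by (auto simp: Kn_def)
      then show "x \<in> \<Omega>" using in\<Omega>[of x] \<epsilon>(1)[of n] by simp
    qed
  qed
  have \<kappa>0: "\<kappa> n x = 0" if "x \<in> \<Omega>" "x \<notin> Kn n" for n x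
  proof (cases "x \<in> cball p r")
    case True
    then have "\<phi> x > - \<epsilon> n" using that closure_subset[of \<Omega>] by (auto simp: Kn_def C_def)
    then have "s n x \<le> 0" unfolding s_def using \<epsilon>(1)[of n] by (simp add: field_simps)
    then show ?thesis by (simp add: \<kappa>_def ramp_bounds)
  qed (simp add: \<kappa>_def)
  have part: "set_integrable lborel \<Omega> (\<lambda>g. D\<kappa> n g (lf \<xi> g) * F \<xi> g + F' \<xi> g * \<kappa> n g)"
    "(LINT g:\<Omega>|lborel. D\<kappa> n g (lf \<xi> g) * F \<xi> g + F' \<xi> g * \<kappa> n g) = 0" if "\<xi> \<in> S" for n \<xi>
  proof -
    note c = continuous_on_subset[OF cF(1)[OF that] closure_subset] continuous_on_subset[OF cF(2)[OF that] closure_subset]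
    have 1: "continuous_on \<Omega> (\<lambda>g. \<kappa> n g * F \<xi> g)" by (intro continuous_intros c\<kappa> c)
    have 2: "continuous_on \<Omega> (\<lambda>g. D\<kappa> n g (lf \<xi> g) * F \<xi> g + F' \<xi> g * \<kappa> n g)"
      by (intro continuous_intros c\<kappa> c blinfun.continuous_on cD\<kappa>)
    have 3: "has_X \<xi> (\<lambda>g. \<kappa> n g * F \<xi> g) (D\<kappa> n g (lf \<xi> g) * F \<xi> g + F' \<xi> g * \<kappa> n g) g" if "g \<in> \<Omega>" for g
      by (rule has_X_mult[OF has_X_has_derivative[OF D\<kappa>] XF[OF \<open>\<xi> \<in> S\<close> that]])
    show "set_integrable lborel \<Omega> (\<lambda>g. D\<kappa> n g (lf \<xi> g) * F \<xi> g + F' \<xi> g * \<kappa> n g)"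
      "(LINT g:\<Omega>|lborel. D\<kappa> n g (lf \<xi> g) * F \<xi> g + F' \<xi> g * \<kappa> n g) = 0"
      using set_integral_X_eq_0[OF \<Omega>(1) Kn _ 1 2 3, of n] \<kappa>0 by auto
  qed
  \<comment> \<open>\<open>H\<close> already contains b and its differential, so the limit concerns
    the ramp alone, cut down to the ball because \<open>\<phi>\<close> is meaningful only near
    it.\<close>
  define \<eta> where "\<eta> n x = (if x \<in> cball p r then ramp (s n x) else 0)" for n x
  have c\<eta>H: "continuous_on \<Omega> (\<lambda>x. \<eta> n x * H x)" for n
  proof (rule continuous_on_glue[OF \<Omega>(1) oU closed_cball r])
    have eq: "\<eta> n x * H x = ramp (s n x) * H x" for x using Hout[of x] by (auto simp: \<eta>_def)
    show "continuous_on (\<Omega> \<inter> U) (\<lambda>x. \<eta> n x * H x)"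
      unfolding eq using closure_subset[of \<Omega>]
      by (intro continuous_intros continuous_on_subset[OF cs] continuous_on_subset[OF cH]) auto
  qed (auto simp: \<eta>_def)
  have iH: "set_integrable lborel \<Omega> H" by (rule set_integrable_closure[OF \<Omega> cH])
  have \<eta>1: "\<bar>\<eta> n x\<bar> \<le> 1" for n x by (simp add: \<eta>_def ramp_bounds)
  have \<eta>H: "norm (indicator \<Omega> x *\<^sub>R (\<eta> n x * H x)) \<le> norm (indicator \<Omega> x *\<^sub>R H x)" for n x
    using mult_right_mono[OF \<eta>1[of n x], of "\<bar>H x\<bar>"] by (simp add: abs_mult indicator_def)
  have m: "(\<lambda>x. indicator \<Omega> x *\<^sub>R (\<eta> n x * H x)) \<in> borel_measurable lborel" for n
    using borel_measurable_continuous_on_indicator[OF _ c\<eta>H[of n]] \<Omega>(1) by simp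
  have i\<eta>H: "set_integrable lborel \<Omega> (\<lambda>x. \<eta> n x * H x)" for n
    unfolding set_integrable_def
    by (rule Bochner_Integration.integrable_bound[OF iH[unfolded set_integrable_def] m])
       (rule AE_I2, rule \<eta>H)
  have le: "(LINT x:\<Omega>|lborel. \<eta> n x * H x) \<le> 0" for n
  proof -
    have "(LINT x:\<Omega>|lborel. \<eta> n x * H x) \<le> (LINT g:\<Omega>|lborel. (\<Sum>\<xi>\<in>S. D\<kappa> n g (lf \<xi> g) * F \<xi> g + F' \<xi> g * \<kappa> n g))"
    proof (rule set_integral_mono[OF i\<eta>H])
      show "set_integrable lborel \<Omega> (\<lambda>g. \<Sum>\<xi>\<in>S. D\<kappa> n g (lf \<xi> g) * F \<xi> g + F' \<xi> g * \<kappa> n g)"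
        by (intro set_integral_finite_sum part(1))
      fix x assume x: "x \<in> \<Omega>"
      have "(\<Sum>\<xi>\<in>S. D\<kappa> n x (lf \<xi> x) * F \<xi> x + F' \<xi> x * \<kappa> n x)
        = ramp (s n x) * H x + (- (b x * ramp' (s n x)) / \<epsilon> n) * P x"
        unfolding H_def P_def D\<kappa>U \<kappa>U sum_distrib_left sum.distrib[symmetric]
        by (intro sum.cong refl) (simp add: blinfun.add_left blinfun.diff_left blinfun.scaleR_left algebra_simps)
      moreover have "ramp (s n x) * H x = \<eta> n x * H x" using Hout[of x] by (auto simp: \<eta>_def)
      moreover have "(- (b x * ramp' (s n x)) / \<epsilon> n) * P x \<ge> 0"
      proof (cases "b x = 0 \<or> ramp' (s n x) = 0")
        case False
        then have xb: "x \<in> cball p r" "0 < s n x" "s n x < 1" using bout ramp'_nonzero by auto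
        then have "\<phi> x > - \<epsilon>0" using \<epsilon>[of n] by (simp add: s_def field_simps)
        then have "x \<notin> Bad" using \<epsilon>0(2) by force
        then have "P x < 0" using x xb closure_subset[of \<Omega>] by (auto simp: Bad_def C_def)
        then have "b x * ramp' (s n x) * P x \<le> 0"
          by (intro mult_nonneg_nonpos mult_nonneg_nonneg b0 ramp_bounds less_imp_le)
        then have "b x * ramp' (s n x) * P x / \<epsilon> n \<le> 0" using \<epsilon>(1) by (rule divide_nonpos_pos)
        then show ?thesis by simp
      qed auto
      ultimately show "\<eta> n x * H x \<le> (\<Sum>\<xi>\<in>S. D\<kappa> n x (lf \<xi> x) * F \<xi> x + F' \<xi> x * \<kappa> n x)" by simp
    qed
    also have "\<dots> = (\<Sum>\<xi>\<in>S. LINT g:\<Omega>|lborel. D\<kappa> n g (lf \<xi> g) * F \<xi> g + F' \<xi> g * \<kappa> n g)"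
      by (intro set_integral_finite_sum part(1))
    also have "\<dots> = 0" using part(2) by simp
    finally show ?thesis .
  qed
  have "(\<lambda>n. LINT x:\<Omega>|lborel. \<eta> n x * H x) \<longlonglongrightarrow> (LINT x:\<Omega>|lborel. H x)"
    unfolding set_lebesgue_integral_def
  proof (rule integral_dominated_convergence[where w="\<lambda>x. norm (indicator \<Omega> x *\<^sub>R H x)"])
    show "integrable lborel (\<lambda>x. norm (indicator \<Omega> x *\<^sub>R H x))"
      using iH by (intro integrable_norm) (simp add: set_integrable_def)
    show "(\<lambda>x. indicator \<Omega> x *\<^sub>R H x) \<in> borel_measurable lborel"
      using iH by (simp add: set_integrable_def borel_measurable_integrable)
    show "(\<lambda>x. indicator \<Omega> x *\<^sub>R (\<eta> n x * H x)) \<in> borel_measurable lborel" for n by (rule m)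
    show "AE x in lborel. norm (indicator \<Omega> x *\<^sub>R (\<eta> n x * H x)) \<le> norm (indicator \<Omega> x *\<^sub>R H x)" for n
      by (rule AE_I2, rule \<eta>H)
    show "AE x in lborel. (\<lambda>n. indicator \<Omega> x *\<^sub>R (\<eta> n x * H x)) \<longlonglongrightarrow> indicator \<Omega> x *\<^sub>R H x"
    proof (rule AE_I2)
      fix x
      show "(\<lambda>n. indicator \<Omega> x *\<^sub>R (\<eta> n x * H x)) \<longlonglongrightarrow> indicator \<Omega> x *\<^sub>R H x"
      proof (cases "x \<in> \<Omega> \<inter> cball p r")
        case True
        then have "x \<in> U" using r by auto
        then have neg: "\<phi> x < 0" using in\<Omega>[of x] True by simp
        \<comment> \<open>Once \<open>n + 3\<close> exceeds this number, the depth of x is above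
          \<open>2 * \<epsilon> n\<close>; the ramp is then 1 and the sequence is eventually
          constant.\<close>
        obtain N :: nat where N: "2 * \<epsilon>0 / - \<phi> x < real N" using reals_Archimedean2[of "2 * \<epsilon>0 / - \<phi> x"] ..
        have "eventually (\<lambda>n. \<eta> n x = 1) sequentially"
        proof (rule eventually_sequentiallyI[of N])
          fix n assume "N \<le> n"
          then have "real N \<le> real n + 3" by simp
          with N have "2 * \<epsilon>0 / - \<phi> x < real n + 3" by (rule less_le_trans)
          then have "2 * \<epsilon>0 < (real n + 3) * - \<phi> x"
            by (subst (asm) pos_divide_less_eq) (use neg in simp_all)
          then have "2 < (real n + 3) * - \<phi> x / \<epsilon>0"
            by (subst pos_less_divide_eq) (use \<epsilon>0(1) in simp_all)
          moreover have "- \<phi> x / \<epsilon> n = (real n + 3) * - \<phi> x / \<epsilon>0" by (simp add: \<epsilon>_def mult.commute)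
          ultimately have "s n x \<ge> 1" by (simp add: s_def)
          then show "\<eta> n x = 1" using True by (simp add: \<eta>_def ramp_bounds)
        qed
        then have "eventually (\<lambda>n. indicator \<Omega> x *\<^sub>R (\<eta> n x * H x) = indicator \<Omega> x *\<^sub>R H x) sequentially"
          by (rule eventually_mono) simp
        then show ?thesis by (rule tendsto_eventually)
      next
        case False
        then show ?thesis using Hout[of x] by (cases "x \<in> \<Omega>") auto
      qed
    qed
  qed
  then have "(LINT x:\<Omega>|lborel. H x) \<le> 0"
    by (rule LIMSEQ_le_const2) (use le in blast)
  then show ?thesis by (simp add: H_def)
qed

lemma span_lf_nonzero:
  assumes "span S = UNIV" "D \<noteq> (0 :: 'a \<Rightarrow>\<^sub>L real)" shows "\<exists>\<xi>\<in>S. D (lf \<xi> p) \<noteq> 0"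
proof (rule ccontr)
  assume "\<not> ?thesis"
  then have 0: "\<And>\<xi>. \<xi> \<in> S \<Longrightarrow> D (lf \<xi> p) = 0" by auto
  have "linear (\<lambda>\<xi>. D (lf \<xi> p))"
    by (rule linearI) (simp_all add: lf_lin blinfun.add_right blinfun.scaleR_right)
  then have "D (lf \<xi> p) = 0" for \<xi>
    by (rule linear_eq_0_on_span[OF _ 0]) (use assms(1) in auto)
  then have "D v = 0" for v using lf_inverse(1)[of v p] by metis
  then have "D = 0" by (intro blinfun_eqI) simp
  with assms(2) show False by simp
qed

lemma X_regularD:
  assumes "X_regular \<Omega> \<xi> f f'"
  shows "continuous_on (closure \<Omega>) f" "continuous_on (closure \<Omega>) f'" "\<And>g. g \<in> \<Omega> \<Longrightarrow> has_X \<xi> f (f' g) g"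
  using assms by (simp_all add: X_regular_def)

text \<open>Subtracting a small constant-coefficient field that points outward near p makes a
  nonpositive flux strict. Constants leave the derivatives unchanged, so the error is \<delta> times
  a fixed integral. The radius is fixed before the field, so that a finite cover can serve fields
  constructed from that very cover.\<close>

lemma divergence_local_boundary:
  assumes \<Omega>: "open \<Omega>" "bounded \<Omega>" and S: "finite S" "span S = UNIV" and loc: "local_defining \<Omega> p U \<phi>"
  obtains r where "r > 0" "\<And>F F' b Db. (\<And>\<xi>. \<xi> \<in> S \<Longrightarrow> X_regular \<Omega> \<xi> (F \<xi>) (F' \<xi>)) \<Longrightarrow> inward_flux \<Omega> S F \<Longrightarrow>
     (\<And>x. (b has_derivative blinfun_apply (Db x)) (at x)) \<Longrightarrow> continuous_on UNIV Db \<Longrightarrow>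
     (\<And>x. 0 \<le> b x) \<Longrightarrow> (\<And>x. x \<notin> cball p r \<Longrightarrow> b x = 0) \<Longrightarrow>
     (LINT g:\<Omega>|lborel. (\<Sum>\<xi>\<in>S. b g * F' \<xi> g + F \<xi> g * Db g (lf \<xi> g))) \<le> 0"
proof -
  obtain D D2 where pU: "p \<in> U" and dd: "defining_derivs \<Omega> U \<phi> D D2"
    by (rule local_defining_derivs[OF loc])
  note oU = defining_derivsD(1)[OF dd] and cD = defining_derivsD(2)[OF dd] and fr = defining_derivsD(9)[OF dd]
  define c where "c \<xi> = D p (lf \<xi> p)" for \<xi>
  \<comment> \<open>At p this is the sum of the squares of \<open>c\<close>, positive because S
    spans and the differential does not vanish; by continuity it stays positive on a ball.\<close>
  define Q where "Q x = (\<Sum>\<xi>\<in>S. c \<xi> * D x (lf \<xi> x))" for x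
  have cQ: "continuous_on U Q" unfolding Q_def
    by (intro continuous_intros blinfun.continuous_on cD)
  obtain \<xi> where "\<xi> \<in> S" "c \<xi> \<noteq> 0"
    using span_lf_nonzero[OF S(2) defining_derivsD(7)[OF dd pU], of p] unfolding c_def by auto
  then have "Q p > 0" unfolding Q_def c_def[symmetric]
    using S(1) by (intro sum_pos2[of S \<xi>]) (auto simp: zero_less_mult_iff)
  have "open {x \<in> U. Q x \<in> {0<..}}"
    using continuous_open_preimage[OF cQ oU, of "{0<..}"] by (simp add: vimage_def Int_def)
  moreover have "p \<in> {x \<in> U. Q x \<in> {0<..}}" using pU \<open>Q p > 0\<close> by simp
  ultimately obtain r where r: "r > 0" "cball p r \<subseteq> {x \<in> U. Q x \<in> {0<..}}"
    using open_contains_cball[of "{x \<in> U. Q x \<in> {0<..}}"] by blast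
  have rU: "cball p r \<subseteq> U" and rQ: "\<And>x. x \<in> cball p r \<Longrightarrow> Q x > 0" using r by auto
  show ?thesis
  proof (rule that[OF r(1)])
    fix F F' b and Db :: "'a \<Rightarrow> 'a \<Rightarrow>\<^sub>L real"
    assume F: "\<And>\<xi>. \<xi> \<in> S \<Longrightarrow> X_regular \<Omega> \<xi> (F \<xi>) (F' \<xi>)" and flux: "inward_flux \<Omega> S F"
      and b: "\<And>x. (b has_derivative blinfun_apply (Db x)) (at x)" and Db: "continuous_on UNIV Db"
      and b0: "\<And>x. 0 \<le> b x" and bout: "\<And>x. x \<notin> cball p r \<Longrightarrow> b x = 0"
    have cb: "continuous_on A b" for A
      by (rule continuous_on_has_derivative, rule b)
    let ?H = "\<lambda>g. \<Sum>\<xi>\<in>S. b g * F' \<xi> g + F \<xi> g * Db g (lf \<xi> g)"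
    let ?E = "\<lambda>g. \<Sum>\<xi>\<in>S. c \<xi> * Db g (lf \<xi> g)"
    have iH: "set_integrable lborel \<Omega> ?H"
      by (intro set_integrable_closure \<Omega> continuous_intros cb blinfun.continuous_on continuous_on_subset[OF Db] X_regularD(1,2)[OF F]) auto
    have iE: "set_integrable lborel \<Omega> ?E"
      by (intro set_integrable_closure \<Omega> continuous_intros blinfun.continuous_on continuous_on_subset[OF Db]) auto
    have le: "(LINT g:\<Omega>|lborel. ?H g) \<le> \<delta> * (LINT g:\<Omega>|lborel. ?E g)" if "\<delta> > 0" for \<delta>
    proof -
      let ?F = "\<lambda>\<xi> x. F \<xi> x - \<delta> * c \<xi>"
      have "(LINT g:\<Omega>|lborel. (\<Sum>\<xi>\<in>S. b g * F' \<xi> g + ?F \<xi> g * Db g (lf \<xi> g))) \<le> 0"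
      proof (rule divergence_local_strict[OF \<Omega> S(1) loc rU _ b Db b0 bout])
        fix \<xi> assume \<xi>: "\<xi> \<in> S"
        show "X_regular \<Omega> \<xi> (?F \<xi>) (F' \<xi>)"
          unfolding X_regular_def
          using has_X_diff[OF X_regularD(3)[OF F[OF \<xi>]] has_X_const[of \<xi> "\<delta> * c \<xi>"]]
          by (auto intro!: continuous_intros X_regularD(1,2)[OF F[OF \<xi>]])
      next
        fix x assume x: "x \<in> frontier \<Omega>" "x \<in> cball p r"
        then have xU: "x \<in> U" using rU by auto
        have "(\<Sum>\<xi>\<in>S. F \<xi> x * frechet_derivative \<phi> (at x) (lf \<xi> x)) \<le> 0"
          using flux x(1) local_defining_mono[OF loc xU] unfolding inward_flux_def by blast
        moreover have "(\<Sum>\<xi>\<in>S. ?F \<xi> x * frechet_derivative \<phi> (at x) (lf \<xi> x))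
           = (\<Sum>\<xi>\<in>S. F \<xi> x * frechet_derivative \<phi> (at x) (lf \<xi> x)) - \<delta> * Q x"
          unfolding fr[OF xU] Q_def sum_distrib_left sum_subtractf[symmetric]
          by (intro sum.cong refl) (simp add: algebra_simps)
        moreover have "\<delta> * Q x > 0" using rQ[OF x(2)] that by simp
        ultimately show "(\<Sum>\<xi>\<in>S. ?F \<xi> x * frechet_derivative \<phi> (at x) (lf \<xi> x)) < 0" by simp
      qed
      moreover have "(LINT g:\<Omega>|lborel. (\<Sum>\<xi>\<in>S. b g * F' \<xi> g + ?F \<xi> g * Db g (lf \<xi> g)))
          = (LINT g:\<Omega>|lborel. ?H g - \<delta> * ?E g)"
        unfolding sum_distrib_left sum_subtractf[symmetric] by (simp add: algebra_simps)
      moreover have "\<dots> = (LINT g:\<Omega>|lborel. ?H g) - \<delta> * (LINT g:\<Omega>|lborel. ?E g)"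
        using iH iE by (subst set_integral_diff(2)) (auto intro: set_integrable_mult_right)
      ultimately show ?thesis by simp
    qed
    show "(LINT g:\<Omega>|lborel. ?H g) \<le> 0"
    proof (rule field_le_epsilon)
      fix e :: real assume "e > 0"
      let ?a = "LINT g:\<Omega>|lborel. ?E g"
      have "(LINT g:\<Omega>|lborel. ?H g) \<le> e / (\<bar>?a\<bar> + 1) * ?a" by (rule le) (use \<open>e > 0\<close> in auto)
      also have "\<dots> \<le> e / (\<bar>?a\<bar> + 1) * (\<bar>?a\<bar> + 1)"
        using \<open>e > 0\<close> by (intro mult_left_mono) auto
      also have "\<dots> = e" by simp
      finally show "(LINT g:\<Omega>|lborel. ?H g) \<le> 0 + e" by simp
    qed
  qed
qed

lemma divergence_local_interior:
  assumes \<Omega>: "open \<Omega>" "bounded \<Omega>" and S: "finite S" and r: "cball p r \<subseteq> \<Omega>"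
    and F: "\<And>\<xi>. \<xi> \<in> S \<Longrightarrow> X_regular \<Omega> \<xi> (F \<xi>) (F' \<xi>)"
    and b: "\<And>x. (b has_derivative blinfun_apply (Db x)) (at x)" and Db: "continuous_on UNIV Db"
    and bout: "\<And>x. x \<notin> cball p r \<Longrightarrow> b x = 0"
  shows "(LINT g:\<Omega>|lborel. (\<Sum>\<xi>\<in>S. b g * F' \<xi> g + F \<xi> g * Db g (lf \<xi> g))) = 0"
proof -
  have cb: "continuous_on A b" for A
    by (rule continuous_on_has_derivative, rule b)
  have *: "set_integrable lborel \<Omega> (\<lambda>g. b g * F' \<xi> g + F \<xi> g * Db g (lf \<xi> g))"
     "(LINT g:\<Omega>|lborel. b g * F' \<xi> g + F \<xi> g * Db g (lf \<xi> g)) = 0" if "\<xi> \<in> S" for \<xi>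
  proof -
    note c = X_regularD(1,2)[OF F[OF that], THEN continuous_on_subset, OF closure_subset]
    have 1: "continuous_on \<Omega> (\<lambda>g. b g * F \<xi> g)" by (intro continuous_intros cb c)
    have 2: "continuous_on \<Omega> (\<lambda>g. b g * F' \<xi> g + F \<xi> g * Db g (lf \<xi> g))"
      by (intro continuous_intros cb c blinfun.continuous_on continuous_on_subset[OF Db]) auto
    have 3: "has_X \<xi> (\<lambda>g. b g * F \<xi> g) (b g * F' \<xi> g + F \<xi> g * Db g (lf \<xi> g)) g" if "g \<in> \<Omega>" for g
      using has_X_mult[OF has_X_has_derivative[OF b] X_regularD(3)[OF F[OF \<open>\<xi> \<in> S\<close>] that]]
      by (simp add: algebra_simps)
    show "set_integrable lborel \<Omega> (\<lambda>g. b g * F' \<xi> g + F \<xi> g * Db g (lf \<xi> g))"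
      "(LINT g:\<Omega>|lborel. b g * F' \<xi> g + F \<xi> g * Db g (lf \<xi> g)) = 0"
      using set_integral_X_eq_0[OF \<Omega>(1) compact_cball r _ 1 2 3] bout by auto
  qed
  then show ?thesis by (simp add: set_integral_finite_sum)
qed

text \<open>Finitely many good balls cover the closure. Instead of normalising the bumps, the field
  is divided by their sum: F is then the sum of the bumps times \<open>E\<close>, and
  \<open>E\<close> is again regular with inward flux because the sum is positive. Adding the local
  inequalities for \<open>E\<close> gives the one for F.\<close>

lemma divergence_inequality:
  assumes \<Omega>: "C2_open_set \<Omega>" "bounded \<Omega>" and S: "finite S" "span S = UNIV"
    and F: "\<And>\<xi>. \<xi> \<in> S \<Longrightarrow> X_regular \<Omega> \<xi> (F \<xi>) (F' \<xi>)" and flux: "inward_flux \<Omega> S F"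
  shows "(LINT g:\<Omega>|lborel. (\<Sum>\<xi>\<in>S. F' \<xi> g)) \<le> 0"
proof -
  have op: "open \<Omega>" using \<Omega> by (simp add: C2_open_set_def)
  \<comment> \<open>Quantified over all admissible fields, because it is applied to
    \<open>E\<close>, which depends on the cover chosen by means of \<open>good\<close>.\<close>
  define good where "good p r \<longleftrightarrow> r > 0 \<and> (\<forall>F F'. (\<forall>\<xi>\<in>S. X_regular \<Omega> \<xi> (F \<xi>) (F' \<xi>)) \<and> inward_flux \<Omega> S F \<longrightarrow>
     (LINT g:\<Omega>|lborel. (\<Sum>\<xi>\<in>S. bump p r g * F' \<xi> g + F \<xi> g * bump' p r g (lf \<xi> g))) \<le> 0)" for p r
  have "\<exists>r. good p r" if p: "p \<in> closure \<Omega>" for p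
  proof (cases "p \<in> \<Omega>")
    case True
    then obtain r where r: "r > 0" "cball p r \<subseteq> \<Omega>" using op open_contains_cball by metis
    have "good p r" unfolding good_def
      using divergence_local_interior[OF op \<Omega>(2) S(1) r(2) _ bump_has_derivative continuous_bump' bump_outside[OF r(1)]] r(1)
      by (auto intro: order_eq_refl)
    then show ?thesis by blast
  next
    case False
    then have "p \<in> frontier \<Omega>" using closure_cases[OF op p] by blast
    then obtain U \<phi> where loc: "local_defining \<Omega> p U \<phi>" using \<Omega>(1) unfolding C2_open_set_def by meson
    obtain r where r: "r > 0" and good: "\<And>F F' b Db. (\<And>\<xi>. \<xi> \<in> S \<Longrightarrow> X_regular \<Omega> \<xi> (F \<xi>) (F' \<xi>)) \<Longrightarrow> inward_flux \<Omega> S F \<Longrightarrow>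
     (\<And>x. (b has_derivative blinfun_apply (Db x)) (at x)) \<Longrightarrow> continuous_on UNIV Db \<Longrightarrow>
     (\<And>x. 0 \<le> b x) \<Longrightarrow> (\<And>x. x \<notin> cball p r \<Longrightarrow> b x = 0) \<Longrightarrow>
     (LINT g:\<Omega>|lborel. (\<Sum>\<xi>\<in>S. b g * F' \<xi> g + F \<xi> g * Db g (lf \<xi> g))) \<le> 0"
      by (rule divergence_local_boundary[OF op \<Omega>(2) S loc]) blast
    have "good p r" unfolding good_def
      using good[OF _ _ bump_has_derivative continuous_bump' bump_nonneg bump_outside[OF r]] r by auto
    then show ?thesis by blast
  qed
  then obtain r where r: "\<And>p. p \<in> closure \<Omega> \<Longrightarrow> good p (r p)" by metis
  have "compact (closure \<Omega>)" using \<Omega>(2) by simp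
  then obtain P where P: "finite P" "P \<subseteq> closure \<Omega>" "closure \<Omega> \<subseteq> (\<Union>p\<in>P. ball p (r p))"
  proof (rule compactE_image[of _ "closure \<Omega>" "\<lambda>p. ball p (r p)"])
    show "closure \<Omega> \<subseteq> (\<Union>p\<in>closure \<Omega>. ball p (r p))"
      using r by (auto simp: good_def intro!: bexI)
  qed auto
  have rpos: "r p > 0" if "p \<in> P" for p using r P(2) that by (auto simp: good_def)
  define s where "s x = (\<Sum>p\<in>P. bump p (r p) x)" for x
  define Ds where "Ds x = (\<Sum>p\<in>P. bump' p (r p) x)" for x
  have s: "(s has_derivative blinfun_apply (Ds x)) (at x)" for x
    unfolding s_def[abs_def] Ds_def blinfun.sum_left
    by (rule has_derivative_sum) (rule bump_has_derivative)
  have cDs: "continuous_on A Ds" for A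
    unfolding Ds_def by (intro continuous_intros continuous_bump')
  have cs: "continuous_on A s" for A
    by (rule continuous_on_has_derivative, rule s)
  have spos: "s x > 0" if "x \<in> closure \<Omega>" for x
  proof -
    obtain p where "p \<in> P" "x \<in> ball p (r p)" using P(3) \<open>x \<in> closure \<Omega>\<close> by blast
    then show ?thesis unfolding s_def
      using P(1) bump_pos[OF rpos] bump_nonneg by (intro sum_pos2[of P p]) auto
  qed
  then have s0: "s x \<noteq> 0" if "x \<in> closure \<Omega>" for x using that by (simp add: less_imp_neq[symmetric])
  define E where "E \<xi> x = F \<xi> x / s x" for \<xi> x
  define E' where "E' \<xi> x = (F' \<xi> x * s x - F \<xi> x * Ds x (lf \<xi> x)) / (s x * s x)" for \<xi> x
  have E: "X_regular \<Omega> \<xi> (E \<xi>) (E' \<xi>)" if "\<xi> \<in> S" for \<xi>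
    unfolding X_regular_def
  proof (intro conjI ballI)
    note R = X_regularD[OF F[OF that]]
    show "continuous_on (closure \<Omega>) (E \<xi>)" "continuous_on (closure \<Omega>) (E' \<xi>)"
      unfolding E_def[abs_def] E'_def[abs_def]
      using s0 by (auto intro!: continuous_intros R cs cDs blinfun.continuous_on)
    show "has_X \<xi> (E \<xi>) (E' \<xi> g) g" if g: "g \<in> \<Omega>" for g
    proof -
      have sg: "s g \<noteq> 0" using s0 closure_subset[of \<Omega>] g by blast
      show ?thesis
        using DERIV_divide[OF R(3)[OF g, unfolded has_X_def] has_X_has_derivative[OF s, of \<xi> g, unfolded has_X_def]] sg
        unfolding has_X_def E_def[abs_def] E'_def[abs_def] by simp
    qed
  qed
  have Eflux: "inward_flux \<Omega> S E"
    unfolding inward_flux_def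
  proof (intro ballI allI impI)
    fix p U \<phi> assume p: "p \<in> frontier \<Omega>" "local_defining \<Omega> p U \<phi>"
    then have 1: "(\<Sum>\<xi>\<in>S. F \<xi> p * frechet_derivative \<phi> (at p) (lf \<xi> p)) \<le> 0"
      using flux unfolding inward_flux_def by blast
    have 2: "s p > 0" using p by (intro spos) (simp add: frontier_def)
    have "(\<Sum>\<xi>\<in>S. E \<xi> p * frechet_derivative \<phi> (at p) (lf \<xi> p))
       = (\<Sum>\<xi>\<in>S. F \<xi> p * frechet_derivative \<phi> (at p) (lf \<xi> p)) / s p"
      by (simp add: E_def sum_divide_distrib)
    also have "\<dots> \<le> 0" using 1 2 by (rule divide_nonpos_pos)
    finally show "(\<Sum>\<xi>\<in>S. E \<xi> p * frechet_derivative \<phi> (at p) (lf \<xi> p)) \<le> 0" .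
  qed
  let ?T = "\<lambda>p g. \<Sum>\<xi>\<in>S. bump p (r p) g * E' \<xi> g + E \<xi> g * bump' p (r p) g (lf \<xi> g)"
  have T: "(LINT g:\<Omega>|lborel. ?T p g) \<le> 0" if "p \<in> P" for p
  proof -
    have "good p (r p)" using r P(2) that by auto
    then show ?thesis using E Eflux unfolding good_def by auto
  qed
  have cbump: "continuous_on A (bump p q)" for A p q
    by (rule continuous_on_has_derivative, rule bump_has_derivative)
  have iT: "set_integrable lborel \<Omega> (?T p)" for p
    by (intro set_integrable_closure op \<Omega>(2) continuous_intros cbump blinfun.continuous_on continuous_bump' X_regularD(1,2)[OF E])
  have "(LINT g:\<Omega>|lborel. (\<Sum>\<xi>\<in>S. F' \<xi> g)) = (LINT g:\<Omega>|lborel. (\<Sum>p\<in>P. ?T p g))"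
  proof (rule set_lebesgue_integral_cong)
    show "\<Omega> \<in> sets lborel" using op by simp
    show "\<forall>g. g \<in> \<Omega> \<longrightarrow> (\<Sum>\<xi>\<in>S. F' \<xi> g) = (\<Sum>p\<in>P. ?T p g)"
    proof (intro allI impI)
      fix g assume "g \<in> \<Omega>"
      then have sg: "s g \<noteq> 0" using s0 closure_subset[of \<Omega>] by blast
      have "(\<Sum>p\<in>P. ?T p g) = (\<Sum>\<xi>\<in>S. \<Sum>p\<in>P. bump p (r p) g * E' \<xi> g + E \<xi> g * bump' p (r p) g (lf \<xi> g))"
        by (rule sum.swap)
      also have "\<dots> = (\<Sum>\<xi>\<in>S. s g * E' \<xi> g + E \<xi> g * Ds g (lf \<xi> g))"
        by (simp add: s_def Ds_def sum.distrib sum_distrib_left sum_distrib_right blinfun.sum_left)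
      also have "\<dots> = (\<Sum>\<xi>\<in>S. F' \<xi> g)"
        by (intro sum.cong refl) (simp add: E_def E'_def sg field_simps)
      finally show "(\<Sum>\<xi>\<in>S. F' \<xi> g) = (\<Sum>p\<in>P. ?T p g)" ..
    qed
  qed
  also have "\<dots> = (\<Sum>p\<in>P. LINT g:\<Omega>|lborel. ?T p g)"
    by (rule set_integral_finite_sum(2)) (rule iT)
  also have "\<dots> \<le> 0" using T by (rule sum_nonpos)
  finally show ?thesis .
qed

end

section \<open>Boundary values of derivatives\<close>

lemma has_real_derivative_along_line:
  assumes "(f has_derivative blinfun_apply f') (at (x + t *\<^sub>R v))"
  shows "((\<lambda>t. f (x + t *\<^sub>R v)) has_real_derivative f' v) (at t)"
proof -
  have "((\<lambda>t. x + t *\<^sub>R v) has_derivative (\<lambda>s. s *\<^sub>R v)) (at t)"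
    by (auto intro!: derivative_eq_intros)
  then have "((\<lambda>t. f (x + t *\<^sub>R v)) has_derivative (\<lambda>s. f' (s *\<^sub>R v))) (at t)"
    by (rule has_derivative_compose) (rule assms)
  moreover have "(\<lambda>s. f' (s *\<^sub>R v)) = (*) (f' v)" by (simp add: fun_eq_iff blinfun.scaleR_right)
  ultimately show ?thesis by (simp only: has_field_derivative_def)
qed

text \<open>Measures the distance of x to the boundary along one fixed direction - n, inside
  \<open>U\<close> and a ball around p, so that a one-variable mean value theorem can compare an
  interior value with a boundary value.\<close>

definition exits_at :: "'a::euclidean_space set \<Rightarrow> 'a set \<Rightarrow> 'a \<Rightarrow> real \<Rightarrow> 'a \<Rightarrow> 'a \<Rightarrow> real \<Rightarrow> bool" where
  "exits_at \<Omega> U p R n x s \<longleftrightarrow> 0 < s \<and> (\<forall>\<sigma>\<in>{0..s}. x - \<sigma> *\<^sub>R n \<in> U \<and> norm (x - \<sigma> *\<^sub>R n - p) \<le> R) \<and>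
     (\<forall>\<sigma>\<in>{0..<s}. x - \<sigma> *\<^sub>R n \<in> \<Omega>) \<and> x - s *\<^sub>R n \<in> frontier \<Omega>"

lemma exits_atD:
  assumes "exits_at \<Omega> U p R n x s"
  shows "0 < s" "\<And>\<sigma>. 0 \<le> \<sigma> \<Longrightarrow> \<sigma> \<le> s \<Longrightarrow> x - \<sigma> *\<^sub>R n \<in> U"
    "\<And>\<sigma>. 0 \<le> \<sigma> \<Longrightarrow> \<sigma> \<le> s \<Longrightarrow> norm (x - \<sigma> *\<^sub>R n - p) \<le> R"
    "\<And>\<sigma>. 0 \<le> \<sigma> \<Longrightarrow> \<sigma> < s \<Longrightarrow> x - \<sigma> *\<^sub>R n \<in> \<Omega>" "x - s *\<^sub>R n \<in> frontier \<Omega>"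
    "x \<in> \<Omega> \<inter> U" "norm (x - p) \<le> R"
proof -
  show *: "0 < s" "\<And>\<sigma>. 0 \<le> \<sigma> \<Longrightarrow> \<sigma> \<le> s \<Longrightarrow> x - \<sigma> *\<^sub>R n \<in> U"
    "\<And>\<sigma>. 0 \<le> \<sigma> \<Longrightarrow> \<sigma> \<le> s \<Longrightarrow> norm (x - \<sigma> *\<^sub>R n - p) \<le> R"
    "\<And>\<sigma>. 0 \<le> \<sigma> \<Longrightarrow> \<sigma> < s \<Longrightarrow> x - \<sigma> *\<^sub>R n \<in> \<Omega>" "x - s *\<^sub>R n \<in> frontier \<Omega>"
    using assms by (simp_all add: exits_at_def)
  show "x \<in> \<Omega> \<inter> U" "norm (x - p) \<le> R" using *(1) *(2)[of 0] *(3)[of 0] *(4)[of 0] by simp_all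
qed

text \<open>
  The parabola \<open>c t\<^sup>2\<close> pushes the tangential segment \<open>p + r a\<close>, \<open>\<bar>r\<bar> \<le> t\<close>, into \<open>\<Omega>\<close> while
  keeping it at distance \<open>O(t\<^sup>2)\<close> of the boundary.
\<close>

lemma boundary_curve:
  fixes \<Omega> :: "'a::euclidean_space set"
  assumes op: "open \<Omega>" and dd: "defining_derivs \<Omega> U \<phi> D D2" and p: "p \<in> U" "\<phi> p = 0" and a: "D p a = 0"
  shows "\<exists>n c C t0. t0 > 0 \<and> C > 0 \<and> (\<forall>t r. 0 < t \<longrightarrow> t < t0 \<longrightarrow> \<bar>r\<bar> \<le> t \<longrightarrow>
     (\<exists>s. s \<le> C * t\<^sup>2 \<and> exits_at \<Omega> U p (C * t) n ((p + (c * t\<^sup>2) *\<^sub>R n) + r *\<^sub>R a) s))"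
proof -
  note oU = defining_derivsD(1)[OF dd] and cD = defining_derivsD(2)[OF dd] and cD2 = defining_derivsD(3)[OF dd]
    and c\<phi> = defining_derivsD(4)[OF dd]
    and \<phi> = defining_derivsD(5)[OF dd] and D2 = defining_derivsD(6)[OF dd] and in\<Omega> = defining_derivsD(8)[OF dd]
  have "\<exists>v. D p v \<noteq> 0"
  proof (rule ccontr)
    assume "\<not> ?thesis"
    then have "D p = 0" by (intro blinfun_eqI) simp
    then show False using defining_derivsD(7)[OF dd p(1)] by simp
  qed
  then obtain v where v: "D p v \<noteq> 0" by blast
  \<comment> \<open>Normalised so that moving along n lowers \<open>\<phi>\<close> at unit rate at
    p; on a small ball the rate is still at least 1/2.\<close>
  define n where "n = (- 1 / D p v) *\<^sub>R v"
  have n: "D p n = -1" using v by (simp add: n_def blinfun.scaleR_right blinfun.minus_right)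
  have "continuous_on U (\<lambda>x. D x n)" by (intro continuous_intros blinfun.continuous_on cD)
  then have "open {x \<in> U. D x n \<in> {..< -1/2}}"
    using continuous_open_preimage[OF _ oU open_lessThan] by (simp add: vimage_def Int_def)
  moreover have "p \<in> {x \<in> U. D x n \<in> {..< -1/2}}" using p n by simp
  ultimately obtain r0 where r0: "r0 > 0" "cball p r0 \<subseteq> {x \<in> U. D x n \<in> {..< -1/2}}"
    using open_contains_cball[of "{x \<in> U. D x n \<in> {..< -1/2}}"] by blast
  have cU: "cball p r0 \<subseteq> U" and cn: "\<And>x. x \<in> cball p r0 \<Longrightarrow> D x n < -1/2" using r0 by auto
  have "bounded (D2 ` cball p r0)"
    by (intro compact_imp_bounded compact_continuous_image continuous_on_subset[OF cD2 cU] compact_cball)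
  then obtain B where "\<forall>y\<in>D2 ` cball p r0. norm y \<le> B"
    unfolding bounded_iff ..
  then have B: "\<And>x. x \<in> cball p r0 \<Longrightarrow> norm (D2 x) \<le> B" by simp
  have B0: "B \<ge> 0" by (rule order_trans[OF norm_ge_zero B[of p]]) (use r0(1) in simp)
  have Dlip: "norm (D x - D p) \<le> B * norm (x - p)" if "x \<in> cball p r0" for x
  proof (rule differentiable_bound[OF convex_cball])
    show "(D has_derivative blinfun_apply (D2 y)) (at y within cball p r0)" if "y \<in> cball p r0" for y
      by (rule has_derivative_at_withinI, rule D2) (use cU that in auto)
    show "onorm (blinfun_apply (D2 y)) \<le> B" if "y \<in> cball p r0" for y
      using B[OF that] by (simp add: norm_blinfun.rep_eq)
  qed (use that r0(1) in auto)
  \<comment> \<open>Coefficient of the quadratic bound for \<open>\<phi>\<close> on the tangential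
    segment, where the linear term is absent as \<open>D p a = 0\<close>. The added 1 ensures
    positivity.\<close>
  define B1 where "B1 = B * (norm a)\<^sup>2 + 1"
  have B1: "B1 > 0" using B0 by (simp add: B1_def add_nonneg_pos)
  have quad: "\<bar>\<phi> (p + r *\<^sub>R a)\<bar> \<le> B1 * r\<^sup>2" if r: "norm (r *\<^sub>R a) \<le> r0" for r
  proof -
    have inb: "p + t *\<^sub>R (r *\<^sub>R a) \<in> cball p r0" if "0 \<le> t" "t \<le> 1" for t
    proof -
      have "norm (t *\<^sub>R (r *\<^sub>R a)) \<le> 1 * norm (r *\<^sub>R a)"
        unfolding norm_scaleR[of t] using that by (intro mult_right_mono) auto
      then show ?thesis using r by (simp add: dist_norm)
    qed
    have "\<exists>t>0. t < 1 \<and> \<phi> (p + 1 *\<^sub>R (r *\<^sub>R a)) - \<phi> (p + 0 *\<^sub>R (r *\<^sub>R a)) = (1 - 0) * D (p + t *\<^sub>R (r *\<^sub>R a)) (r *\<^sub>R a)"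
      using inb cU by (intro MVT2 has_real_derivative_along_line \<phi>) auto
    then obtain t where t: "0 < t" "t < 1" "\<phi> (p + r *\<^sub>R a) = D (p + t *\<^sub>R (r *\<^sub>R a)) (r *\<^sub>R a)"
      using p(2) by auto
    have "D (p + t *\<^sub>R (r *\<^sub>R a)) (r *\<^sub>R a) = (D (p + t *\<^sub>R (r *\<^sub>R a)) - D p) (r *\<^sub>R a)"
      using a by (simp add: blinfun.diff_left blinfun.scaleR_right)
    then have "\<bar>\<phi> (p + r *\<^sub>R a)\<bar> \<le> norm (D (p + t *\<^sub>R (r *\<^sub>R a)) - D p) * norm (r *\<^sub>R a)"
      using t(3) norm_blinfun[of "D (p + t *\<^sub>R (r *\<^sub>R a)) - D p" "r *\<^sub>R a"] by simp
    also have "\<dots> \<le> (B * norm (r *\<^sub>R a)) * norm (r *\<^sub>R a)"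
    proof (rule mult_right_mono)
      have "norm (D (p + t *\<^sub>R (r *\<^sub>R a)) - D p) \<le> B * norm (t *\<^sub>R (r *\<^sub>R a))"
        using Dlip[of "p + t *\<^sub>R (r *\<^sub>R a)"] inb[of t] t by simp
      also have "\<dots> \<le> B * norm (r *\<^sub>R a)"
        using t B0 by (intro mult_left_mono) (auto simp: abs_mult intro!: mult_right_mono mult_left_le_one_le)
      finally show "norm (D (p + t *\<^sub>R (r *\<^sub>R a)) - D p) \<le> B * norm (r *\<^sub>R a)" .
    qed simp
    also have "\<dots> = B * (norm a)\<^sup>2 * r\<^sup>2" by (simp add: power2_eq_square mult_ac)
    also have "\<dots> \<le> B1 * r\<^sup>2" by (simp add: B1_def algebra_simps)
    finally show ?thesis .
  qed
  have desc: "\<phi> (x - \<tau> *\<^sub>R n) + (\<sigma> - \<tau>) / 2 \<le> \<phi> (x - \<sigma> *\<^sub>R n)"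
    if "\<tau> < \<sigma>" "\<And>\<rho>. \<tau> \<le> \<rho> \<Longrightarrow> \<rho> \<le> \<sigma> \<Longrightarrow> x - \<rho> *\<^sub>R n \<in> cball p r0" for x \<tau> \<sigma>
  proof -
    have "\<exists>z>\<tau>. z < \<sigma> \<and> \<phi> (x + \<sigma> *\<^sub>R (- n)) - \<phi> (x + \<tau> *\<^sub>R (- n)) = (\<sigma> - \<tau>) * D (x + z *\<^sub>R (- n)) (- n)"
    proof (rule MVT2[OF that(1)])
      fix \<rho> assume "\<tau> \<le> \<rho>" "\<rho> \<le> \<sigma>"
      then have "x + \<rho> *\<^sub>R (- n) \<in> U" using that(2)[of \<rho>] cU by auto
      then show "((\<lambda>\<sigma>. \<phi> (x + \<sigma> *\<^sub>R (- n))) has_real_derivative D (x + \<rho> *\<^sub>R (- n)) (- n)) (at \<rho>)"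
        by (intro has_real_derivative_along_line \<phi>)
    qed
    then obtain z where z: "\<tau> < z" "z < \<sigma>" "\<phi> (x - \<sigma> *\<^sub>R n) - \<phi> (x - \<tau> *\<^sub>R n) = (\<sigma> - \<tau>) * - D (x - z *\<^sub>R n) n"
      by (auto simp: blinfun.minus_right)
    have "1/2 \<le> - D (x - z *\<^sub>R n) n" using cn[of "x - z *\<^sub>R n"] that(2)[of z] z by simp
    then have "(\<sigma> - \<tau>) * (1/2) \<le> (\<sigma> - \<tau>) * - D (x - z *\<^sub>R n) n" using that(1) by (intro mult_left_mono) auto
    then show ?thesis using z(3) by argo
  qed
  \<comment> \<open>Shifting by 4 B1 t^2 along n lowers \<open>\<phi>\<close> by at least 2 B1 t^2,
    which beats the bound B1 t^2 on the segment. Moving back by 6 B1 t^2 overshoots the segment by 2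
    B1 t^2 and makes \<open>\<phi>\<close> nonnegative, so an exit lies in between. \<open>C\<close>
    adds up these lengths for the distance to p and also bounds the exit time.\<close>
  define c where "c = 4 * B1"
  define C where "C = 10 * B1 * norm n + norm a + 6 * B1"
  have C: "C > 0" unfolding C_def using B1 by (simp add: add_nonneg_pos)
  define t0 where "t0 = min 1 (r0 / C)"
  have t0: "t0 > 0" using C r0(1) by (simp add: t0_def)
  show ?thesis
  proof (rule exI[of _ n], rule exI[of _ c], rule exI[of _ C], rule exI[of _ t0], intro conjI allI impI t0 C)
    fix t r :: real assume t: "0 < t" "t < t0" and r: "\<bar>r\<bar> \<le> t"
    have t1: "t < 1" "C * t < r0" using t C by (auto simp: t0_def pos_less_divide_eq mult.commute)
    have tt: "t\<^sup>2 \<le> t" using t t1 by (simp add: power2_eq_square mult_left_le_one_le)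
    define x where "x = (p + (c * t\<^sup>2) *\<^sub>R n) + r *\<^sub>R a"
    define S where "S = 6 * B1 * t\<^sup>2"
    have nb: "norm (x - \<sigma> *\<^sub>R n - p) \<le> C * t" if "0 \<le> \<sigma>" "\<sigma> \<le> S" for \<sigma>
    proof -
      have "norm (x - \<sigma> *\<^sub>R n - p) = norm ((c * t\<^sup>2) *\<^sub>R n + r *\<^sub>R a - \<sigma> *\<^sub>R n)" by (simp add: x_def algebra_simps)
      also have "\<dots> \<le> norm ((c * t\<^sup>2) *\<^sub>R n) + norm (r *\<^sub>R a) + norm (\<sigma> *\<^sub>R n)"
        by (meson norm_triangle_ineq norm_triangle_ineq4 add_right_mono order_trans)
      also have "\<dots> = c * t\<^sup>2 * norm n + \<bar>r\<bar> * norm a + \<sigma> * norm n" using that(1) B1 by (simp add: c_def)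
      also have "\<dots> \<le> (4 * B1) * t * norm n + t * norm a + 6 * B1 * t * norm n"
      proof (intro add_mono mult_right_mono)
        show "c * t\<^sup>2 \<le> 4 * B1 * t" using tt B1 by (simp add: c_def)
        have "S \<le> 6 * B1 * t" using tt B1 by (simp add: S_def)
        then show "\<sigma> \<le> 6 * B1 * t" using that by simp
      qed (use r in auto)
      also have "\<dots> \<le> C * t" using B1 t by (simp add: C_def algebra_simps)
      finally show ?thesis .
    qed
    have inb: "x - \<sigma> *\<^sub>R n \<in> cball p r0" if "0 \<le> \<sigma>" "\<sigma> \<le> S" for \<sigma>
    proof -
      have "dist p (x - \<sigma> *\<^sub>R n) \<le> C * t" using nb[OF that] by (simp add: dist_norm norm_minus_commute)
      then show ?thesis using t1 by simp
    qed
    have cS: "0 < c * t\<^sup>2" "c * t\<^sup>2 < S" "S - c * t\<^sup>2 = 2 * B1 * t\<^sup>2" using B1 t by (auto simp: c_def S_def algebra_simps)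
    have xc: "x - (c * t\<^sup>2) *\<^sub>R n = p + r *\<^sub>R a" by (simp add: x_def)
    have "\<bar>\<phi> (p + r *\<^sub>R a)\<bar> \<le> B1 * r\<^sup>2"
      by (rule quad) (use inb[of "c * t\<^sup>2"] cS xc in \<open>simp add: dist_norm\<close>)
    also have "\<dots> \<le> B1 * t\<^sup>2" using r B1 by (intro mult_left_mono power2_le_iff_abs_le[THEN iffD2]) auto
    finally have \<phi>y: "\<bar>\<phi> (p + r *\<^sub>R a)\<bar> \<le> B1 * t\<^sup>2" .
    have "\<phi> (x - 0 *\<^sub>R n) + (c * t\<^sup>2 - 0) / 2 \<le> \<phi> (x - (c * t\<^sup>2) *\<^sub>R n)"
      by (rule desc) (use inb cS in auto)
    moreover have "B1 * t\<^sup>2 > 0" using B1 t by simp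
    ultimately have \<phi>x: "\<phi> x < 0" using \<phi>y unfolding xc by (simp add: c_def)
    have "\<phi> (x - (c * t\<^sup>2) *\<^sub>R n) + (S - c * t\<^sup>2) / 2 \<le> \<phi> (x - S *\<^sub>R n)"
      by (rule desc) (use inb cS in auto)
    then have \<phi>S: "0 \<le> \<phi> (x - S *\<^sub>R n)" using \<phi>y unfolding xc cS(3) by simp
    have S0: "0 < S" using cS by simp
    have contl: "continuous_on {0..S} (\<lambda>\<sigma>. \<phi> (x - \<sigma> *\<^sub>R n))"
    proof (rule continuous_on_compose2[OF c\<phi>])
      show "continuous_on {0..S} (\<lambda>\<sigma>. x - \<sigma> *\<^sub>R n)" by (intro continuous_intros)
      show "(\<lambda>\<sigma>. x - \<sigma> *\<^sub>R n) ` {0..S} \<subseteq> U" using inb cU by auto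
    qed
    obtain s where s: "0 \<le> s" "s \<le> S" "\<phi> (x - s *\<^sub>R n) = 0"
      using IVT'[of "\<lambda>\<sigma>. \<phi> (x - \<sigma> *\<^sub>R n)" 0 0 S] \<phi>x \<phi>S S0 contl by auto
    have "s \<noteq> 0" using s(3) \<phi>x by auto
    then have s0: "0 < s" using s by simp
    have in1: "x - \<sigma> *\<^sub>R n \<in> \<Omega>" if "0 \<le> \<sigma>" "\<sigma> < s" for \<sigma>
    proof -
      have "\<phi> (x - \<sigma> *\<^sub>R n) + (s - \<sigma>) / 2 \<le> \<phi> (x - s *\<^sub>R n)"
        by (rule desc) (use inb that s in auto)
      then have "\<phi> (x - \<sigma> *\<^sub>R n) < 0" using s(3) that by argo
      moreover have "x - \<sigma> *\<^sub>R n \<in> U" using inb[of \<sigma>] that s cU by auto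
      ultimately show ?thesis using in\<Omega> by simp
    qed
    have "x - s *\<^sub>R n \<notin> \<Omega>" using in\<Omega>[of "x - s *\<^sub>R n"] inb[of s] s cU by auto
    moreover have "x - s *\<^sub>R n \<in> closure \<Omega>"
    proof -
      have "(\<lambda>\<sigma>. x - \<sigma> *\<^sub>R n) ` closure {0..<s} \<subseteq> closure \<Omega>"
        by (rule image_closure_subset) (use in1 closure_subset[of \<Omega>] in \<open>auto intro!: continuous_intros\<close>)
      moreover have "s \<in> closure {0..<s}" using s0 by simp
      ultimately show ?thesis by blast
    qed
    ultimately have fr: "x - s *\<^sub>R n \<in> frontier \<Omega>" using op by (simp add: frontier_def interior_open)
    show "\<exists>s. s \<le> C * t\<^sup>2 \<and> exits_at \<Omega> U p (C * t) n ((p + (c * t\<^sup>2) *\<^sub>R n) + r *\<^sub>R a) s"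
      unfolding x_def[symmetric] exits_at_def
    proof (intro exI[of _ s] conjI ballI s0 fr)
      have "S \<le> C * t\<^sup>2" unfolding S_def C_def using B1 by (intro mult_right_mono) auto
      then show "s \<le> C * t\<^sup>2" using s by simp
    next
      fix \<sigma> assume "\<sigma> \<in> {0..s}"
      then show "x - \<sigma> *\<^sub>R n \<in> U" "norm (x - \<sigma> *\<^sub>R n - p) \<le> C * t" using inb[of \<sigma>] nb[of \<sigma>] s cU by auto
    next
      fix \<sigma> assume "\<sigma> \<in> {0..<s}"
      then show "x - \<sigma> *\<^sub>R n \<in> \<Omega>" using in1 by auto
    qed
  qed
qed

text \<open>Mean value theorem on the exit segment, whose far end lies where w is zero and whose
  length is of order t^2. At that end only continuity is available.\<close>

lemma vanishing_near_boundary: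
  fixes w :: "'a::euclidean_space \<Rightarrow> real"
  assumes s: "0 < s" "s \<le> C * t\<^sup>2" and M: "M \<ge> 0"
    and \<Omega>: "\<And>\<sigma>. 0 \<le> \<sigma> \<Longrightarrow> \<sigma> < s \<Longrightarrow> x - \<sigma> *\<^sub>R n \<in> \<Omega>" and fr: "w (x - s *\<^sub>R n) = 0"
    and w: "\<And>\<sigma>. 0 \<le> \<sigma> \<Longrightarrow> \<sigma> < s \<Longrightarrow> (w has_derivative blinfun_apply (Dw (x - \<sigma> *\<^sub>R n))) (at (x - \<sigma> *\<^sub>R n))"
    and bd: "\<And>\<sigma>. 0 \<le> \<sigma> \<Longrightarrow> \<sigma> < s \<Longrightarrow> norm (Dw (x - \<sigma> *\<^sub>R n)) \<le> M"
    and cont: "continuous_on {0..s} (\<lambda>\<sigma>. w (x - \<sigma> *\<^sub>R n))"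
  shows "\<bar>w x\<bar> \<le> M * norm n * C * t\<^sup>2"
proof -
  have d: "((\<lambda>\<sigma>. w (x - \<sigma> *\<^sub>R n)) has_real_derivative Dw (x - \<sigma> *\<^sub>R n) (- n)) (at \<sigma>)" if "0 \<le> \<sigma>" "\<sigma> < s" for \<sigma>
    using has_real_derivative_along_line[of w "Dw (x - \<sigma> *\<^sub>R n)" x \<sigma> "- n"] w[OF that] by simp
  have "\<exists>l z. 0 < z \<and> z < s \<and> ((\<lambda>\<sigma>. w (x - \<sigma> *\<^sub>R n)) has_real_derivative l) (at z) \<and>
      w (x - s *\<^sub>R n) - w (x - 0 *\<^sub>R n) = (s - 0) * l"
  proof (rule MVT[OF s(1) cont])
    fix z :: real assume "0 < z" "z < s"
    then have "((\<lambda>\<sigma>. w (x - \<sigma> *\<^sub>R n)) has_real_derivative Dw (x - z *\<^sub>R n) (- n)) (at z)" by (intro d) simp_all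
    then show "(\<lambda>\<sigma>. w (x - \<sigma> *\<^sub>R n)) differentiable (at z)"
      unfolding real_differentiable_def by (rule exI)
  qed
  then obtain l z where z: "0 < z" "z < s" "((\<lambda>\<sigma>. w (x - \<sigma> *\<^sub>R n)) has_real_derivative l) (at z)"
    "w (x - s *\<^sub>R n) - w x = s * l" by auto
  have l: "l = Dw (x - z *\<^sub>R n) (- n)" by (rule DERIV_unique[OF z(3) d]) (use z in simp_all)
  have "w x = - (s * l)" using z(4) fr by simp
  then have "\<bar>w x\<bar> = s * \<bar>l\<bar>" using s(1) by (simp add: abs_mult)
  also have "\<dots> \<le> s * (M * norm n)"
  proof (rule mult_left_mono)
    have "\<bar>l\<bar> \<le> norm (Dw (x - z *\<^sub>R n)) * norm n" unfolding l using norm_blinfun[of "Dw (x - z *\<^sub>R n)" "- n"] by simp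
    also have "\<dots> \<le> M * norm n" using bd[of z] z by (intro mult_right_mono) auto
    finally show "\<bar>l\<bar> \<le> M * norm n" .
  qed (use s in simp)
  also have "\<dots> \<le> (C * t\<^sup>2) * (M * norm n)" using s M by (intro mult_right_mono) auto
  finally show ?thesis by (simp add: mult_ac)
qed

lemma boundary_curveE:
  fixes \<Omega> :: "'a::euclidean_space set"
  assumes op: "open \<Omega>" and dd: "defining_derivs \<Omega> U \<phi> D D2" and p: "p \<in> U" "\<phi> p = 0" and a: "D p a = 0"
  obtains n and C :: real and q :: "nat \<Rightarrow> 'a" and t :: "nat \<Rightarrow> real"
  where "C > 0" "\<forall>k. t k > 0" "t \<longlonglongrightarrow> 0"
    "\<forall>k r. \<bar>r\<bar> \<le> t k \<longrightarrow> (\<exists>s. s \<le> C * (t k)\<^sup>2 \<and> exits_at \<Omega> U p (C * t k) n (q k + r *\<^sub>R a) s)"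
proof -
  obtain n c C t0 where *: "t0 > 0" "C > 0" "\<forall>t r. 0 < t \<longrightarrow> t < t0 \<longrightarrow> \<bar>r\<bar> \<le> t \<longrightarrow>
     (\<exists>s. s \<le> C * t\<^sup>2 \<and> exits_at \<Omega> U p (C * t) n ((p + (c * t\<^sup>2) *\<^sub>R n) + r *\<^sub>R a) s)"
    using boundary_curve[OF assms] by (elim exE conjE) (rule that)
  define t where "t k = t0 / (real k + 2)" for k
  have t: "0 < t k" "t k < t0" for k using *(1) by (auto simp: t_def pos_divide_less_eq algebra_simps add_pos_nonneg)
  have "(\<lambda>k. t0 / (real k + 2)) \<longlonglongrightarrow> 0" by real_asymp
  then have lim: "t \<longlonglongrightarrow> 0" by (simp add: t_def[abs_def])
  show ?thesis
    by (rule that[of C t n "\<lambda>k. p + (c * (t k)\<^sup>2) *\<^sub>R n"]) (use *(2,3) t lim in simp_all)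
qed

lemma boundary_estimate:
  fixes w :: "'a::euclidean_space \<Rightarrow> real"
  assumes s: "s \<le> C * t\<^sup>2" and ex: "exits_at \<Omega> U p R n x s"
    and M: "M \<ge> 0" and w: "\<And>x. x \<in> \<Omega> \<inter> U \<Longrightarrow> (w has_derivative blinfun_apply (Dw x)) (at x)"
    and cw: "continuous_on (closure \<Omega> \<inter> U) w" and w0: "\<And>x. x \<in> frontier \<Omega> \<inter> U \<Longrightarrow> w x = 0"
    and bd: "\<And>y. y \<in> \<Omega> \<inter> U \<Longrightarrow> norm (y - p) \<le> R \<Longrightarrow> norm (Dw y) \<le> M"
  shows "\<bar>w x\<bar> \<le> M * norm n * C * t\<^sup>2"
proof (rule vanishing_near_boundary[OF exits_atD(1)[OF ex] s M])
  note e = exits_atD[OF ex]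
  fix \<sigma> :: real assume \<sigma>: "0 \<le> \<sigma>" "\<sigma> < s"
  then have in1: "x - \<sigma> *\<^sub>R n \<in> \<Omega> \<inter> U" using e(2)[of \<sigma>] e(4)[of \<sigma>] by simp
  then show "x - \<sigma> *\<^sub>R n \<in> \<Omega>" by simp
  show "norm (Dw (x - \<sigma> *\<^sub>R n)) \<le> M" using bd[OF in1] e(3)[of \<sigma>] \<sigma> by simp
  show "(w has_derivative blinfun_apply (Dw (x - \<sigma> *\<^sub>R n))) (at (x - \<sigma> *\<^sub>R n))" by (rule w[OF in1])
next
  note e = exits_atD[OF ex]
  show "w (x - s *\<^sub>R n) = 0" using e(1,5) e(2)[of s] by (intro w0) simp
  show "continuous_on {0..s} (\<lambda>\<sigma>. w (x - \<sigma> *\<^sub>R n))"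
  proof (rule continuous_on_compose2[OF cw])
    show "continuous_on {0..s} (\<lambda>\<sigma>. x - \<sigma> *\<^sub>R n)" by (intro continuous_intros)
    show "(\<lambda>\<sigma>. x - \<sigma> *\<^sub>R n) ` {0..s} \<subseteq> closure \<Omega> \<inter> U"
    proof (rule image_subsetI)
      fix \<sigma> assume \<sigma>: "\<sigma> \<in> {0..s}"
      have "x - \<sigma> *\<^sub>R n \<in> closure \<Omega>"
      proof (cases "\<sigma> = s")
        case True then show ?thesis using e(5) by (simp add: frontier_def)
      next
        case False
        then have "x - \<sigma> *\<^sub>R n \<in> \<Omega>" using e(4)[of \<sigma>] \<sigma> by simp
        then show ?thesis using closure_subset[of \<Omega>] by blast
      qed
      then show "x - \<sigma> *\<^sub>R n \<in> closure \<Omega> \<inter> U" using e(2)[of \<sigma>] \<sigma> by simp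
    qed
  qed
qed

text \<open>On segments of half-length t just inside \<Omega> the values of w are of order t^2, so
  by the mean value theorem \<open>Dw\<close> applied to a is of order t somewhere near p. As
  \<open>Dw p\<close> is not a derivative but a limit from inside, continuity up to the boundary
  then finishes.\<close>

lemma boundary_first_order:
  fixes w :: "'a::euclidean_space \<Rightarrow> real"
  assumes op: "open \<Omega>" and dd: "defining_derivs \<Omega> U \<phi> D D2" and p: "p \<in> U" "p \<in> frontier \<Omega>" "\<phi> p = 0" and a: "D p a = 0"
    and w: "\<And>x. x \<in> \<Omega> \<inter> U \<Longrightarrow> (w has_derivative blinfun_apply (Dw x)) (at x)"
    and cw: "continuous_on (closure \<Omega> \<inter> U) w" and w0: "\<And>x. x \<in> frontier \<Omega> \<inter> U \<Longrightarrow> w x = 0"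
    and cDw: "continuous_on (closure \<Omega> \<inter> U) Dw" and bd: "\<And>x. x \<in> \<Omega> \<inter> U \<Longrightarrow> norm (Dw x) \<le> M"
  shows "Dw p a = 0"
proof -
  obtain n C q t where C: "C > 0" and t0: "\<forall>k. t k > 0" and t2: "t \<longlonglongrightarrow> 0"
    and q: "\<forall>k r. \<bar>r\<bar> \<le> t k \<longrightarrow> (\<exists>s. s \<le> C * (t k)\<^sup>2 \<and> exits_at \<Omega> U p (C * t k) n (q k + r *\<^sub>R a) s)"
    by (rule boundary_curveE[OF op dd p(1,3) a])
  note t = t0[rule_format] t2
  have q0: "q k + r *\<^sub>R a \<in> \<Omega> \<inter> U" "norm (q k + r *\<^sub>R a - p) \<le> C * t k" if r: "\<bar>r\<bar> \<le> t k" for k r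
  proof -
    obtain s where "exits_at \<Omega> U p (C * t k) n (q k + r *\<^sub>R a) s" using q r by meson
    then show "q k + r *\<^sub>R a \<in> \<Omega> \<inter> U" "norm (q k + r *\<^sub>R a - p) \<le> C * t k" by (rule exits_atD)+
  qed
  have M: "M \<ge> 0" 
    by (rule order_trans[OF norm_ge_zero bd[OF q0(1)[of 0 0]]]) (use t(1)[of 0] in simp)
  have small: "\<bar>w (q k + r *\<^sub>R a)\<bar> \<le> M * norm n * C * (t k)\<^sup>2" if r: "\<bar>r\<bar> \<le> t k" for k r
  proof -
    obtain s where s: "s \<le> C * (t k)\<^sup>2" "exits_at \<Omega> U p (C * t k) n (q k + r *\<^sub>R a) s" using q r by meson
    show ?thesis by (rule boundary_estimate[OF s M w cw w0 bd])
  qed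
  have "\<exists>z. \<bar>z\<bar> \<le> t k \<and> \<bar>Dw (q k + z *\<^sub>R a) a\<bar> \<le> M * norm n * C * t k" for k
  proof -
    have "\<exists>z>- t k. z < t k \<and> w (q k + t k *\<^sub>R a) - w (q k + (- t k) *\<^sub>R a) = (t k - (- t k)) * Dw (q k + z *\<^sub>R a) a"
      using t(1)[of k] by (intro MVT2 has_real_derivative_along_line w q0) auto
    then obtain z where z: "- t k < z" "z < t k" "w (q k + t k *\<^sub>R a) - w (q k + (- t k) *\<^sub>R a) = 2 * t k * Dw (q k + z *\<^sub>R a) a"
      by auto
    have "2 * t k * \<bar>Dw (q k + z *\<^sub>R a) a\<bar> = \<bar>w (q k + t k *\<^sub>R a) - w (q k + (- t k) *\<^sub>R a)\<bar>"
      unfolding z(3) using t(1)[of k] by (simp add: abs_mult)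
    also have "\<dots> \<le> \<bar>w (q k + t k *\<^sub>R a)\<bar> + \<bar>w (q k + (- t k) *\<^sub>R a)\<bar>" by (rule abs_triangle_ineq4)
    also have "\<dots> \<le> M * norm n * C * (t k)\<^sup>2 + M * norm n * C * (t k)\<^sup>2"
      using t(1)[of k] by (intro add_mono small) auto
    also have "\<dots> = 2 * t k * (M * norm n * C * t k)" by (simp add: power2_eq_square)
    finally have "\<bar>Dw (q k + z *\<^sub>R a) a\<bar> \<le> M * norm n * C * t k" using t(1)[of k] by simp
    then show ?thesis using z by (intro exI[of _ z]) auto
  qed
  then obtain z where z: "\<And>k. \<bar>z k\<bar> \<le> t k" "\<And>k. \<bar>Dw (q k + z k *\<^sub>R a) a\<bar> \<le> M * norm n * C * t k" by metis
  have Ct: "(\<lambda>k. K * t k) \<longlonglongrightarrow> 0" for K using tendsto_mult_left[OF t(2), of K] by simp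
  have "(\<lambda>k. q k + z k *\<^sub>R a - p) \<longlonglongrightarrow> 0"
    by (rule Lim_null_comparison[OF _ Ct[of C]]) (use q0(2)[OF z(1)] in simp)
  then have lim: "(\<lambda>k. q k + z k *\<^sub>R a) \<longlonglongrightarrow> p" by (simp add: LIM_zero_iff)
  have "(\<lambda>k. Dw (q k + z k *\<^sub>R a)) \<longlonglongrightarrow> Dw p"
  proof (rule continuous_on_tendsto_compose[OF cDw lim])
    show "p \<in> closure \<Omega> \<inter> U" using p by (simp add: frontier_def)
    show "eventually (\<lambda>k. q k + z k *\<^sub>R a \<in> closure \<Omega> \<inter> U) sequentially"
      using q0(1)[OF z(1)] closure_subset[of \<Omega>] by (intro always_eventually) blast
  qed
  then have "(\<lambda>k. Dw (q k + z k *\<^sub>R a) a) \<longlonglongrightarrow> Dw p a" by (intro blinfun.tendsto tendsto_const)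
  moreover have "(\<lambda>k. Dw (q k + z k *\<^sub>R a) a) \<longlonglongrightarrow> 0"
    by (rule Lim_null_comparison[OF _ Ct[of "M * norm n * C"]]) (use z(2) in simp)
  ultimately show ?thesis by (rule LIMSEQ_unique)
qed

text \<open>Vanishing of \<open>Dw p\<close> improves the bound for w on the segments from order t^2
  to \<epsilon> t^2 with \<epsilon> arbitrary. The symmetric second difference is therefore o(t^2),
  while Taylor expansion expresses it by second derivatives at points tending to p.\<close>

lemma boundary_second_order:
  fixes w :: "'a::euclidean_space \<Rightarrow> real"
  assumes op: "open \<Omega>" and dd: "defining_derivs \<Omega> U \<phi> D D2" and p: "p \<in> U" "p \<in> frontier \<Omega>" "\<phi> p = 0" and a: "D p a = 0"
    and w: "\<And>x. x \<in> \<Omega> \<inter> U \<Longrightarrow> (w has_derivative blinfun_apply (Dw x)) (at x)"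
    and Dw: "\<And>x. x \<in> \<Omega> \<inter> U \<Longrightarrow> (Dw has_derivative blinfun_apply (D2w x)) (at x)"
    and cw: "continuous_on (closure \<Omega> \<inter> U) w" and w0: "\<And>x. x \<in> frontier \<Omega> \<inter> U \<Longrightarrow> w x = 0"
    and cDw: "continuous_on (closure \<Omega> \<inter> U) Dw" and cD2w: "continuous_on (closure \<Omega> \<inter> U) D2w"
    and Dw0: "Dw p = 0"
  shows "D2w p a a = 0"
proof -
  obtain n C q t where C: "C > 0" and t0: "\<forall>k. t k > 0" and t2: "t \<longlonglongrightarrow> 0"
    and q: "\<forall>k r. \<bar>r\<bar> \<le> t k \<longrightarrow> (\<exists>s. s \<le> C * (t k)\<^sup>2 \<and> exits_at \<Omega> U p (C * t k) n (q k + r *\<^sub>R a) s)"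
    by (rule boundary_curveE[OF op dd p(1,3) a])
  note t = t0[rule_format] t2
  have q0: "q k + r *\<^sub>R a \<in> \<Omega> \<inter> U" "norm (q k + r *\<^sub>R a - p) \<le> C * t k" if r: "\<bar>r\<bar> \<le> t k" for k r
  proof -
    obtain s where "exits_at \<Omega> U p (C * t k) n (q k + r *\<^sub>R a) s" using q r by meson
    then show "q k + r *\<^sub>R a \<in> \<Omega> \<inter> U" "norm (q k + r *\<^sub>R a - p) \<le> C * t k" by (rule exits_atD)+
  qed
  have Ct: "(\<lambda>k. K * t k) \<longlonglongrightarrow> 0" for K using tendsto_mult_left[OF t(2), of K] by simp
  have lim: "(\<lambda>k. q k + z k *\<^sub>R a) \<longlonglongrightarrow> p" if "\<And>k. \<bar>z k\<bar> \<le> t k" for z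
  proof -
    have "(\<lambda>k. q k + z k *\<^sub>R a - p) \<longlonglongrightarrow> 0"
      by (rule Lim_null_comparison[OF _ Ct[of C]]) (use q0(2)[OF that] in simp)
    then show ?thesis by (simp add: LIM_zero_iff)
  qed
  have pcl: "p \<in> closure \<Omega> \<inter> U" using p by (simp add: frontier_def)
  have limD2: "(\<lambda>k. D2w (q k + z k *\<^sub>R a) a a) \<longlonglongrightarrow> D2w p a a" if "\<And>k. \<bar>z k\<bar> \<le> t k" for z
  proof -
    have "(\<lambda>k. D2w (q k + z k *\<^sub>R a)) \<longlonglongrightarrow> D2w p"
    proof (rule continuous_on_tendsto_compose[OF cD2w lim[OF that] pcl])
      show "eventually (\<lambda>k. q k + z k *\<^sub>R a \<in> closure \<Omega> \<inter> U) sequentially"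
        using q0(1)[OF that] closure_subset[of \<Omega>] by (intro always_eventually) blast
    qed
    then show ?thesis by (intro blinfun.tendsto tendsto_const)
  qed
  have diff: "\<exists>z1 z2. \<bar>z1\<bar> \<le> t k \<and> \<bar>z2\<bar> \<le> t k \<and>
      w (q k + t k *\<^sub>R a) + w (q k + (- t k) *\<^sub>R a) - 2 * w (q k) =
      (t k)\<^sup>2 / 2 * (D2w (q k + z1 *\<^sub>R a) a a + D2w (q k + z2 *\<^sub>R a) a a)" for k
  proof -
    define d where "d m r = (if m = (0::nat) then w (q k + r *\<^sub>R a) else if m = 1 then Dw (q k + r *\<^sub>R a) a else D2w (q k + r *\<^sub>R a) a a)" for m r
    have d0: "((\<lambda>r. w (q k + r *\<^sub>R a)) has_real_derivative Dw (q k + r *\<^sub>R a) a) (at r)" if "\<bar>r\<bar> \<le> t k" for r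
      by (intro has_real_derivative_along_line w q0 that)
    have d1: "((\<lambda>r. Dw (q k + r *\<^sub>R a) a) has_real_derivative D2w (q k + r *\<^sub>R a) a a) (at r)" if "\<bar>r\<bar> \<le> t k" for r
    proof -
      have "((\<lambda>r. Dw (q k + r *\<^sub>R a)) has_derivative (\<lambda>s. D2w (q k + r *\<^sub>R a) (s *\<^sub>R a))) (at r)"
        by (rule has_derivative_compose[where g=Dw and f="\<lambda>r. q k + r *\<^sub>R a", OF _ Dw[OF q0(1)[OF that]]]) (auto intro!: derivative_eq_intros)
      then have "((\<lambda>r. Dw (q k + r *\<^sub>R a) a) has_derivative (\<lambda>s. D2w (q k + r *\<^sub>R a) (s *\<^sub>R a) a)) (at r)"
        by (rule bounded_linear.has_derivative[OF blinfun.bounded_linear_left])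
      moreover have "(\<lambda>s. D2w (q k + r *\<^sub>R a) (s *\<^sub>R a) a) = (*) (D2w (q k + r *\<^sub>R a) a a)"
        by (simp add: fun_eq_iff blinfun.scaleR_right blinfun.scaleR_left)
      ultimately show ?thesis by (simp only: has_field_derivative_def)
    qed
    have dfun: "d 0 = (\<lambda>r. w (q k + r *\<^sub>R a))" "d (Suc 0) = (\<lambda>r. Dw (q k + r *\<^sub>R a) a)"
      "d (Suc (Suc 0)) = (\<lambda>r. D2w (q k + r *\<^sub>R a) a a)"
      by (simp_all add: d_def fun_eq_iff)
    have D: "DERIV (d m) r :> d (Suc m) r" if m: "m < 2" and r: "\<bar>r\<bar> \<le> t k" for m r
    proof -
      from m have "m = 0 \<or> m = 1" by linarith
      then show ?thesis using d0[OF r] d1[OF r] by (auto simp: dfun)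
    qed
    have "\<exists>z. 0 < z \<and> z < t k \<and> w (q k + t k *\<^sub>R a) = (\<Sum>m<2. d m 0 / fact m * (t k) ^ m) + d 2 z / fact 2 * (t k) ^ 2"
      by (rule Maclaurin[where diff=d and f="\<lambda>r. w (q k + r *\<^sub>R a)"]) (use t(1)[of k] D dfun(1) in auto)
    then obtain z1 where z1: "0 < z1" "z1 < t k"
      "w (q k + t k *\<^sub>R a) = w (q k) + Dw (q k) a * t k + (t k)\<^sup>2 / 2 * D2w (q k + z1 *\<^sub>R a) a a"
      by (auto simp: numeral_2_eq_2 d_def power2_eq_square mult_ac)
    have "\<exists>z. - t k < z \<and> z < 0 \<and> w (q k + (- t k) *\<^sub>R a) = (\<Sum>m<2. d m 0 / fact m * (- t k) ^ m) + d 2 z / fact 2 * (- t k) ^ 2"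
      by (rule Maclaurin_minus[where diff=d and f="\<lambda>r. w (q k + r *\<^sub>R a)"]) (use t(1)[of k] D dfun(1) in auto)
    then obtain z2 where z2: "- t k < z2" "z2 < 0"
      "w (q k + (- t k) *\<^sub>R a) = w (q k) - Dw (q k) a * t k + (t k)\<^sup>2 / 2 * D2w (q k + z2 *\<^sub>R a) a a"
      by (auto simp: numeral_2_eq_2 d_def power2_eq_square mult_ac)
    show ?thesis using z1 z2 by (intro exI[of _ z1] exI[of _ z2]) (simp add: algebra_simps)
  qed
  have "\<forall>k. \<exists>z1 z2. \<bar>z1\<bar> \<le> t k \<and> \<bar>z2\<bar> \<le> t k \<and>
      w (q k + t k *\<^sub>R a) + w (q k + (- t k) *\<^sub>R a) - 2 * w (q k) =
      (t k)\<^sup>2 / 2 * (D2w (q k + z1 *\<^sub>R a) a a + D2w (q k + z2 *\<^sub>R a) a a)" using diff by blast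
  from choice[OF this] obtain z1 where "\<forall>k. \<exists>z2. \<bar>z1 k\<bar> \<le> t k \<and> \<bar>z2\<bar> \<le> t k \<and>
      w (q k + t k *\<^sub>R a) + w (q k + (- t k) *\<^sub>R a) - 2 * w (q k) =
      (t k)\<^sup>2 / 2 * (D2w (q k + z1 k *\<^sub>R a) a a + D2w (q k + z2 *\<^sub>R a) a a)" ..
  from choice[OF this] obtain z2 where z12: "\<forall>k. \<bar>z1 k\<bar> \<le> t k \<and> \<bar>z2 k\<bar> \<le> t k \<and>
      w (q k + t k *\<^sub>R a) + w (q k + (- t k) *\<^sub>R a) - 2 * w (q k) =
      (t k)\<^sup>2 / 2 * (D2w (q k + z1 k *\<^sub>R a) a a + D2w (q k + z2 k *\<^sub>R a) a a)" ..
  then have z: "\<And>k. \<bar>z1 k\<bar> \<le> t k" "\<And>k. \<bar>z2 k\<bar> \<le> t k" by blast+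
  have S: "(\<lambda>k. D2w (q k + z1 k *\<^sub>R a) a a + D2w (q k + z2 k *\<^sub>R a) a a) \<longlonglongrightarrow> D2w p a a + D2w p a a"
    by (intro tendsto_add limD2 z)
  \<comment> \<open>The coefficients of the second difference have total weight 4, and dividing by
    \<open>(t k)\<^sup>2 / 2\<close> turns this into 8.\<close>
  have small: "\<bar>D2w p a a + D2w p a a\<bar> \<le> 8 * (\<epsilon> * norm n * C)" if \<epsilon>: "\<epsilon> > 0" for \<epsilon>
  proof -
    obtain \<delta> where \<delta>: "\<delta> > 0" "\<And>x. x \<in> closure \<Omega> \<inter> U \<Longrightarrow> dist x p < \<delta> \<Longrightarrow> dist (Dw x) (Dw p) < \<epsilon>"
      using cDw[unfolded continuous_on_iff, rule_format, OF pcl \<epsilon>] by blast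
    have "eventually (\<lambda>k. C * t k < \<delta>) sequentially"
      using order_tendstoD(2)[OF Ct[of C] \<delta>(1)] .
    then have "eventually (\<lambda>k. \<bar>D2w (q k + z1 k *\<^sub>R a) a a + D2w (q k + z2 k *\<^sub>R a) a a\<bar> \<le> 8 * (\<epsilon> * norm n * C)) sequentially"
    proof (rule eventually_mono)
      fix k assume k: "C * t k < \<delta>"
      have sm: "\<bar>w (q k + r *\<^sub>R a)\<bar> \<le> \<epsilon> * norm n * C * (t k)\<^sup>2" if r: "\<bar>r\<bar> \<le> t k" for r
      proof -
        obtain s where s: "s \<le> C * (t k)\<^sup>2" "exits_at \<Omega> U p (C * t k) n (q k + r *\<^sub>R a) s" using q r by meson
        show ?thesis
        proof (rule boundary_estimate[OF s less_imp_le[OF \<epsilon>] w cw w0])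
          fix y assume y: "y \<in> \<Omega> \<inter> U" "norm (y - p) \<le> C * t k"
          then have "y \<in> closure \<Omega> \<inter> U" "dist y p < \<delta>" using k closure_subset[of \<Omega>] by (auto simp: dist_norm)
          then have "dist (Dw y) (Dw p) < \<epsilon>" by (rule \<delta>(2))
          then show "norm (Dw y) \<le> \<epsilon>" using Dw0 by simp
        qed
      qed
      let ?L = "w (q k + t k *\<^sub>R a) + w (q k + (- t k) *\<^sub>R a) - 2 * w (q k)"
      let ?B = "\<epsilon> * norm n * C * (t k)\<^sup>2"
      have "\<bar>w (q k + t k *\<^sub>R a)\<bar> \<le> ?B" "\<bar>w (q k + (- t k) *\<^sub>R a)\<bar> \<le> ?B" "\<bar>w (q k)\<bar> \<le> ?B"
        using sm[of "t k"] sm[of "- t k"] sm[of 0] t(1)[of k] by auto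
      then have "\<bar>?L\<bar> \<le> 4 * ?B" by linarith
      moreover have "?L = (t k)\<^sup>2 / 2 * (D2w (q k + z1 k *\<^sub>R a) a a + D2w (q k + z2 k *\<^sub>R a) a a)"
        using z12 by blast
      ultimately have "(t k)\<^sup>2 / 2 * \<bar>D2w (q k + z1 k *\<^sub>R a) a a + D2w (q k + z2 k *\<^sub>R a) a a\<bar> \<le> 4 * ?B"
        by (simp add: abs_mult)
      also have "4 * ?B = (t k)\<^sup>2 / 2 * (8 * (\<epsilon> * norm n * C))" by simp
      finally show "\<bar>D2w (q k + z1 k *\<^sub>R a) a a + D2w (q k + z2 k *\<^sub>R a) a a\<bar> \<le> 8 * (\<epsilon> * norm n * C)"
        by (rule mult_left_le_imp_le) (use t(1)[of k] in simp)
    qed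
    then show ?thesis by (rule tendsto_upperbound[OF tendsto_rabs[OF S]]) simp
  qed
  have "\<bar>D2w p a a + D2w p a a\<bar> \<le> 0"
  proof (rule field_le_epsilon)
    fix e :: real assume e: "e > 0"
    have "\<bar>D2w p a a + D2w p a a\<bar> \<le> 8 * (e / (8 * (norm n * C + 1)) * norm n * C)"
      by (rule small) (use e C in \<open>auto intro!: divide_pos_pos add_nonneg_pos\<close>)
    also have "\<dots> = e * (norm n * C / (norm n * C + 1))"
    proof -
      have "norm n * C + 1 > 0" using C by (simp add: add_nonneg_pos)
      then show ?thesis by (simp add: field_simps)
    qed
    also have "\<dots> \<le> e * 1" using e C
      by (intro mult_left_mono) (auto simp: divide_le_eq_1 add_nonneg_pos)
    finally show "\<bar>D2w p a a + D2w p a a\<bar> \<le> 0 + e" by simp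
  qed
  then show ?thesis by simp
qed

section \<open>Commutators\<close>

context carnot2
begin

lemma flow_taylor:
  assumes h: "0 < h" and f1: "\<And>t. 0 \<le> t \<Longrightarrow> t \<le> h \<Longrightarrow> has_X \<xi> f (f1 (g + t *\<^sub>R lf \<xi> g)) (g + t *\<^sub>R lf \<xi> g)"
    and f2: "\<And>t. 0 \<le> t \<Longrightarrow> t \<le> h \<Longrightarrow> has_X \<xi> f1 (f2 (g + t *\<^sub>R lf \<xi> g)) (g + t *\<^sub>R lf \<xi> g)"
  shows "\<exists>t>0. t < h \<and> f (g + h *\<^sub>R lf \<xi> g) = f g + h * f1 g + h\<^sup>2 / 2 * f2 (g + t *\<^sub>R lf \<xi> g)"
proof -
  define d where "d m t = (if m = (0::nat) then f (g + t *\<^sub>R lf \<xi> g) else if m = 1 then f1 (g + t *\<^sub>R lf \<xi> g)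
    else f2 (g + t *\<^sub>R lf \<xi> g))" for m t
  have dfun: "d 0 = (\<lambda>t. f (g + t *\<^sub>R lf \<xi> g))" "d (Suc 0) = (\<lambda>t. f1 (g + t *\<^sub>R lf \<xi> g))"
    "d (Suc (Suc 0)) = (\<lambda>t. f2 (g + t *\<^sub>R lf \<xi> g))"
    by (simp_all add: d_def fun_eq_iff)
  have D: "DERIV (d m) t :> d (Suc m) t" if m: "m < 2" and t: "0 \<le> t" "t \<le> h" for m t
  proof -
    from m have "m = 0 \<or> m = 1" by linarith
    then show ?thesis using has_X_flow[OF f1[OF t]] has_X_flow[OF f2[OF t]] by (auto simp: dfun)
  qed
  have "\<exists>t. 0 < t \<and> t < h \<and> f (g + h *\<^sub>R lf \<xi> g) = (\<Sum>m<2. d m 0 / fact m * h ^ m) + d 2 t / fact 2 * h ^ 2"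
    by (rule Maclaurin[where diff=d and f="\<lambda>t. f (g + t *\<^sub>R lf \<xi> g)"]) (use h D dfun(1) in auto)
  then show ?thesis by (auto simp: numeral_2_eq_2 d_def power2_eq_square mult_ac)
qed

text \<open>
  Both sides are the second order term of \<open>v (g exp(s\<xi>) exp(s\<eta>)) - v (g exp(s\<eta>) exp(s\<xi>))\<close>.
\<close>

lemma X_commutator:
  assumes \<Omega>: "open \<Omega>" "g \<in> \<Omega>"
    and v: "\<And>x. x \<in> \<Omega> \<Longrightarrow> has_X \<xi> v (a x) x" "\<And>x. x \<in> \<Omega> \<Longrightarrow> has_X \<eta> v (b x) x"
    and ab: "\<And>x. x \<in> \<Omega> \<Longrightarrow> has_X \<xi> a (aa x) x" "\<And>x. x \<in> \<Omega> \<Longrightarrow> has_X \<xi> b (ab x) x"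
      "\<And>x. x \<in> \<Omega> \<Longrightarrow> has_X \<eta> a (ba x) x" "\<And>x. x \<in> \<Omega> \<Longrightarrow> has_X \<eta> b (bb x) x"
    and w: "\<And>x. x \<in> \<Omega> \<Longrightarrow> has_X (br \<xi> \<eta>) v (w x) x"
    and cont: "continuous_on \<Omega> aa" "continuous_on \<Omega> ab" "continuous_on \<Omega> ba" "continuous_on \<Omega> bb" "continuous_on \<Omega> w"
  shows "ab g - ba g = w g"
proof -
  let ?A = "lf \<xi> g" and ?B = "lf \<eta> g" and ?Z = "br \<xi> \<eta>"
  \<comment> \<open>Products of flows along \<open>\<xi>\<close> and \<open>\<eta>\<close> stay in
    this three-parameter family based at g: following one field shifts the coefficient of the
    bracket in proportion to the other coordinate.\<close>
  define pt where "pt \<alpha> \<beta> \<gamma> = g + \<alpha> *\<^sub>R ?A + \<beta> *\<^sub>R ?B + \<gamma> *\<^sub>R ?Z" for \<alpha> \<beta> \<gamma>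
  have ZA: "br \<eta> \<xi> = - ?Z" by (rule br_antisym)
  have lf1: "lf \<xi> (pt \<alpha> \<beta> \<gamma>) = ?A - (\<beta> / 2) *\<^sub>R ?Z" for \<alpha> \<beta> \<gamma>
    by (simp add: pt_def lf_def ZA algebra_simps)
  have lf2: "lf \<eta> (pt \<alpha> \<beta> \<gamma>) = ?B + (\<alpha> / 2) *\<^sub>R ?Z" for \<alpha> \<beta> \<gamma>
    by (simp add: pt_def lf_def algebra_simps)
  have lf3: "lf ?Z x = ?Z" for x by (simp add: br_in_V2)
  \<comment> \<open>One \<epsilon> each for \<open>w\<close>, \<open>ab\<close> and
    \<open>ba\<close>; the two values of \<open>aa\<close> and the two of \<open>bb\<close> enter
    with weight 1/2 and opposite signs, which costs one more \<epsilon> for each pair.\<close>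
  have near: "\<bar>(ab g - ba g) - w g\<bar> \<le> 5 * \<epsilon>" if \<epsilon>: "\<epsilon> > 0" for \<epsilon>
  proof -
    have ev: "eventually (\<lambda>x. \<bar>F x - F g\<bar> < \<epsilon>) (nhds g)" if "continuous_on \<Omega> F" for F
    proof -
      have "isCont F g" using that \<Omega> by (simp add: continuous_on_eq_continuous_at)
      then have "eventually (\<lambda>x. dist (F x) (F g) < \<epsilon>) (at g)" using \<epsilon> by (simp add: isCont_def tendstoD)
      then show ?thesis using \<epsilon> by (auto simp: eventually_at_filter dist_real_def elim: eventually_mono)
    qed
    have "eventually (\<lambda>x. x \<in> \<Omega> \<and> \<bar>aa x - aa g\<bar> < \<epsilon> \<and> \<bar>ab x - ab g\<bar> < \<epsilon> \<and> \<bar>ba x - ba g\<bar> < \<epsilon> \<and>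
        \<bar>bb x - bb g\<bar> < \<epsilon> \<and> \<bar>w x - w g\<bar> < \<epsilon>) (nhds g)"
      by (intro eventually_conj ev cont eventually_nhds_in_open \<Omega>)
    then obtain \<delta> where \<delta>: "\<delta> > 0" "\<forall>x. dist x g < \<delta> \<longrightarrow> x \<in> \<Omega> \<and> \<bar>aa x - aa g\<bar> < \<epsilon> \<and> \<bar>ab x - ab g\<bar> < \<epsilon> \<and>
        \<bar>ba x - ba g\<bar> < \<epsilon> \<and> \<bar>bb x - bb g\<bar> < \<epsilon> \<and> \<bar>w x - w g\<bar> < \<epsilon>"
      unfolding eventually_nhds_metric by (elim exE conjE) (rule that)
    define K where "K = norm ?A + norm ?B + norm ?Z + 1"
    have K: "K > 0" by (simp add: K_def add_nonneg_pos)
    define s where "s = min 1 (\<delta> / (2 * K))"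
    have s: "0 < s" "s \<le> 1" using \<delta>(1) K by (auto simp: s_def)
    have sK: "s * K < \<delta>"
    proof -
      have "s * K \<le> \<delta> / (2 * K) * K" using K by (intro mult_right_mono) (auto simp: s_def)
      also have "\<dots> < \<delta>" using K \<delta>(1) by simp
      finally show ?thesis .
    qed
    have ss: "s\<^sup>2 \<le> s" using s by (simp add: power2_eq_square mult_left_le_one_le)
    have inb: "dist (pt \<alpha> \<beta> \<gamma>) g < \<delta>" if "\<bar>\<alpha>\<bar> \<le> s" "\<bar>\<beta>\<bar> \<le> s" "\<bar>\<gamma>\<bar> \<le> s" for \<alpha> \<beta> \<gamma>
    proof -
      have "dist (pt \<alpha> \<beta> \<gamma>) g = norm (\<alpha> *\<^sub>R ?A + \<beta> *\<^sub>R ?B + \<gamma> *\<^sub>R ?Z)" by (simp add: dist_norm pt_def algebra_simps)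
      also have "\<dots> \<le> norm (\<alpha> *\<^sub>R ?A) + norm (\<beta> *\<^sub>R ?B) + norm (\<gamma> *\<^sub>R ?Z)"
        by (rule order_trans[OF norm_triangle_ineq add_right_mono[OF norm_triangle_ineq]])
      also have "\<dots> \<le> s * norm ?A + s * norm ?B + s * norm ?Z"
        unfolding norm_scaleR using that by (intro add_mono mult_right_mono) auto
      also have "\<dots> \<le> s * K" using s by (simp add: K_def algebra_simps)
      finally show ?thesis using sK by simp
    qed
    note N = \<delta>(2)[rule_format, OF inb]
    have ts: "\<bar>t * s / 2\<bar> \<le> s" if "0 \<le> t" "t \<le> s" for t
    proof -
      have "t * s \<le> s * s" using that s by (intro mult_right_mono) auto
      then show ?thesis using that s ss by (simp add: power2_eq_square)
    qed
    have T1: "\<exists>t>0. t < s \<and> v (pt s 0 0) = v g + s * a g + s\<^sup>2 / 2 * aa (pt t 0 0)"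
    proof -
      have eq: "pt t 0 0 = g + t *\<^sub>R lf \<xi> g" for t by (simp add: pt_def)
      show ?thesis unfolding eq
        by (rule flow_taylor[OF s(1)]) (use N[of _ 0 0] v(1) ab(1) s in \<open>auto simp: eq\<close>)
    qed
    have T1b: "\<exists>t>0. t < s \<and> b (pt s 0 0) - b g = s * ab (pt t 0 0)"
    proof -
      have eq: "pt t 0 0 = g + t *\<^sub>R lf \<xi> g" for t by (simp add: pt_def)
      obtain t where "0 < t" "t < s" "b (g + s *\<^sub>R lf \<xi> g) - b g = s * ab (g + t *\<^sub>R lf \<xi> g)"
        by (rule flow_mvt[OF s(1), of \<xi> b ab g]) (use N[of _ 0 0] ab(2) s in \<open>auto simp: eq\<close>)
      then show ?thesis by (auto simp: eq)
    qed
    have T2: "\<exists>t>0. t < s \<and> v (pt s s (s\<^sup>2 / 2)) = v (pt s 0 0) + s * b (pt s 0 0) + s\<^sup>2 / 2 * bb (pt s t (t * s / 2))"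
    proof -
      have eq: "pt s t (t * s / 2) = pt s 0 0 + t *\<^sub>R lf \<eta> (pt s 0 0)" for t
        unfolding lf2 by (simp add: pt_def algebra_simps)
      have eq2: "pt s s (s\<^sup>2 / 2) = pt s 0 0 + s *\<^sub>R lf \<eta> (pt s 0 0)" using eq[of s] by (simp add: power2_eq_square)
      show ?thesis unfolding eq eq2
      proof (rule flow_taylor[OF s(1)])
        fix t assume t: "0 \<le> t" "t \<le> s"
        then have "pt s t (t * s / 2) \<in> \<Omega>" using N[of s t "t * s / 2"] ts[OF t] s by auto
        then show "has_X \<eta> v (b (pt s 0 0 + t *\<^sub>R lf \<eta> (pt s 0 0))) (pt s 0 0 + t *\<^sub>R lf \<eta> (pt s 0 0))"
          "has_X \<eta> b (bb (pt s 0 0 + t *\<^sub>R lf \<eta> (pt s 0 0))) (pt s 0 0 + t *\<^sub>R lf \<eta> (pt s 0 0))"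
          unfolding eq by (rule v ab)+
      qed
    qed
    have U1: "\<exists>t>0. t < s \<and> v (pt 0 s 0) = v g + s * b g + s\<^sup>2 / 2 * bb (pt 0 t 0)"
    proof -
      have eq: "pt 0 t 0 = g + t *\<^sub>R lf \<eta> g" for t by (simp add: pt_def)
      show ?thesis unfolding eq
        by (rule flow_taylor[OF s(1)]) (use N[of 0 _ 0] v(2) ab(4) s in \<open>auto simp: eq\<close>)
    qed
    have U1b: "\<exists>t>0. t < s \<and> a (pt 0 s 0) - a g = s * ba (pt 0 t 0)"
    proof -
      have eq: "pt 0 t 0 = g + t *\<^sub>R lf \<eta> g" for t by (simp add: pt_def)
      obtain t where "0 < t" "t < s" "a (g + s *\<^sub>R lf \<eta> g) - a g = s * ba (g + t *\<^sub>R lf \<eta> g)"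
        by (rule flow_mvt[OF s(1), of \<eta> a ba g]) (use N[of 0 _ 0] ab(3) s in \<open>auto simp: eq\<close>)
      then show ?thesis by (auto simp: eq)
    qed
    have U2: "\<exists>t>0. t < s \<and> v (pt s s (- (s\<^sup>2 / 2))) = v (pt 0 s 0) + s * a (pt 0 s 0) + s\<^sup>2 / 2 * aa (pt t s (- (t * s / 2)))"
    proof -
      have eq: "pt t s (- (t * s / 2)) = pt 0 s 0 + t *\<^sub>R lf \<xi> (pt 0 s 0)" for t
        unfolding lf1 by (simp add: pt_def algebra_simps)
      have eq2: "pt s s (- (s\<^sup>2 / 2)) = pt 0 s 0 + s *\<^sub>R lf \<xi> (pt 0 s 0)" using eq[of s] by (simp add: power2_eq_square)
      show ?thesis unfolding eq eq2
      proof (rule flow_taylor[OF s(1)])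
        fix t assume t: "0 \<le> t" "t \<le> s"
        then have "pt t s (- (t * s / 2)) \<in> \<Omega>" using N[of t s "- (t * s / 2)"] ts[OF t] s by auto
        then show "has_X \<xi> v (a (pt 0 s 0 + t *\<^sub>R lf \<xi> (pt 0 s 0))) (pt 0 s 0 + t *\<^sub>R lf \<xi> (pt 0 s 0))"
          "has_X \<xi> a (aa (pt 0 s 0 + t *\<^sub>R lf \<xi> (pt 0 s 0))) (pt 0 s 0 + t *\<^sub>R lf \<xi> (pt 0 s 0))"
          unfolding eq by (rule v ab)+
      qed
    qed
    \<comment> \<open>The two routes end at points that differ by \<open>s\<^sup>2\<close> in the
      direction of the bracket; the derivative along the bracket closes the quadrilateral.\<close>
    have W: "\<exists>t>0. t < s\<^sup>2 \<and> v (pt s s (s\<^sup>2 / 2)) - v (pt s s (- (s\<^sup>2 / 2))) = s\<^sup>2 * w (pt s s (- (s\<^sup>2 / 2) + t))"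
    proof -
      have eq: "pt s s (- (s\<^sup>2 / 2) + t) = pt s s (- (s\<^sup>2 / 2)) + t *\<^sub>R lf ?Z (pt s s (- (s\<^sup>2 / 2)))" for t
        unfolding lf3 by (simp add: pt_def algebra_simps)
      have eq2: "pt s s (s\<^sup>2 / 2) = pt s s (- (s\<^sup>2 / 2)) + s\<^sup>2 *\<^sub>R lf ?Z (pt s s (- (s\<^sup>2 / 2)))"
        using eq[of "s\<^sup>2"] by simp
      have s2: "0 < s\<^sup>2" using s by simp
      obtain t where "0 < t" "t < s\<^sup>2" "v (pt s s (- (s\<^sup>2 / 2)) + s\<^sup>2 *\<^sub>R lf ?Z (pt s s (- (s\<^sup>2 / 2)))) - v (pt s s (- (s\<^sup>2 / 2)))
          = s\<^sup>2 * w (pt s s (- (s\<^sup>2 / 2)) + t *\<^sub>R lf ?Z (pt s s (- (s\<^sup>2 / 2))))"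
      proof (rule flow_mvt[OF s2, of ?Z v w "pt s s (- (s\<^sup>2 / 2))"])
        fix t assume "0 \<le> t" "t \<le> s\<^sup>2"
        then have "pt s s (- (s\<^sup>2 / 2) + t) \<in> \<Omega>" using N[of s s "- (s\<^sup>2 / 2) + t"] s ss by auto
        then show "has_X ?Z v (w (pt s s (- (s\<^sup>2 / 2)) + t *\<^sub>R lf ?Z (pt s s (- (s\<^sup>2 / 2))))) (pt s s (- (s\<^sup>2 / 2)) + t *\<^sub>R lf ?Z (pt s s (- (s\<^sup>2 / 2))))"
          unfolding eq by (rule w)
      qed
      then show ?thesis unfolding eq eq2 by blast
    qed
    obtain t1 where t1: "0 < t1" "t1 < s" "v (pt s 0 0) = v g + s * a g + s\<^sup>2 / 2 * aa (pt t1 0 0)" using T1 by blast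
    obtain t2 where t2: "0 < t2" "t2 < s" "b (pt s 0 0) - b g = s * ab (pt t2 0 0)" using T1b by blast
    obtain t3 where t3: "0 < t3" "t3 < s" "v (pt s s (s\<^sup>2 / 2)) = v (pt s 0 0) + s * b (pt s 0 0) + s\<^sup>2 / 2 * bb (pt s t3 (t3 * s / 2))" using T2 by blast
    obtain t4 where t4: "0 < t4" "t4 < s" "v (pt 0 s 0) = v g + s * b g + s\<^sup>2 / 2 * bb (pt 0 t4 0)" using U1 by blast
    obtain t5 where t5: "0 < t5" "t5 < s" "a (pt 0 s 0) - a g = s * ba (pt 0 t5 0)" using U1b by blast
    obtain t6 where t6: "0 < t6" "t6 < s" "v (pt s s (- (s\<^sup>2 / 2))) = v (pt 0 s 0) + s * a (pt 0 s 0) + s\<^sup>2 / 2 * aa (pt t6 s (- (t6 * s / 2)))" using U2 by blast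
    obtain t7 where t7: "0 < t7" "t7 < s\<^sup>2" "v (pt s s (s\<^sup>2 / 2)) - v (pt s s (- (s\<^sup>2 / 2))) = s\<^sup>2 * w (pt s s (- (s\<^sup>2 / 2) + t7))" using W by blast
    have b': "b (pt s 0 0) = b g + s * ab (pt t2 0 0)" and a': "a (pt 0 s 0) = a g + s * ba (pt 0 t5 0)" using t2(3) t5(3) by auto
    have "s\<^sup>2 * w (pt s s (- (s\<^sup>2 / 2) + t7)) =
      s\<^sup>2 * (aa (pt t1 0 0) / 2 + ab (pt t2 0 0) + bb (pt s t3 (t3 * s / 2)) / 2
         - bb (pt 0 t4 0) / 2 - ba (pt 0 t5 0) - aa (pt t6 s (- (t6 * s / 2))) / 2)"
      unfolding t7(3)[symmetric] t3(3) t6(3) t1(3) t4(3) b' a' by (simp add: algebra_simps power2_eq_square)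
    then have eq: "w (pt s s (- (s\<^sup>2 / 2) + t7)) = aa (pt t1 0 0) / 2 + ab (pt t2 0 0) + bb (pt s t3 (t3 * s / 2)) / 2
         - bb (pt 0 t4 0) / 2 - ba (pt 0 t5 0) - aa (pt t6 s (- (t6 * s / 2))) / 2"
      using s(1) by simp
    have "\<bar>w (pt s s (- (s\<^sup>2 / 2) + t7)) - w g\<bar> < \<epsilon>"
      using N[of s s "- (s\<^sup>2 / 2) + t7"] s ss t7 by auto
    moreover have "\<bar>aa (pt t1 0 0) - aa g\<bar> < \<epsilon>" "\<bar>ab (pt t2 0 0) - ab g\<bar> < \<epsilon>"
      using N[of t1 0 0] N[of t2 0 0] t1 t2 s by auto
    moreover have "\<bar>bb (pt 0 t4 0) - bb g\<bar> < \<epsilon>" "\<bar>ba (pt 0 t5 0) - ba g\<bar> < \<epsilon>"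
      using N[of 0 t4 0] N[of 0 t5 0] t4 t5 s by auto
    moreover have "\<bar>bb (pt s t3 (t3 * s / 2)) - bb g\<bar> < \<epsilon>"
      using N[of s t3 "t3 * s / 2"] ts[of t3] t3 s by auto
    moreover have "\<bar>aa (pt t6 s (- (t6 * s / 2))) - aa g\<bar> < \<epsilon>"
      using N[of t6 s "- (t6 * s / 2)"] ts[of t6] t6 s by auto
    ultimately show ?thesis using eq by argo
  qed
  have "\<bar>(ab g - ba g) - w g\<bar> \<le> 0"
  proof (rule field_le_epsilon)
    fix e :: real assume "e > 0"
    then show "\<bar>(ab g - ba g) - w g\<bar> \<le> 0 + e" using near[of "e / 5"] by simp
  qed
  then show ?thesis by simp
qed

text \<open>The bracket term comes from differentiating the vector \<open>lf \<xi>\<close>, which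
  varies affinely with the point.\<close>

lemma has_X_second:
  fixes D2 :: "'a \<Rightarrow>\<^sub>L 'a \<Rightarrow>\<^sub>L real"
  assumes D: "(D has_derivative blinfun_apply D2) (at g)"
  shows "has_X \<eta> (\<lambda>x. D x (lf \<xi> x)) (D2 (lf \<eta> g) (lf \<xi> g) + (1/2) * D g (br \<eta> \<xi>)) g"
proof -
  have 1: "(lf \<xi> has_derivative (\<lambda>h. (1/2) *\<^sub>R br h \<xi>)) (at g)"
    unfolding lf_def[abs_def]
    by (auto intro!: derivative_eq_intros bounded_linear.has_derivative[OF bounded_linear_br_left])
  have "((\<lambda>x. D x (lf \<xi> x)) has_derivative (\<lambda>h. D g ((1/2) *\<^sub>R br h \<xi>) + D2 h (lf \<xi> g))) (at g)"
    by (rule bounded_bilinear.FDERIV[OF bounded_bilinear_blinfun_apply D 1])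
  from has_X_has_derivative[OF this, of \<eta>] show ?thesis
    by (simp add: blinfun.scaleR_right lf_def add.commute)
qed

text \<open>An application of \<open>X_commutator\<close> to f itself: the two half brackets already
  account for the derivative along the commutator, so the Hessian parts must agree on left-invariant
  vectors, and these exhaust all vectors at g.\<close>

lemma second_derivative_symmetric:
  fixes D2 :: "'a \<Rightarrow> 'a \<Rightarrow>\<^sub>L 'a \<Rightarrow>\<^sub>L real"
  assumes \<Omega>: "open \<Omega>" "g \<in> \<Omega>" and f: "\<And>x. x \<in> \<Omega> \<Longrightarrow> (f has_derivative blinfun_apply (D x)) (at x)"
    and D: "\<And>x. x \<in> \<Omega> \<Longrightarrow> (D has_derivative blinfun_apply (D2 x)) (at x)" and cD2: "continuous_on \<Omega> D2"
  shows "D2 g v w = D2 g w v"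
proof -
  have cD: "continuous_on \<Omega> D" by (rule continuous_on_has_derivative, rule D)
  have sym: "D2 g (lf \<xi> g) (lf \<eta> g) = D2 g (lf \<eta> g) (lf \<xi> g)" for \<xi> \<eta>
  proof -
    let ?H = "\<lambda>\<xi> \<eta> x. D2 x (lf \<xi> x) (lf \<eta> x) + (1/2) * D x (br \<xi> \<eta>)"
    have c: "continuous_on \<Omega> (?H \<xi> \<eta>)" for \<xi> \<eta>
      by (intro continuous_intros blinfun.continuous_on cD cD2)
    have "?H \<xi> \<eta> g - ?H \<eta> \<xi> g = D g (lf (br \<xi> \<eta>) g)"
    proof (rule X_commutator[OF \<Omega>, where v=f and a="\<lambda>x. D x (lf \<xi> x)" and b="\<lambda>x. D x (lf \<eta> x)"
          and aa="?H \<xi> \<xi>" and bb="?H \<eta> \<eta>" and w="\<lambda>x. D x (lf (br \<xi> \<eta>) x)"])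
      show "continuous_on \<Omega> (\<lambda>x. D x (lf (br \<xi> \<eta>) x))" by (intro continuous_intros blinfun.continuous_on cD)
    qed (rule c has_X_second[OF D] has_X_has_derivative[OF f]; assumption)+
    then show ?thesis using br_antisym[of \<eta> \<xi>] by (simp add: br_in_V2 blinfun.minus_right)
  qed
  show ?thesis using sym[of "v - (1/2) *\<^sub>R br g v" "w - (1/2) *\<^sub>R br g w"] by (simp only: lf_inverse)
qed

end

section \<open>The boundary in the left-invariant metric\<close>

text \<open>A direction that lowers \<open>\<phi>\<close> at first order leads into \<Omega>, where
  \<open>\<psi>\<close> is negative as well; since \<open>\<psi>\<close> vanishes at p, it cannot
  increase at first order.\<close>

lemma decreasing_direction:
  fixes D D' :: "'a::euclidean_space \<Rightarrow> 'a \<Rightarrow>\<^sub>L real"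
  assumes dd: "defining_derivs \<Omega> U \<phi> D D2" "defining_derivs \<Omega> U' \<psi> D' D2'"
    and p: "p \<in> U" "p \<in> U'" "\<phi> p = 0" "\<psi> p = 0" and a: "D p a < 0"
  shows "D' p a \<le> 0"
proof (rule ccontr)
  assume "\<not> D' p a \<le> 0"
  then have a': "D' p a > 0" by simp
  have d: "((\<lambda>t. \<phi> (p + t *\<^sub>R a)) has_real_derivative D p a) (at 0)"
    by (rule has_real_derivative_along_line) (use defining_derivsD(5)[OF dd(1) p(1)] in simp)
  have d': "((\<lambda>t. \<psi> (p + t *\<^sub>R a)) has_real_derivative D' p a) (at 0)"
    by (rule has_real_derivative_along_line) (use defining_derivsD(5)[OF dd(2) p(2)] in simp)
  obtain e1 where e1: "e1 > 0" "\<forall>h>0. h < e1 \<longrightarrow> \<phi> (p + (0 + h) *\<^sub>R a) < \<phi> (p + 0 *\<^sub>R a)"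
    using DERIV_neg_dec_right[OF d a] by blast
  obtain e2 where e2: "e2 > 0" "\<forall>h>0. h < e2 \<longrightarrow> \<psi> (p + 0 *\<^sub>R a) < \<psi> (p + (0 + h) *\<^sub>R a)"
    using DERIV_pos_inc_right[OF d' a'] by blast
  have "((\<lambda>t. p + t *\<^sub>R a) \<longlongrightarrow> p + 0 *\<^sub>R a) (at_right 0)" by (intro tendsto_intros)
  moreover have "open (U \<inter> U')" using defining_derivsD(1)[OF dd(1)] defining_derivsD(1)[OF dd(2)] by (rule open_Int)
  ultimately have "eventually (\<lambda>t. p + t *\<^sub>R a \<in> U \<inter> U') (at_right 0)"
    using p(1,2) topological_tendstoD[of "\<lambda>t. p + t *\<^sub>R a" p "at_right 0" "U \<inter> U'"] by simp
  moreover have "eventually (\<lambda>t. t \<in> {0<..<min e1 e2}) (at_right (0::real))"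
    by (rule eventually_at_right_real) (use e1(1) e2(1) in simp)
  ultimately have "eventually (\<lambda>t. p + t *\<^sub>R a \<in> U \<inter> U' \<and> t \<in> {0<..<min e1 e2}) (at_right (0::real))"
    by (rule eventually_conj)
  then have "\<exists>t. p + t *\<^sub>R a \<in> U \<inter> U' \<and> t \<in> {0<..<min e1 e2}"
    by (rule eventually_happens'[OF trivial_limit_at_right_real])
  then obtain t where t: "p + t *\<^sub>R a \<in> U" "p + t *\<^sub>R a \<in> U'" "t < e1" "t < e2" "t > 0" by auto
  have "\<phi> (p + t *\<^sub>R a) < 0" using e1(2)[rule_format, OF t(5,3)] p(3) by simp
  then have "\<psi> (p + t *\<^sub>R a) < 0"
    using defining_derivsD(8)[OF dd(1) t(1)] defining_derivsD(8)[OF dd(2) t(2)] by simp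
  moreover have "\<psi> (p + t *\<^sub>R a) > 0" using e2(2)[rule_format, OF t(5,4)] p(4) by simp
  ultimately show False by simp
qed

lemma blinfun_normalized_direction:
  assumes "D \<noteq> (0 :: 'a::real_normed_vector \<Rightarrow>\<^sub>L real)" obtains n where "D n = -1"
proof -
  have "\<exists>v. D v \<noteq> 0"
  proof (rule ccontr)
    assume "\<not> ?thesis"
    then have "D = 0" by (intro blinfun_eqI) simp
    with assms show False by simp
  qed
  then obtain v where "D v \<noteq> 0" by blast
  then have "D ((- 1 / D v) *\<^sub>R v) = -1" by (simp add: blinfun.scaleR_right blinfun.minus_right)
  then show ?thesis by (rule that)
qed

lemma blinfun_proportional:
  fixes D E :: "'a::real_normed_vector \<Rightarrow>\<^sub>L real"
  assumes n: "D n = -1" and ker: "\<And>a. D a = 0 \<Longrightarrow> E a = 0"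
  shows "E = (- E n) *\<^sub>R D"
proof (rule blinfun_eqI)
  fix v
  have "D (v + D v *\<^sub>R n) = 0" using n by (simp add: blinfun.add_right blinfun.scaleR_right)
  then have "E (v + D v *\<^sub>R n) = 0" by (rule ker)
  then show "E v = ((- E n) *\<^sub>R D) v"
    by (simp add: blinfun.add_right blinfun.scaleR_right blinfun.scaleR_left blinfun.minus_left algebra_simps)
qed

text \<open>Perturbing a tangent vector of \<open>\<phi>\<close> by small multiples of an entering
  direction shows that \<open>D' p\<close> is nonpositive on the kernel of \<open>D p\<close>, hence
  zero there by passing to the negative vector. The entering direction then fixes the sign of the
  factor.\<close>

lemma defining_derivs_proportional:
  fixes D D' :: "'a::euclidean_space \<Rightarrow> 'a \<Rightarrow>\<^sub>L real"
  assumes dd: "defining_derivs \<Omega> U \<phi> D D2" "defining_derivs \<Omega> U' \<psi> D' D2'"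
    and p: "p \<in> U" "p \<in> U'" "\<phi> p = 0" "\<psi> p = 0"
  obtains k where "k > 0" "D' p = k *\<^sub>R D p"
proof -
  obtain n where n: "D p n = -1" by (rule blinfun_normalized_direction[OF defining_derivsD(7)[OF dd(1) p(1)]])
  note dec = decreasing_direction[OF dd p]
  have le: "D' p a \<le> 0" if "D p a = 0" for a
  proof (rule field_le_epsilon)
    fix e :: real assume e: "e > 0"
    define s where "s = e / (\<bar>D' p n\<bar> + 1)"
    have s: "s > 0" using e by (simp add: s_def)
    have "D p (a + s *\<^sub>R n) < 0" using that n s by (simp add: blinfun.add_right blinfun.scaleR_right)
    then have "D' p a + s * D' p n \<le> 0" using dec[of "a + s *\<^sub>R n"] by (simp add: blinfun.add_right blinfun.scaleR_right)
    moreover have "- (s * D' p n) \<le> s * (\<bar>D' p n\<bar> + 1)" 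
    proof -
      have "s * - D' p n \<le> s * (\<bar>D' p n\<bar> + 1)" using s by (intro mult_left_mono) auto
      then show ?thesis by simp
    qed
    moreover have "s * (\<bar>D' p n\<bar> + 1) = e" by (simp add: s_def)
    ultimately show "D' p a \<le> 0 + e" by linarith
  qed
  have ker: "D' p a = 0" if "D p a = 0" for a
    using le[of a] le[of "- a"] that by (simp add: blinfun.minus_right)
  have eq: "D' p = (- D' p n) *\<^sub>R D p" by (rule blinfun_proportional[OF n ker])
  have "D' p n \<le> 0" using dec[of n] n by simp
  moreover have "D' p n \<noteq> 0" using eq defining_derivsD(7)[OF dd(2) p(2)] by auto
  ultimately have "- D' p n > 0" by simp
  then show ?thesis using eq by (rule that)
qed

context carnot2
begin

lemma inv_lfield: "inv (\<lambda>\<xi>. lfield G \<xi> g) v = v - (1/2) *\<^sub>R br g v"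
  unfolding lfield_eq
proof (rule inv_f_eq)
  show "inj (\<lambda>\<xi>. lf \<xi> g)"
  proof (rule injI)
    fix x y assume "lf x g = lf y g"
    then have "lf x g - (1/2) *\<^sub>R br g (lf x g) = lf y g - (1/2) *\<^sub>R br g (lf y g)" by simp
    then show "x = y" unfolding lf_inverse .
  qed
qed (rule lf_inverse)

lemma riem_eq: "riem G g v w = (v - (1/2) *\<^sub>R br g v) \<bullet> (w - (1/2) *\<^sub>R br g w)"
  unfolding riem_def inv_lfield ..

lemma riem_lf [simp]: "riem G g (lf \<xi> g) (lf \<eta> g) = \<xi> \<bullet> \<eta>"
  unfolding riem_eq lf_inverse(2) ..

lemma rnorm_lf [simp]: "rnorm G g (lf \<xi> g) = norm \<xi>"
  by (simp add: rnorm_def norm_eq_sqrt_inner)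

text \<open>The Riesz vector in the Lie algebra of the covector read in left-invariant coordinates;
  its length is that of the Riemannian gradient.\<close>

definition cov :: "('a \<Rightarrow>\<^sub>L real) \<Rightarrow> 'a \<Rightarrow> 'a" where
  "cov D g = (\<Sum>b\<in>Basis. D (lf b g) *\<^sub>R b)"

lemma cov_inner: "cov D g \<bullet> \<xi> = D (lf \<xi> g)"
proof -
  have "D (lf \<xi> g) = D (lf (\<Sum>b\<in>Basis. (\<xi> \<bullet> b) *\<^sub>R b) g)" by (simp add: euclidean_representation)
  also have "\<dots> = (\<Sum>b\<in>Basis. (\<xi> \<bullet> b) * D (lf b g))"
    by (simp add: lf_sum blinfun.sum_right blinfun.scaleR_right)
  finally show ?thesis by (simp add: cov_def inner_sum_left inner_commute[of \<xi>] mult.commute)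
qed

lemma cov_scale: "cov (k *\<^sub>R D) g = k *\<^sub>R cov D g"
  by (simp add: cov_def blinfun.scaleR_left scaleR_sum_right)

lemma cov_nonzero: assumes "D \<noteq> 0" shows "cov D g \<noteq> 0"
proof
  assume "cov D g = 0"
  then have "D (lf \<xi> g) = 0" for \<xi> using cov_inner[of D g \<xi>] by simp
  then have "D v = 0" for v using lf_inverse(1)[of v g] by metis
  then have "D = 0" by (intro blinfun_eqI) simp
  with assms show False by simp
qed

lemma rgrad_eq:
  assumes "frechet_derivative \<phi> (at g) = blinfun_apply D" shows "rgrad G \<phi> g = lf (cov D g) g"
  unfolding rgrad_def assms
proof (rule the_equality)
  show "\<forall>w. riem G g (lf (cov D g) g) w = D w"
  proof
    fix w
    obtain \<omega> where w: "w = lf \<omega> g" using lf_inverse(1)[of w g] by metis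
    show "riem G g (lf (cov D g) g) w = D w" unfolding w riem_lf cov_inner ..
  qed
next
  fix v assume v: "\<forall>w. riem G g v w = D w"
  define c where "c = v - (1/2) *\<^sub>R br g v"
  have vc: "v = lf c g" unfolding c_def by (simp only: lf_inverse)
  have "c \<bullet> \<xi> = cov D g \<bullet> \<xi>" for \<xi>
    using v[rule_format, of "lf \<xi> g"] unfolding vc by (simp add: cov_inner)
  then have "c = cov D g" using vector_eq_rdot by blast
  then show "v = lf (cov D g) g" using vc by simp
qed

text \<open>Positive proportionality of the differentials makes the normalised gradient independent
  of the defining function, which is the uniqueness that the definite description requires.\<close>

lemma outer_normal_eq:
  assumes op: "open \<Omega>" and p: "p \<in> frontier \<Omega>" and loc: "local_defining \<Omega> p U \<phi>" and dd: "defining_derivs \<Omega> U \<phi> D D2"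
  shows "outer_normal G \<Omega> p = lf (cov (D p) p /\<^sub>R norm (cov (D p) p)) p"
proof -
  have eq: "rgrad G \<psi> p /\<^sub>R rnorm G p (rgrad G \<psi> p) = lf (cov (D' p) p /\<^sub>R norm (cov (D' p) p)) p"
    if "p \<in> V" "defining_derivs \<Omega> V \<psi> D' D2'" for V \<psi> D' D2'
    using rgrad_eq[OF defining_derivsD(9)[OF that(2,1)]] by (simp add: lf_lin)
  have pU: "p \<in> U" using loc by (simp add: local_defining_def)
  show ?thesis
    unfolding outer_normal_def
  proof (rule the_equality)
    show "\<exists>U \<phi>. local_defining \<Omega> p U \<phi> \<and> lf (cov (D p) p /\<^sub>R norm (cov (D p) p)) p = rgrad G \<phi> p /\<^sub>R rnorm G p (rgrad G \<phi> p)"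
      using loc eq[OF pU dd] by metis
  next
    fix n assume "\<exists>U \<phi>. local_defining \<Omega> p U \<phi> \<and> n = rgrad G \<phi> p /\<^sub>R rnorm G p (rgrad G \<phi> p)"
    then obtain V \<psi> where V: "local_defining \<Omega> p V \<psi>" and n: "n = rgrad G \<psi> p /\<^sub>R rnorm G p (rgrad G \<psi> p)" by blast
    obtain D' D2' where D': "p \<in> V" "defining_derivs \<Omega> V \<psi> D' D2'" by (rule local_defining_derivs[OF V])
    obtain k where k: "k > 0" "D' p = k *\<^sub>R D p"
      by (rule defining_derivs_proportional[OF dd D'(2) pU D'(1) local_defining_frontier_eq_0[OF op loc p] local_defining_frontier_eq_0[OF op V p]])
    show "n = lf (cov (D p) p /\<^sub>R norm (cov (D p) p)) p"
    proof -
      have *: "inverse k * inverse x * k = inverse x" for x :: real using k(1) by (simp add: field_simps)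
      show ?thesis unfolding n eq[OF D'] k(2) cov_scale using k(1) by (simp add: *)
    qed
  qed
qed

text \<open>Component i of the horizontal conormal, unnormalised: another defining function changes
  it on the boundary by a positive factor.\<close>

definition hnu :: "('a \<Rightarrow>\<^sub>L real) \<Rightarrow> 'a \<Rightarrow> nat \<Rightarrow> real" where
  "hnu D p i = D (lf (e i) p)"

lemma Zfield_eq: "Zfield G g = hproj g + 2 *\<^sub>R (g - hproj g)"
proof -
  have "dilation G l g = l *\<^sub>R hproj g + l\<^sup>2 *\<^sub>R (g - hproj g)" for l
    unfolding dilation_def
  proof (rule the_equality)
    show "\<exists>v\<in>V1 G. \<exists>w\<in>V2 G. g = v + w \<and> l *\<^sub>R hproj g + l\<^sup>2 *\<^sub>R (g - hproj g) = l *\<^sub>R v + l\<^sup>2 *\<^sub>R w"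
      by (rule bexI[OF _ hproj_V1[of g]], rule bexI[OF _ vproj_V2[of g]]) simp
  next
    fix h assume "\<exists>v\<in>V1 G. \<exists>w\<in>V2 G. g = v + w \<and> h = l *\<^sub>R v + l\<^sup>2 *\<^sub>R w"
    then obtain v w where vw: "v \<in> V1 G" "w \<in> V2 G" "g = v + w" "h = l *\<^sub>R v + l\<^sup>2 *\<^sub>R w" by blast
    have "hproj g = v" using vw(3) hproj_decomp[OF vw(1,2)] by simp
    then show "h = l *\<^sub>R hproj g + l\<^sup>2 *\<^sub>R (g - hproj g)" using vw by simp
  qed
  then show ?thesis
    unfolding Zfield_def by (intro vector_derivative_at) (auto intro!: derivative_eq_intros simp: scaleR_2)
qed

text \<open>Both quantities carry the same normalising factor, which therefore cancels in the
  hypothesis that compares them.\<close>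

lemma normal_inner_products:
  assumes op: "open \<Omega>" and p: "p \<in> frontier \<Omega>" and loc: "local_defining \<Omega> p U \<phi>" and dd: "defining_derivs \<Omega> U \<phi> D D2"
  shows "angle_fun G \<Omega> p = sqrt (\<Sum>i\<in>I. (hnu (D p) p i)\<^sup>2) / norm (cov (D p) p)"
    and "riem G p (Zfield G p) (outer_normal G \<Omega> p) = D p (Zfield G p) / norm (cov (D p) p)"
    and "norm (cov (D p) p) > 0"
proof -
  let ?c = "cov (D p) p"
  have pU: "p \<in> U" using loc by (simp add: local_defining_def)
  show c: "norm ?c > 0" using cov_nonzero[OF defining_derivsD(7)[OF dd pU]] by simp
  note n = outer_normal_eq[OF assms]
  have "riem G p (outer_normal G \<Omega> p) (lfield G (e i) p) = hnu (D p) p i / norm ?c" for i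
    unfolding n lfield_eq riem_lf by (simp add: cov_inner hnu_def divide_inverse mult.commute)
  then have "angle_fun G \<Omega> p = sqrt (\<Sum>i\<in>I. (hnu (D p) p i / norm ?c)\<^sup>2)"
    by (simp add: angle_fun_def I_def)
  also have "(\<Sum>i\<in>I. (hnu (D p) p i / norm ?c)\<^sup>2) = (\<Sum>i\<in>I. (hnu (D p) p i)\<^sup>2) / (norm ?c)\<^sup>2"
    by (simp add: power_divide sum_divide_distrib)
  finally show "angle_fun G \<Omega> p = sqrt (\<Sum>i\<in>I. (hnu (D p) p i)\<^sup>2) / norm ?c"
    by (simp add: real_sqrt_divide)
  let ?z = "Zfield G p - (1/2) *\<^sub>R br p (Zfield G p)"
  have z: "Zfield G p = lf ?z p" by (simp only: lf_inverse)
  have "riem G p (lf ?z p) (outer_normal G \<Omega> p) = (?c \<bullet> ?z) / norm ?c"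
    unfolding n riem_lf inner_scaleR_right inner_commute[of ?z ?c] by (simp only: divide_inverse mult.commute)
  also have "\<dots> = D p (Zfield G p) / norm ?c" unfolding cov_inner lf_inverse ..
  finally show "riem G p (Zfield G p) (outer_normal G \<Omega> p) = D p (Zfield G p) / norm ?c" unfolding z[symmetric] .
qed

text \<open>The numerator of the H-mean curvature in terms of the Euclidean second differential. The
  half brackets in the horizontal second derivatives do not show: they vanish on the diagonal and
  cancel in the symmetrised Hessian.\<close>

definition hcurv_num :: "('a \<Rightarrow>\<^sub>L real) \<Rightarrow> ('a \<Rightarrow>\<^sub>L 'a \<Rightarrow>\<^sub>L real) \<Rightarrow> 'a \<Rightarrow> real" where
  "hcurv_num D D2 p = (\<Sum>i\<in>I. (hnu D p i)\<^sup>2) * (\<Sum>i\<in>I. D2 (lf (e i) p) (lf (e i) p))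
     - (\<Sum>i\<in>I. \<Sum>j\<in>I. hnu D p i * hnu D p j * D2 (lf (e i) p) (lf (e j) p))"

lemma X_has_derivative:
  assumes "(f has_derivative blinfun_apply D) (at g)" shows "X G i f g = D (lf (e i) g)"
  by (rule has_X_X) (rule has_X_has_derivative[OF assms])

lemma X_X_has_derivative:
  fixes D :: "'a \<Rightarrow> 'a \<Rightarrow>\<^sub>L real"
  assumes U: "open U" "g \<in> U" and f: "\<And>x. x \<in> U \<Longrightarrow> (f has_derivative blinfun_apply (D x)) (at x)"
    and D: "(D has_derivative blinfun_apply D2) (at g)"
  shows "X G j (X G i f) g = D2 (lf (e j) g) (lf (e i) g) + (1/2) * D g (br (e j) (e i))"
proof (rule has_X_X)
  show "has_X (e j) (X G i f) (D2 (lf (e j) g) (lf (e i) g) + (1/2) * D g (br (e j) (e i))) g"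
    using has_X_cong_open[OF U, of "X G i f" "\<lambda>x. D x (lf (e i) x)"] X_has_derivative[OF f] has_X_second[OF D]
    by simp
qed

lemma norm_frame_sum: "norm (\<Sum>i\<in>I. c i *\<^sub>R e i) = sqrt (\<Sum>i\<in>I. (c i)\<^sup>2)"
proof -
  have "(\<Sum>i\<in>I. c i *\<^sub>R e i) \<bullet> (\<Sum>i\<in>I. c i *\<^sub>R e i) = (\<Sum>i\<in>I. \<Sum>j\<in>I. c i * (c j * (e j \<bullet> e i)))"
    by (simp add: inner_sum_left inner_sum_right sum_distrib_left)
  also have "\<dots> = (\<Sum>i\<in>I. \<Sum>j\<in>I. if j = i then c i * c i else 0)"
    by (intro sum.cong refl) (auto simp: frame_orth)
  also have "\<dots> = (\<Sum>i\<in>I. (c i)\<^sup>2)" by (simp add: sum.delta power2_eq_square)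
  finally show ?thesis by (simp add: norm_eq_sqrt_inner)
qed

lemma Hcurv_of_eq:
  assumes dd: "defining_derivs \<Omega> U \<phi> D D2" and p: "p \<in> U"
  shows "Hcurv_of G \<phi> p = hcurv_num (D p) (D2 p) p / (sqrt (\<Sum>i\<in>I. (hnu (D p) p i)\<^sup>2)) ^ 3"
proof -
  note \<phi> = defining_derivsD(5)[OF dd] and D2 = defining_derivsD(6)[OF dd]
  have X1: "X G i \<phi> p = hnu (D p) p i" for i
    unfolding hnu_def by (rule X_has_derivative[OF \<phi>[OF p]])
  have X2: "X G j (X G i \<phi>) p = D2 p (lf (e j) p) (lf (e i) p) + (1/2) * D p (br (e j) (e i))" for i j
    by (rule X_X_has_derivative[OF defining_derivsD(1)[OF dd] p \<phi> D2[OF p]])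
  have "hgrad G \<phi> p = lf (\<Sum>i\<in>I. hnu (D p) p i *\<^sub>R e i) p"
    unfolding hgrad_def X1 lfield_eq lf_sum I_def ..
  then have n: "rnorm G p (hgrad G \<phi> p) = sqrt (\<Sum>i\<in>I. (hnu (D p) p i)\<^sup>2)" by (simp add: norm_frame_sum)
  have l: "hlap G \<phi> p = (\<Sum>i\<in>I. D2 p (lf (e i) p) (lf (e i) p))"
    unfolding hlap_def X2 I_def by simp
  have h: "hhess G i j \<phi> p = (D2 p (lf (e i) p) (lf (e j) p) + D2 p (lf (e j) p) (lf (e i) p)) / 2" for i j
    unfolding hhess_def X2 using br_antisym[of "e i" "e j"] by (simp add: blinfun.minus_right)
  let ?t = "\<lambda>i j. D2 p (lf (e i) p) (lf (e j) p) * hnu (D p) p i * hnu (D p) p j"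
  have "hinflap G \<phi> p = (\<Sum>i\<in>I. \<Sum>j\<in>I. (?t i j + ?t j i) / 2)"
    unfolding hinflap_def X1 h I_def by (intro sum.cong refl) (simp add: field_simps)
  also have "\<dots> = ((\<Sum>i\<in>I. \<Sum>j\<in>I. ?t i j) + (\<Sum>i\<in>I. \<Sum>j\<in>I. ?t j i)) / 2"
    by (simp add: sum.distrib sum_divide_distrib[symmetric])
  also have "(\<Sum>i\<in>I. \<Sum>j\<in>I. ?t j i) = (\<Sum>i\<in>I. \<Sum>j\<in>I. ?t i j)" by (rule sum.swap)
  finally have il: "hinflap G \<phi> p = (\<Sum>i\<in>I. \<Sum>j\<in>I. hnu (D p) p i * hnu (D p) p j * D2 p (lf (e i) p) (lf (e j) p))"
    by (simp add: mult_ac)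
  show ?thesis unfolding Hcurv_of_def n l il hcurv_num_def by (simp add: sum_nonneg)
qed

text \<open>Clearing denominators turns both boundary hypotheses into inequalities that make sense
  and hold at every boundary point, with one defining function serving for both.\<close>

lemma hcurv_num_bound:
  assumes \<Omega>: "C2_open_set \<Omega>" and M: "(SUP g\<in>Hcurv_dom G \<Omega>. ereal \<bar>Hcurv G \<Omega> g\<bar>) \<le> ereal M"
    and \<alpha>: "\<forall>g\<in>frontier \<Omega>. riem G g (Zfield G g) (outer_normal G \<Omega> g) \<ge> \<alpha> * angle_fun G \<Omega> g"
    and p: "p \<in> frontier \<Omega>"
  obtains U \<phi> D D2 where "local_defining \<Omega> p U \<phi>" "defining_derivs \<Omega> U \<phi> D D2" "p \<in> U" "\<phi> p = 0"
    "hcurv_num (D p) (D2 p) p \<le> M * (sqrt (\<Sum>i\<in>I. (hnu (D p) p i)\<^sup>2)) ^ 3"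
    "\<alpha> * sqrt (\<Sum>i\<in>I. (hnu (D p) p i)\<^sup>2) \<le> D p (Zfield G p)"
proof -
  have op: "open \<Omega>" using \<Omega> by (simp add: C2_open_set_def)
  have \<alpha>': "\<alpha> * sqrt (\<Sum>i\<in>I. (hnu (D p) p i)\<^sup>2) \<le> D p (Zfield G p)"
    if "local_defining \<Omega> p U \<phi>" "defining_derivs \<Omega> U \<phi> D D2" for U \<phi> D D2
  proof -
    note n = normal_inner_products[OF op p that]
    have "\<alpha> * (sqrt (\<Sum>i\<in>I. (hnu (D p) p i)\<^sup>2) / norm (cov (D p) p)) \<le> D p (Zfield G p) / norm (cov (D p) p)"
      using bspec[OF \<alpha> p] unfolding n(1,2) .
    then show ?thesis using n(3) by (simp add: divide_le_cancel)
  qed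
  obtain U0 \<phi>0 where loc0: "local_defining \<Omega> p U0 \<phi>0" using \<Omega> p unfolding C2_open_set_def by meson
  note result = that
  have main: thesis if loc: "local_defining \<Omega> p U \<phi>" and dd: "defining_derivs \<Omega> U \<phi> D D2" and pU: "p \<in> U"
    and le: "hcurv_num (D p) (D2 p) p \<le> M * (sqrt (\<Sum>i\<in>I. (hnu (D p) p i)\<^sup>2)) ^ 3" for U \<phi> D D2
    by (rule result[OF loc dd pU local_defining_frontier_eq_0[OF op loc p] le \<alpha>'[OF loc dd]])
  show ?thesis
  proof (cases "angle_fun G \<Omega> p = 0")
    case True
    obtain D D2 where D: "p \<in> U0" "defining_derivs \<Omega> U0 \<phi>0 D D2" by (rule local_defining_derivs[OF loc0])
    \<comment> \<open>At a characteristic point all components of the horizontal conormal are zero,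
      so both sides of the curvature inequality vanish.\<close>
    have "sqrt (\<Sum>i\<in>I. (hnu (D p) p i)\<^sup>2) = 0"
      using True normal_inner_products(1,3)[OF op p loc0 D(2)] by simp
    then have s0: "(\<Sum>i\<in>I. (hnu (D p) p i)\<^sup>2) = 0" by simp
    then have "hnu (D p) p i = 0" if "i \<in> I" for i
      using sum_nonneg_eq_0_iff[of I "\<lambda>i. (hnu (D p) p i)\<^sup>2"] that by simp
    then have "hcurv_num (D p) (D2 p) p = 0" unfolding hcurv_num_def s0 by simp
    then show ?thesis using s0 by (intro main[OF loc0 D(2,1)]) simp
  next
    case False
    then have nc: "p \<notin> char_set G \<Omega>" by (simp add: char_set_def)
    then have dom: "p \<in> Hcurv_dom G \<Omega>" using p by (simp add: Hcurv_dom_def)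
    have "ereal \<bar>Hcurv G \<Omega> p\<bar> \<le> ereal M" using SUP_upper[OF dom] M by (rule order_trans)
    then have HM: "\<bar>Hcurv_nonchar G \<Omega> p\<bar> \<le> M" using nc by (simp add: Hcurv_def)
    \<comment> \<open>The value selected by \<open>SOME\<close> belongs to some defining function,
      and that function is the one returned; no curvatures of two defining functions have to be
      compared.\<close>
    have "\<exists>U \<phi>. local_defining \<Omega> p U \<phi> \<and> Hcurv_nonchar G \<Omega> p = Hcurv_of G \<phi> p"
      unfolding Hcurv_nonchar_def
      by (rule someI[of "\<lambda>h. \<exists>U \<phi>. local_defining \<Omega> p U \<phi> \<and> h = Hcurv_of G \<phi> p"]) (use loc0 in blast)
    then obtain U \<phi> where loc: "local_defining \<Omega> p U \<phi>" and H: "Hcurv_nonchar G \<Omega> p = Hcurv_of G \<phi> p" by blast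
    obtain D D2 where D: "p \<in> U" "defining_derivs \<Omega> U \<phi> D D2" by (rule local_defining_derivs[OF loc])
    let ?N = "sqrt (\<Sum>i\<in>I. (hnu (D p) p i)\<^sup>2)"
    have "?N \<noteq> 0" using False normal_inner_products(1,3)[OF op p loc D(2)] by auto
    moreover have "?N \<ge> 0" by (simp add: sum_nonneg)
    ultimately have N: "?N ^ 3 > 0" by simp
    have "hcurv_num (D p) (D2 p) p / ?N ^ 3 \<le> M"
      using HM unfolding H Hcurv_of_eq[OF D(2,1)] by (rule abs_le_D1)
    then have "hcurv_num (D p) (D2 p) p \<le> M * ?N ^ 3" using N by (simp add: pos_divide_le_eq)
    then show ?thesis by (rule main[OF loc D(2,1)])
  qed
qed

end

lemma defining_derivs_local:
  assumes "defining_derivs \<Omega> U \<phi> D D2" "p \<in> U" shows "local_defining \<Omega> p U \<phi>"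
proof -
  note d = defining_derivsD[OF assms(1)]
  have "frechet_derivative \<phi> (at x) \<noteq> (\<lambda>v. 0)" if "x \<in> U" for x
  proof
    assume "frechet_derivative \<phi> (at x) = (\<lambda>v. 0)"
    then have "D x = 0" unfolding d(9)[OF that] by (intro blinfun_eqI) simp
    then show False using d(7)[OF that] by simp
  qed
  moreover have "C2_on U \<phi>" unfolding C2_on_def using d(3,5,6) by (intro exI[of _ D] exI[of _ D2]) simp
  moreover have "\<Omega> \<inter> U = {x \<in> U. \<phi> x < 0}" using d(8) by auto
  ultimately show ?thesis using d(1) assms(2) by (simp add: local_defining_def)
qed

section \<open>Bounding the dilation field by horizontal derivatives and commutators\<close>

context carnot2
begin

abbreviation E :: "'a set" where "E \<equiv> e ` I"

lemma inj_frame: "inj_on e I"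
proof (rule inj_onI)
  fix i j assume "i \<in> I" "j \<in> I" "e i = e j"
  then show "i = j" using frame_orth[of i i] frame_orth[of i j] by (auto split: if_splits)
qed

lemma sum_frame: "(\<Sum>i\<in>I. f (e i)) = (\<Sum>\<xi>\<in>E. f \<xi>)"
  by (simp add: sum.reindex[OF inj_frame])

lemma E_V1: "\<xi> \<in> E \<Longrightarrow> \<xi> \<in> V1 G"
  using frame_V1 by auto

lemma E_norm: "\<xi> \<in> E \<Longrightarrow> \<xi> \<bullet> \<xi> = 1"
  using frame_orth by auto

lemma hproj_E: "hproj g = (\<Sum>\<xi>\<in>E. (g \<bullet> \<xi>) *\<^sub>R \<xi>)"
  unfolding hproj_def by (rule sum_frame)

lemma lf_inner_E: "\<xi> \<in> E \<Longrightarrow> lf \<xi> g \<bullet> \<xi> = 1"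
  using V1_V2_orth[OF E_V1 br_in_V2, of \<xi> g \<xi>] E_norm[of \<xi>]
  by (simp add: lf_def inner_add_left inner_commute[of "br g \<xi>" \<xi>])

lemma E_nonempty: "E \<noteq> {}"
proof
  assume "E = {}"
  then have "hproj g = 0" for g by (simp add: hproj_E)
  then have "br x y = 0" for x y using br_hproj(1)[of x y] by simp
  then have "{br v v' | v v'. v \<in> V1 G \<and> v' \<in> V1 G} \<subseteq> {0}" by auto
  from span_mono[OF this] have "V2 G \<subseteq> {0}" using V2_span by simp
  then show False using V2_nontrivial subspace_0[OF subspace_V2] by auto
qed

definition bracket_sum :: "('a \<Rightarrow>\<^sub>L real) \<Rightarrow> real" where
  "bracket_sum D = (\<Sum>\<xi>\<in>E. \<Sum>\<eta>\<in>E. \<bar>D (br \<xi> \<eta>)\<bar>)"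

text \<open>Vertical vectors are combinations of brackets, and expanding both entries in the frame
  leaves brackets of frame vectors. The constant depends on k alone, which makes the bound uniform
  in the covector.\<close>

lemma bracket_bound:
  assumes "k \<in> V2 G"
  shows "\<exists>c\<ge>0. \<forall>D. \<bar>blinfun_apply D k\<bar> \<le> c * bracket_sum D"
proof -
  have "k \<in> span {br v v' | v v'. v \<in> V1 G \<and> v' \<in> V1 G}" using assms V2_span by simp
  then show ?thesis
  proof (induction rule: span_induct_alt)
    case base then show ?case by (intro exI[of _ 0]) (simp add: blinfun.zero_right)
  next
    case (step a x y)
    obtain v v' where x: "x = br v v'" using step(1) by auto
    obtain c where c: "c \<ge> 0" "\<forall>D. \<bar>blinfun_apply D y\<bar> \<le> c * bracket_sum D" using step(2) by blast
    let ?c = "norm v * norm v'"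
    have bx: "\<bar>D x\<bar> \<le> ?c * bracket_sum D" for D :: "'a \<Rightarrow>\<^sub>L real"
    proof -
      have 1: "D (br \<xi> v') = (\<Sum>\<eta>\<in>E. (v' \<bullet> \<eta>) * D (br \<xi> \<eta>))" for \<xi>
      proof -
        have "br \<xi> v' = br \<xi> (hproj v')" by simp
        also have "\<dots> = (\<Sum>\<eta>\<in>E. (v' \<bullet> \<eta>) *\<^sub>R br \<xi> \<eta>)"
          unfolding hproj_E linear_sum[OF linear_br_right] by simp
        finally show ?thesis by (simp add: blinfun.sum_right blinfun.scaleR_right)
      qed
      have "x = br (hproj v) v'" by (simp add: x)
      also have "\<dots> = (\<Sum>\<xi>\<in>E. (v \<bullet> \<xi>) *\<^sub>R br \<xi> v')"
        unfolding hproj_E linear_sum[OF linear_br_left] by simp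
      finally have "D x = (\<Sum>\<xi>\<in>E. \<Sum>\<eta>\<in>E. (v \<bullet> \<xi>) * ((v' \<bullet> \<eta>) * D (br \<xi> \<eta>)))"
        by (simp add: blinfun.sum_right blinfun.scaleR_right 1 sum_distrib_left)
      also have "\<bar>\<dots>\<bar> \<le> (\<Sum>\<xi>\<in>E. \<Sum>\<eta>\<in>E. \<bar>(v \<bullet> \<xi>) * ((v' \<bullet> \<eta>) * D (br \<xi> \<eta>))\<bar>)"
        by (rule order_trans[OF sum_abs sum_mono[OF sum_abs]])
      also have "\<dots> \<le> (\<Sum>\<xi>\<in>E. \<Sum>\<eta>\<in>E. ?c * \<bar>D (br \<xi> \<eta>)\<bar>)"
      proof (intro sum_mono)
        fix \<xi> \<eta> assume "\<xi> \<in> E" "\<eta> \<in> E"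
        then have n: "norm \<xi> = 1" "norm \<eta> = 1" using E_norm by (auto simp: norm_eq_sqrt_inner)
        have "\<bar>v \<bullet> \<xi>\<bar> \<le> norm v" "\<bar>v' \<bullet> \<eta>\<bar> \<le> norm v'"
          using Cauchy_Schwarz_ineq2[of v \<xi>] Cauchy_Schwarz_ineq2[of v' \<eta>] n by simp_all
        then have "\<bar>v \<bullet> \<xi>\<bar> * \<bar>v' \<bullet> \<eta>\<bar> \<le> ?c" by (intro mult_mono) auto
        then have "\<bar>v \<bullet> \<xi>\<bar> * \<bar>v' \<bullet> \<eta>\<bar> * \<bar>D (br \<xi> \<eta>)\<bar> \<le> ?c * \<bar>D (br \<xi> \<eta>)\<bar>" by (rule mult_right_mono) simp
        then show "\<bar>(v \<bullet> \<xi>) * ((v' \<bullet> \<eta>) * D (br \<xi> \<eta>))\<bar> \<le> ?c * \<bar>D (br \<xi> \<eta>)\<bar>" by (simp add: abs_mult mult_ac)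
      qed
      finally show ?thesis by (simp add: bracket_sum_def sum_distrib_left)
    qed
    have "\<bar>D (a *\<^sub>R x + y)\<bar> \<le> (\<bar>a\<bar> * ?c + c) * bracket_sum D" for D :: "'a \<Rightarrow>\<^sub>L real"
    proof -
      have "\<bar>D (a *\<^sub>R x + y)\<bar> \<le> \<bar>a\<bar> * \<bar>D x\<bar> + \<bar>D y\<bar>"
        by (simp add: blinfun.add_right blinfun.scaleR_right abs_mult[symmetric])
      also have "\<dots> \<le> \<bar>a\<bar> * (?c * bracket_sum D) + c * bracket_sum D"
        by (intro add_mono mult_left_mono bx c(2)[rule_format]) simp
      finally show ?thesis by (simp add: algebra_simps)
    qed
    moreover have "\<bar>a\<bar> * ?c + c \<ge> 0" using c(1) by simp
    ultimately show ?case by blast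
  qed
qed

lemma sum_abs_square_le:
  fixes f :: "'b \<Rightarrow> real" shows "(\<Sum>i\<in>A. \<bar>f i\<bar>)\<^sup>2 \<le> card A * (\<Sum>i\<in>A. (f i)\<^sup>2)"
  using sum_squared_le_sum_of_squares[of "\<lambda>i. \<bar>f i\<bar>" A]
  by (cases "finite A") (simp_all add: mult.commute)

text \<open>At g the dilation field is the left-invariant field of the horizontal part of g plus
  twice the vertical part. The first costs horizontal derivatives and the second brackets, with
  coefficients bounded on \<Omega>. Being stated for all covectors, the constant is independent of
  u.\<close>

lemma Zfield_bound:
  assumes "bounded \<Omega>"
  shows "\<exists>c>0. \<forall>g\<in>\<Omega>. \<forall>D :: 'a \<Rightarrow>\<^sub>L real.
     (D (Zfield G g))\<^sup>2 \<le> c * ((\<Sum>\<xi>\<in>E. (D (lf \<xi> g))\<^sup>2) + (\<Sum>\<xi>\<in>E. \<Sum>\<eta>\<in>E. (D (br \<xi> \<eta>))\<^sup>2))"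
proof -
  obtain R where R: "\<forall>g\<in>\<Omega>. norm g \<le> R" using assms unfolding bounded_iff ..
  define R1 where "R1 = max R 0"
  have R1: "R1 \<ge> 0" "\<And>g. g \<in> \<Omega> \<Longrightarrow> norm g \<le> R1" using R by (auto simp: R1_def intro: max.coboundedI1)
  let ?q = "\<lambda>k. SOME c. c \<ge> 0 \<and> (\<forall>D. \<bar>blinfun_apply D k\<bar> \<le> c * bracket_sum D)"
  have q: "?q k \<ge> 0 \<and> (\<forall>D. \<bar>blinfun_apply D k\<bar> \<le> ?q k * bracket_sum D)" if "k \<in> V2 G" for k
    using bracket_bound[OF that] by (rule someI_ex)
  define c2 where "c2 = (\<Sum>b\<in>Basis. ?q (b - hproj b))"
  have c2: "c2 \<ge> 0" unfolding c2_def using q[OF vproj_V2] by (intro sum_nonneg) blast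
  have vbound: "\<bar>D (g - hproj g)\<bar> \<le> R1 * c2 * bracket_sum D" if g: "g \<in> \<Omega>" for g and D :: "'a \<Rightarrow>\<^sub>L real"
  proof -
    have l: "linear (\<lambda>g. g - hproj g)" by (intro linear_compose_sub linear_ident linear_hproj)
    have "g - hproj g = (\<Sum>b\<in>Basis. (g \<bullet> b) *\<^sub>R (b - hproj b))"
      using linear_sum[OF l, of "\<lambda>b. (g \<bullet> b) *\<^sub>R b" Basis] linear_scale[OF l]
      by (simp add: euclidean_representation)
    then have "D (g - hproj g) = (\<Sum>b\<in>Basis. (g \<bullet> b) * D (b - hproj b))"
      by (simp add: blinfun.sum_right blinfun.scaleR_right)
    also have "\<bar>\<dots>\<bar> \<le> (\<Sum>b\<in>Basis. \<bar>(g \<bullet> b) * D (b - hproj b)\<bar>)" by (rule sum_abs)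
    also have "\<dots> \<le> (\<Sum>b\<in>Basis. R1 * (?q (b - hproj b) * bracket_sum D))"
    proof (rule sum_mono)
      fix b :: 'a assume b: "b \<in> Basis"
      have "\<bar>g \<bullet> b\<bar> \<le> R1" using Basis_le_norm[OF b, of g] R1(2)[OF g] by simp
      then show "\<bar>(g \<bullet> b) * D (b - hproj b)\<bar> \<le> R1 * (?q (b - hproj b) * bracket_sum D)"
        unfolding abs_mult using q[OF vproj_V2] R1(1) by (intro mult_mono) auto
    qed
    also have "\<dots> = R1 * c2 * bracket_sum D" by (simp only: c2_def sum_distrib_left sum_distrib_right mult.assoc)
    finally show ?thesis .
  qed
  have hbound: "\<bar>D (lf (hproj g) g)\<bar> \<le> R1 * (\<Sum>\<xi>\<in>E. \<bar>D (lf \<xi> g)\<bar>)" if g: "g \<in> \<Omega>" for g and D :: "'a \<Rightarrow>\<^sub>L real"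
  proof -
    have "D (lf (hproj g) g) = (\<Sum>\<xi>\<in>E. (g \<bullet> \<xi>) * D (lf \<xi> g))"
      unfolding hproj_E lf_sum by (simp add: blinfun.sum_right blinfun.scaleR_right)
    also have "\<bar>\<dots>\<bar> \<le> (\<Sum>\<xi>\<in>E. \<bar>(g \<bullet> \<xi>) * D (lf \<xi> g)\<bar>)" by (rule sum_abs)
    also have "\<dots> \<le> (\<Sum>\<xi>\<in>E. R1 * \<bar>D (lf \<xi> g)\<bar>)"
    proof (rule sum_mono)
      fix \<xi> assume "\<xi> \<in> E"
      then have "norm \<xi> = 1" using E_norm by (auto simp: norm_eq_sqrt_inner)
      then have "\<bar>g \<bullet> \<xi>\<bar> \<le> R1" using Cauchy_Schwarz_ineq2[of g \<xi>] R1(2)[OF g] by simp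
      then show "\<bar>(g \<bullet> \<xi>) * D (lf \<xi> g)\<bar> \<le> R1 * \<bar>D (lf \<xi> g)\<bar>" unfolding abs_mult by (rule mult_right_mono) simp
    qed
    finally show ?thesis by (simp add: sum_distrib_left)
  qed
  \<comment> \<open>From (x + 2y)^2 \<le> 2x^2 + 8y^2 and Cauchy-Schwarz over the
    \<open>card E\<close> horizontal and \<open>card (E \<times> E)\<close> bracket terms; the 1
    secures positivity.\<close>
  define c where "c = 2 * R1\<^sup>2 * card E + 8 * (R1 * c2)\<^sup>2 * card (E \<times> E) + 1"
  have "c > 0" unfolding c_def by (intro add_nonneg_pos add_nonneg_nonneg mult_nonneg_nonneg) auto
  moreover have "(D (Zfield G g))\<^sup>2 \<le> c * ((\<Sum>\<xi>\<in>E. (D (lf \<xi> g))\<^sup>2) + (\<Sum>\<xi>\<in>E. \<Sum>\<eta>\<in>E. (D (br \<xi> \<eta>))\<^sup>2))"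
    if g: "g \<in> \<Omega>" for g and D :: "'a \<Rightarrow>\<^sub>L real"
  proof -
    let ?N = "\<Sum>\<xi>\<in>E. (D (lf \<xi> g))\<^sup>2" and ?A = "\<Sum>\<xi>\<in>E. \<Sum>\<eta>\<in>E. (D (br \<xi> \<eta>))\<^sup>2"
    let ?x = "D (lf (hproj g) g)" and ?y = "D (g - hproj g)"
    have N0: "?N \<ge> 0" "?A \<ge> 0" by (auto intro!: sum_nonneg)
    have "Zfield G g = lf (hproj g) g + 2 *\<^sub>R (g - hproj g)" by (simp add: Zfield_eq lf_def)
    then have "D (Zfield G g) = ?x + 2 * ?y" by (simp add: blinfun.add_right blinfun.scaleR_right)
    then have "(D (Zfield G g))\<^sup>2 \<le> 2 * ?x\<^sup>2 + 8 * ?y\<^sup>2"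
      using sum_squares_ge_zero[of "?x - 2 * ?y" 0] by (simp add: power2_eq_square algebra_simps)
    moreover have "?x\<^sup>2 \<le> R1\<^sup>2 * card E * ?N"
    proof -
      have "?x\<^sup>2 \<le> (R1 * (\<Sum>\<xi>\<in>E. \<bar>D (lf \<xi> g)\<bar>))\<^sup>2" using power_mono[OF hbound[OF g, of D] abs_ge_zero, of 2] by simp
      also have "\<dots> \<le> R1\<^sup>2 * (card E * ?N)" unfolding power_mult_distrib
        by (intro mult_left_mono sum_abs_square_le) simp
      finally show ?thesis by (simp add: mult.assoc)
    qed
    moreover have "?y\<^sup>2 \<le> (R1 * c2)\<^sup>2 * card (E \<times> E) * ?A"
    proof -
      have "?y\<^sup>2 \<le> (R1 * c2 * bracket_sum D)\<^sup>2" using power_mono[OF vbound[OF g, of D] abs_ge_zero, of 2] by simp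
      also have "\<dots> = (R1 * c2)\<^sup>2 * (\<Sum>z\<in>E \<times> E. \<bar>D (br (fst z) (snd z))\<bar>)\<^sup>2"
        by (simp add: bracket_sum_def power_mult_distrib sum.cartesian_product split_beta)
      also have "\<dots> \<le> (R1 * c2)\<^sup>2 * (real (card (E \<times> E)) * (\<Sum>z\<in>E \<times> E. (D (br (fst z) (snd z)))\<^sup>2))"
        by (intro mult_left_mono sum_abs_square_le) simp
      also have "(\<Sum>z\<in>E \<times> E. (D (br (fst z) (snd z)))\<^sup>2) = ?A" by (simp add: sum.cartesian_product split_beta)
      finally show ?thesis by (simp only: mult.assoc)
    qed
    ultimately have "(D (Zfield G g))\<^sup>2 \<le> (2 * R1\<^sup>2 * card E) * ?N + (8 * (R1 * c2)\<^sup>2 * card (E \<times> E)) * ?A" by simp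
    also have "\<dots> \<le> c * ?N + c * ?A"
      using N0 by (intro add_mono mult_right_mono) (auto simp: c_def)
    finally show ?thesis by (simp add: algebra_simps)
  qed
  ultimately show ?thesis by blast
qed

end

section \<open>The integral identities\<close>

text \<open>On the boundary \<open>D\<close> and \<open>D2\<close> are continuous extensions, not
  derivatives. \<open>u3 \<xi> \<eta> \<zeta>\<close> extends the third derivative X_\<xi> X_\<eta>
  X_\<zeta> u, and \<open>B\<close> is an orthonormal basis of the second layer, so that divergences
  are taken along \<open>E \<union> B\<close>. Frame vectors replace indices throughout.\<close>

locale zero_boundary_function = carnot2 +
  fixes \<Omega> :: "'a set" and u :: "'a \<Rightarrow> real" and D :: "'a \<Rightarrow> 'a \<Rightarrow>\<^sub>L real" and D2 :: "'a \<Rightarrow> 'a \<Rightarrow>\<^sub>L 'a \<Rightarrow>\<^sub>L real"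
    and u3 :: "'a \<Rightarrow> 'a \<Rightarrow> 'a \<Rightarrow> 'a \<Rightarrow> real" and B :: "'a set"
  assumes C2\<Omega>: "C2_open_set \<Omega>" and bdd: "bounded \<Omega>"
    and u: "\<And>x. x \<in> \<Omega> \<Longrightarrow> (u has_derivative blinfun_apply (D x)) (at x)"
    and D: "\<And>x. x \<in> \<Omega> \<Longrightarrow> (D has_derivative blinfun_apply (D2 x)) (at x)"
    and cu: "continuous_on (closure \<Omega>) u" and cD: "continuous_on (closure \<Omega>) D" and cD2: "continuous_on (closure \<Omega>) D2"
    and u0: "\<And>x. x \<in> frontier \<Omega> \<Longrightarrow> u x = 0"
    and cu3: "\<And>\<xi> \<eta> \<zeta>. \<xi> \<in> E \<Longrightarrow> \<eta> \<in> E \<Longrightarrow> \<zeta> \<in> E \<Longrightarrow> continuous_on (closure \<Omega>) (u3 \<xi> \<eta> \<zeta>)"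
    and u3: "\<And>\<xi> \<eta> \<zeta> g. \<xi> \<in> E \<Longrightarrow> \<eta> \<in> E \<Longrightarrow> \<zeta> \<in> E \<Longrightarrow> g \<in> \<Omega> \<Longrightarrow>
        has_X \<xi> (\<lambda>x. D2 x (lf \<eta> x) (lf \<zeta> x) + (1/2) * D x (br \<eta> \<zeta>)) (u3 \<xi> \<eta> \<zeta> g) g"
    and B: "finite B" "B \<subseteq> V2 G" "B \<noteq> {}" "\<And>k. k \<in> B \<Longrightarrow> k \<bullet> k = 1"
    and B_expand: "\<And>g. (\<Sum>k\<in>B. (g \<bullet> k) *\<^sub>R k) = g - hproj g"
begin

lemma op: "open \<Omega>" using C2\<Omega> by (simp add: C2_open_set_def)

definition u1 :: "'a \<Rightarrow> 'a \<Rightarrow> real" where "u1 \<xi> x = D x (lf \<xi> x)"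
text \<open>The derivative X_\<xi> X_\<eta> u; the half bracket is its antisymmetric part.\<close>

definition u2 :: "'a \<Rightarrow> 'a \<Rightarrow> 'a \<Rightarrow> real" where "u2 \<xi> \<eta> x = D2 x (lf \<xi> x) (lf \<eta> x) + (1/2) * D x (br \<xi> \<eta>)"
definition L :: "'a \<Rightarrow> real" where "L x = (\<Sum>\<xi>\<in>E. u2 \<xi> \<xi> x)"
definition N2 :: "'a \<Rightarrow> real" where "N2 x = (\<Sum>\<xi>\<in>E. (u1 \<xi> x)\<^sup>2)"
definition Zu :: "'a \<Rightarrow> real" where "Zu x = D x (Zfield G x)"
definition S2 :: "'a \<Rightarrow> real" where "S2 x = (\<Sum>\<xi>\<in>E. \<Sum>\<eta>\<in>E. ((u2 \<xi> \<eta> x + u2 \<eta> \<xi> x) / 2)\<^sup>2)"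
definition A2 :: "'a \<Rightarrow> real" where "A2 x = (\<Sum>\<xi>\<in>E. \<Sum>\<eta>\<in>E. (D x (br \<xi> \<eta>))\<^sup>2)"
definition F :: "'a \<Rightarrow> 'a \<Rightarrow> real" where "F \<xi> x = u1 \<xi> x * L x - (\<Sum>\<eta>\<in>E. u1 \<eta> x * (2 * u2 \<eta> \<xi> x - u2 \<xi> \<eta> x))"
definition F' :: "'a \<Rightarrow> 'a \<Rightarrow> real" where
  "F' \<xi> x = (u2 \<xi> \<xi> x * L x + (\<Sum>\<eta>\<in>E. u3 \<xi> \<eta> \<eta> x) * u1 \<xi> x)
     - (\<Sum>\<eta>\<in>E. u2 \<xi> \<eta> x * (2 * u2 \<eta> \<xi> x - u2 \<xi> \<eta> x) + (2 * u3 \<xi> \<eta> \<xi> x - u3 \<xi> \<xi> \<eta> x) * u1 \<eta> x)"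

lemma Zfield_linear: "linear (Zfield G)"
  unfolding Zfield_eq[abs_def]
  by (intro linear_compose_add linear_compose_scale_right linear_compose_sub linear_ident linear_hproj)

lemma Zfield_bounded_linear: "bounded_linear (Zfield G)"
  using Zfield_linear linear_conv_bounded_linear by blast

lemma cZ: "continuous_on A (Zfield G)"
  by (rule linear_continuous_on[OF Zfield_bounded_linear])

lemma sym: "x \<in> \<Omega> \<Longrightarrow> D2 x v w = D2 x w v"
  by (rule second_derivative_symmetric[OF op _ u D continuous_on_subset[OF cD2 closure_subset]])

lemma cu1: "continuous_on (closure \<Omega>) (u1 \<xi>)"
  unfolding u1_def by (intro continuous_intros blinfun.continuous_on cD)

lemma cu2: "continuous_on (closure \<Omega>) (u2 \<xi> \<eta>)"
  unfolding u2_def by (intro continuous_intros blinfun.continuous_on cD cD2)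

lemma cont_ops:
  "continuous_on (closure \<Omega>) L" "continuous_on (closure \<Omega>) N2" "continuous_on (closure \<Omega>) Zu"
  "continuous_on (closure \<Omega>) S2" "continuous_on (closure \<Omega>) A2" "continuous_on (closure \<Omega>) (F \<xi>)"
  unfolding L_def N2_def Zu_def S2_def A2_def F_def
  by (intro continuous_intros cu1 cu2 blinfun.continuous_on cD cZ; simp)+

lemma X_u: "x \<in> \<Omega> \<Longrightarrow> has_X \<xi> u (u1 \<xi> x) x"
  unfolding u1_def by (rule has_X_has_derivative[OF u])

lemma X_u1: "x \<in> \<Omega> \<Longrightarrow> has_X \<xi> (u1 \<eta>) (u2 \<xi> \<eta> x) x"
  unfolding u1_def[abs_def] u2_def by (rule has_X_second[OF D])

lemma X_u2: "\<xi> \<in> E \<Longrightarrow> \<eta> \<in> E \<Longrightarrow> \<zeta> \<in> E \<Longrightarrow> x \<in> \<Omega> \<Longrightarrow> has_X \<xi> (u2 \<eta> \<zeta>) (u3 \<xi> \<eta> \<zeta> x) x"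
  unfolding u2_def[abs_def] by (rule u3)

lemma u2_diff: "x \<in> \<Omega> \<Longrightarrow> u2 \<xi> \<eta> x - u2 \<eta> \<xi> x = D x (br \<xi> \<eta>)"
  unfolding u2_def using sym[of x "lf \<xi> x" "lf \<eta> x"] br_antisym[of \<eta> \<xi>] by (simp add: blinfun.minus_right)

text \<open>The left side is the double commutator [[X_\<eta>,X_\<xi>],X_\<xi>]u. It is evaluated in
  two halves, since no third derivative with a vertical direction is at hand: one difference is a
  commutator acting on X_\<xi> u, the other is X_\<xi> acting on the commutator of u. Both are mixed
  second derivatives, and they cancel by symmetry of \<open>D2\<close>.\<close>

lemma third_order:
  assumes "\<xi> \<in> E" "\<eta> \<in> E" "x \<in> \<Omega>"
  shows "u3 \<eta> \<xi> \<xi> x - 2 * u3 \<xi> \<eta> \<xi> x + u3 \<xi> \<xi> \<eta> x = 0"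
proof -
  have c: "continuous_on \<Omega> f" if "continuous_on (closure \<Omega>) f" for f :: "'a \<Rightarrow> real"
    using that closure_subset by (rule continuous_on_subset)
  have "u3 \<eta> \<xi> \<xi> x - u3 \<xi> \<eta> \<xi> x = u2 (br \<eta> \<xi>) \<xi> x"
    by (rule X_commutator[OF op assms(3), where \<xi>=\<eta> and \<eta>=\<xi> and v="u1 \<xi>" and a="u2 \<eta> \<xi>" and b="u2 \<xi> \<xi>"
          and aa="u3 \<eta> \<eta> \<xi>" and bb="u3 \<xi> \<xi> \<xi>" and w="u2 (br \<eta> \<xi>) \<xi>"])
       (intro X_u1 X_u2 c cu2 cu3 assms(1,2) | assumption)+
  also have "\<dots> = D2 x (br \<eta> \<xi>) (lf \<xi> x)" by (simp add: u2_def br_in_V2)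
  finally have 1: "u3 \<eta> \<xi> \<xi> x - u3 \<xi> \<eta> \<xi> x = D2 x (br \<eta> \<xi>) (lf \<xi> x)" .
  have "has_X \<xi> (\<lambda>y. u2 \<xi> \<eta> y - u2 \<eta> \<xi> y) (u3 \<xi> \<xi> \<eta> x - u3 \<xi> \<eta> \<xi> x) x"
    by (intro has_X_diff X_u2 assms)
  then have "has_X \<xi> (\<lambda>y. D y (lf (br \<xi> \<eta>) y)) (u3 \<xi> \<xi> \<eta> x - u3 \<xi> \<eta> \<xi> x) x"
    using has_X_cong_open[OF op assms(3), of "\<lambda>y. u2 \<xi> \<eta> y - u2 \<eta> \<xi> y" "\<lambda>y. D y (lf (br \<xi> \<eta>) y)" \<xi>] u2_diff
    by (simp add: br_in_V2)
  from has_X_unique[OF this has_X_second[OF D[OF assms(3)]]]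
  have 2: "u3 \<xi> \<xi> \<eta> x - u3 \<xi> \<eta> \<xi> x = D2 x (lf \<xi> x) (br \<xi> \<eta>)" by (simp add: br_in_V2 blinfun.zero_right)
  have "D2 x (lf \<xi> x) (br \<xi> \<eta>) = D2 x (br \<xi> \<eta>) (lf \<xi> x)" by (rule sym[OF assms(3)])
  also have "\<dots> = - D2 x (br \<eta> \<xi>) (lf \<xi> x)"
    unfolding br_antisym[of \<xi> \<eta>] by (simp only: blinfun.minus_right blinfun.minus_left)
  finally have "D2 x (lf \<xi> x) (br \<xi> \<eta>) = - D2 x (br \<eta> \<xi>) (lf \<xi> x)" .
  with 1 2 show ?thesis by simp
qed

lemma F_regular: assumes "\<xi> \<in> E" shows "X_regular \<Omega> \<xi> (F \<xi>) (F' \<xi>)"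
  unfolding X_regular_def
proof (intro conjI ballI)
  show "continuous_on (closure \<Omega>) (F \<xi>)" by (rule cont_ops)
  show "continuous_on (closure \<Omega>) (F' \<xi>)" unfolding F'_def[abs_def]
    by (intro continuous_intros cu1 cu2 cont_ops cu3 assms) auto
  fix g assume g: "g \<in> \<Omega>"
  have XL: "has_X \<xi> L (\<Sum>\<eta>\<in>E. u3 \<xi> \<eta> \<eta> g) g"
    unfolding L_def[abs_def] by (intro has_X_sum X_u2 assms g)
  show "has_X \<xi> (F \<xi>) (F' \<xi> g) g"
    unfolding F_def[abs_def] F'_def
    by (intro has_X_diff has_X_mult has_X_sum has_X_cmult X_u1 X_u2 XL assms g)
qed

text \<open>The third derivatives cancel by \<open>third_order\<close> once the summation indices
  are exchanged in the term coming from X_\<xi> \<open>L\<close>. A quadratic form in the second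
  derivatives remains.\<close>

lemma F_divergence: assumes x: "x \<in> \<Omega>"
  shows "(\<Sum>\<xi>\<in>E. F' \<xi> x) = (L x)\<^sup>2 - S2 x + 3/4 * A2 x"
proof -
  let ?p = "\<lambda>\<xi> \<eta>. u2 \<xi> \<eta> x"
  have "(\<Sum>\<xi>\<in>E. F' \<xi> x) = (\<Sum>\<xi>\<in>E. u2 \<xi> \<xi> x * L x) + (\<Sum>\<xi>\<in>E. \<Sum>\<eta>\<in>E. u3 \<xi> \<eta> \<eta> x * u1 \<xi> x)
      - (\<Sum>\<xi>\<in>E. \<Sum>\<eta>\<in>E. ?p \<xi> \<eta> * (2 * ?p \<eta> \<xi> - ?p \<xi> \<eta>))
      - (\<Sum>\<xi>\<in>E. \<Sum>\<eta>\<in>E. (2 * u3 \<xi> \<eta> \<xi> x - u3 \<xi> \<xi> \<eta> x) * u1 \<eta> x)"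
    unfolding F'_def by (simp add: sum.distrib sum_subtractf sum_distrib_right)
  also have "(\<Sum>\<xi>\<in>E. u2 \<xi> \<xi> x * L x) = (L x)\<^sup>2" by (simp add: L_def power2_eq_square sum_distrib_right)
  also have "(\<Sum>\<xi>\<in>E. \<Sum>\<eta>\<in>E. u3 \<xi> \<eta> \<eta> x * u1 \<xi> x) = (\<Sum>\<xi>\<in>E. \<Sum>\<eta>\<in>E. u3 \<eta> \<xi> \<xi> x * u1 \<eta> x)" by (rule sum.swap)
  also have "\<dots> = (\<Sum>\<xi>\<in>E. \<Sum>\<eta>\<in>E. (2 * u3 \<xi> \<eta> \<xi> x - u3 \<xi> \<xi> \<eta> x) * u1 \<eta> x)"
  proof (intro sum.cong refl)
    fix \<xi> \<eta> assume "\<xi> \<in> E" "\<eta> \<in> E"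
    then have "u3 \<eta> \<xi> \<xi> x = 2 * u3 \<xi> \<eta> \<xi> x - u3 \<xi> \<xi> \<eta> x" using third_order[OF _ _ x, of \<xi> \<eta>] by simp
    then show "u3 \<eta> \<xi> \<xi> x * u1 \<eta> x = (2 * u3 \<xi> \<eta> \<xi> x - u3 \<xi> \<xi> \<eta> x) * u1 \<eta> x" by simp
  qed
  also have "(\<Sum>\<xi>\<in>E. \<Sum>\<eta>\<in>E. ?p \<xi> \<eta> * (2 * ?p \<eta> \<xi> - ?p \<xi> \<eta>)) = S2 x - 3/4 * A2 x"
  proof -
    let ?f = "\<lambda>\<xi> \<eta>. ?p \<xi> \<eta> * (2 * ?p \<eta> \<xi> - ?p \<xi> \<eta>)"
    \<comment> \<open>With p = s + a/2 and q = s - a/2, the product p(2q - p) equals s^2 - 3a^2/4 -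
      sa. The last term is odd under exchange of the indices and disappears when the sum is
      symmetrised.\<close>
    have "2 * (\<Sum>\<xi>\<in>E. \<Sum>\<eta>\<in>E. ?f \<xi> \<eta>) = (\<Sum>\<xi>\<in>E. \<Sum>\<eta>\<in>E. ?f \<xi> \<eta>) + (\<Sum>\<xi>\<in>E. \<Sum>\<eta>\<in>E. ?f \<eta> \<xi>)"
      using sum.swap[of ?f E E] by simp
    also have "\<dots> = (\<Sum>\<xi>\<in>E. \<Sum>\<eta>\<in>E. 2 * (((?p \<xi> \<eta> + ?p \<eta> \<xi>) / 2)\<^sup>2 - 3/4 * (?p \<xi> \<eta> - ?p \<eta> \<xi>)\<^sup>2))"
      unfolding sum.distrib[symmetric] by (intro sum.cong refl) (simp add: power2_eq_square field_simps)
    also have "\<dots> = 2 * (S2 x - 3/4 * A2 x)"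
      unfolding u2_diff[OF x] S2_def A2_def by (simp add: sum_subtractf sum_distrib_left)
    finally show ?thesis by simp
  qed
  finally show ?thesis by simp
qed

section \<open>The Rellich field: components and divergence\<close>

definition R :: "'a \<Rightarrow> 'a \<Rightarrow> real" where "R \<xi> x = (x \<bullet> \<xi>) * N2 x - 2 * (Zu x * u1 \<xi> x)"
definition R' :: "'a \<Rightarrow> 'a \<Rightarrow> real" where
  "R' \<xi> x = N2 x + 2 * (\<Sum>\<eta>\<in>E. u2 \<xi> \<eta> x * u1 \<eta> x) * (x \<bullet> \<xi>)
     - 2 * ((D2 x (lf \<xi> x) (Zfield G x) + D x (\<xi> + br x \<xi>)) * u1 \<xi> x + u2 \<xi> \<xi> x * Zu x)"
text \<open>The gradient term of the field is horizontal, so the vertical components come from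
  \<open>N2\<close> times the dilation field alone, whose coefficient along k is twice the
  coordinate.\<close>

definition Rv :: "'a \<Rightarrow> 'a \<Rightarrow> real" where "Rv k x = 2 * ((x \<bullet> k) * N2 x)"
definition Rv' :: "'a \<Rightarrow> 'a \<Rightarrow> real" where
  "Rv' k x = 2 * (N2 x + 2 * (\<Sum>\<eta>\<in>E. u2 k \<eta> x * u1 \<eta> x) * (x \<bullet> k))"

lemma X_coord: "has_X \<xi> (\<lambda>x. x \<bullet> \<eta>) (lf \<xi> x \<bullet> \<eta>) x"
  by (rule has_X_has_derivative[where D="\<lambda>h. h \<bullet> \<eta>"]) (auto intro!: derivative_eq_intros)

lemma X_N2: assumes "x \<in> \<Omega>" shows "has_X \<xi> N2 (2 * (\<Sum>\<eta>\<in>E. u2 \<xi> \<eta> x * u1 \<eta> x)) x"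
proof -
  have "has_X \<xi> (\<lambda>x. \<Sum>\<eta>\<in>E. u1 \<eta> x * u1 \<eta> x) (\<Sum>\<eta>\<in>E. u2 \<xi> \<eta> x * u1 \<eta> x + u2 \<xi> \<eta> x * u1 \<eta> x) x"
    by (intro has_X_sum has_X_mult X_u1 assms)
  then show ?thesis by (simp add: N2_def[abs_def] power2_eq_square sum_distrib_left mult_ac)
qed

lemma Z_lf: "Zfield G (lf \<xi> x) = hproj \<xi> + 2 *\<^sub>R (\<xi> - hproj \<xi>) + br x \<xi>"
  by (simp add: Zfield_eq lf_def linear_add[OF linear_hproj] linear_scale[OF linear_hproj] hproj_V2 br_in_V2 algebra_simps)

lemma X_Zu: assumes "x \<in> \<Omega>" "\<xi> \<in> E"
  shows "has_X \<xi> Zu (D2 x (lf \<xi> x) (Zfield G x) + D x (\<xi> + br x \<xi>)) x"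
proof -
  have "(Zfield G has_derivative Zfield G) (at x)"
    by (rule bounded_linear_imp_has_derivative[OF Zfield_bounded_linear])
  from has_X_has_derivative[OF bounded_bilinear.FDERIV[OF bounded_bilinear_blinfun_apply D[OF assms(1)] this], of \<xi>]
  have "has_X \<xi> Zu (D x (Zfield G (lf \<xi> x)) + D2 x (lf \<xi> x) (Zfield G x)) x"
    by (simp add: Zu_def[abs_def])
  then show ?thesis using frame_expand[OF E_V1[OF assms(2)]] by (simp add: Z_lf add.commute)
qed

lemma R_regular: assumes "\<xi> \<in> E" shows "X_regular \<Omega> \<xi> (R \<xi>) (R' \<xi>)"
  unfolding X_regular_def
proof (intro conjI ballI)
  show "continuous_on (closure \<Omega>) (R \<xi>)" unfolding R_def[abs_def]
    by (intro continuous_intros cont_ops cu1)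
  have "continuous_on (closure \<Omega>) (\<lambda>x. br x \<xi>)"
    using bounded_linear_br_left by (rule linear_continuous_on)
  then show "continuous_on (closure \<Omega>) (R' \<xi>)" unfolding R'_def[abs_def]
    by (intro continuous_intros cont_ops cu1 cu2 blinfun.continuous_on cD cD2 cZ)
  fix g assume g: "g \<in> \<Omega>"
  have "has_X \<xi> (R \<xi>) (((lf \<xi> g \<bullet> \<xi>) * N2 g + 2 * (\<Sum>\<eta>\<in>E. u2 \<xi> \<eta> g * u1 \<eta> g) * (g \<bullet> \<xi>))
     - 2 * ((D2 g (lf \<xi> g) (Zfield G g) + D g (\<xi> + br g \<xi>)) * u1 \<xi> g + u2 \<xi> \<xi> g * Zu g)) g"
    unfolding R_def[abs_def] by (intro has_X_diff has_X_cmult has_X_mult X_coord X_N2 X_Zu X_u1 g assms)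
  then show "has_X \<xi> (R \<xi>) (R' \<xi> g) g" by (simp add: R'_def lf_inner_E[OF assms])
qed

lemma Rv_regular: assumes "k \<in> B" shows "X_regular \<Omega> k (Rv k) (Rv' k)"
  unfolding X_regular_def
proof (intro conjI ballI)
  show "continuous_on (closure \<Omega>) (Rv k)" unfolding Rv_def[abs_def]
    by (intro continuous_intros cont_ops)
  show "continuous_on (closure \<Omega>) (Rv' k)" unfolding Rv'_def[abs_def]
    by (intro continuous_intros cont_ops cu1 cu2)
  fix g assume g: "g \<in> \<Omega>"
  have k: "lf k g \<bullet> k = 1" using B assms by auto
  have "has_X k (Rv k) (2 * ((lf k g \<bullet> k) * N2 g + 2 * (\<Sum>\<eta>\<in>E. u2 k \<eta> g * u1 \<eta> g) * (g \<bullet> k))) g"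
    unfolding Rv_def[abs_def] by (intro has_X_cmult has_X_mult X_coord X_N2 g)
  then show "has_X k (Rv k) (Rv' k g) g" unfolding k by (simp add: Rv'_def)
qed

text \<open>The divergence of the dilation field is the homogeneous dimension
  \<open>card E + 2 * card B\<close>. The Hessian terms from differentiating \<open>N2\<close> and
  \<open>Zu\<close> cancel except for the commutator of X_\<eta> with the dilation field, which is
  X_\<eta> itself and produces the -2.\<close>

lemma R_divergence: assumes x: "x \<in> \<Omega>"
  shows "(\<Sum>\<xi>\<in>E. R' \<xi> x) + (\<Sum>k\<in>B. Rv' k x) = (real (card E) + 2 * real (card B) - 2) * N2 x - 2 * (Zu x * L x)"
proof -
  let ?Z = "Zfield G x"
  have lfk: "lf k y = k" if "k \<in> B" for k y using B(2) that by auto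
  have Zdec: "?Z = (\<Sum>\<xi>\<in>E. (x \<bullet> \<xi>) *\<^sub>R lf \<xi> x) + 2 *\<^sub>R (\<Sum>k\<in>B. (x \<bullet> k) *\<^sub>R k)"
    unfolding B_expand lf_sum[symmetric] hproj_E[symmetric] by (simp add: Zfield_eq lf_def)
  \<comment> \<open>Both sides are the dilation field applied to X_\<eta> u, the left one in frame
    components.\<close>
  have A: "(\<Sum>\<xi>\<in>E. (x \<bullet> \<xi>) * u2 \<xi> \<eta> x) + 2 * (\<Sum>k\<in>B. (x \<bullet> k) * u2 k \<eta> x)
      = D2 x (lf \<eta> x) ?Z + (1/2) * D x (br x \<eta>)" for \<eta>
  proof -
    have k: "u2 k \<eta> x = D2 x k (lf \<eta> x)" if "k \<in> B" for k
      using B(2) that lfk[OF that] by (auto simp: u2_def blinfun.zero_right)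
    have "br x \<eta> = br (hproj x) \<eta>" by simp
    also have "\<dots> = (\<Sum>\<xi>\<in>E. (x \<bullet> \<xi>) *\<^sub>R br \<xi> \<eta>)"
      unfolding hproj_E linear_sum[OF linear_br_left] by simp
    finally have b: "D x (br x \<eta>) = (\<Sum>\<xi>\<in>E. (x \<bullet> \<xi>) * D x (br \<xi> \<eta>))"
      by (simp add: blinfun.sum_right blinfun.scaleR_right)
    have "D2 x (lf \<eta> x) ?Z = D2 x ?Z (lf \<eta> x)" by (rule sym[OF x])
    also have "\<dots> = (\<Sum>\<xi>\<in>E. (x \<bullet> \<xi>) * D2 x (lf \<xi> x) (lf \<eta> x)) + 2 * (\<Sum>k\<in>B. (x \<bullet> k) * D2 x k (lf \<eta> x))"
      unfolding Zdec by (simp add: blinfun.sum_right blinfun.scaleR_right blinfun.add_right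
          blinfun.sum_left blinfun.scaleR_left blinfun.add_left)
    finally have 1: "D2 x (lf \<eta> x) ?Z = (\<Sum>\<xi>\<in>E. (x \<bullet> \<xi>) * D2 x (lf \<xi> x) (lf \<eta> x)) + 2 * (\<Sum>k\<in>B. (x \<bullet> k) * D2 x k (lf \<eta> x))" .
    have 2: "(\<Sum>k\<in>B. (x \<bullet> k) * u2 k \<eta> x) = (\<Sum>k\<in>B. (x \<bullet> k) * D2 x k (lf \<eta> x))"
      by (intro sum.cong refl) (simp add: k)
    have 3: "(\<Sum>\<xi>\<in>E. (x \<bullet> \<xi>) * u2 \<xi> \<eta> x) = (\<Sum>\<xi>\<in>E. (x \<bullet> \<xi>) * D2 x (lf \<xi> x) (lf \<eta> x)) + (1/2) * (\<Sum>\<xi>\<in>E. (x \<bullet> \<xi>) * D x (br \<xi> \<eta>))"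
      unfolding sum_distrib_left sum.distrib[symmetric] by (intro sum.cong refl) (simp add: u2_def algebra_simps)
    show ?thesis unfolding 1 2 3 b by simp
  qed
  have "(\<Sum>\<xi>\<in>E. R' \<xi> x) = real (card E) * N2 x + 2 * (\<Sum>\<xi>\<in>E. \<Sum>\<eta>\<in>E. (x \<bullet> \<xi>) * u2 \<xi> \<eta> x * u1 \<eta> x)
     - 2 * ((\<Sum>\<eta>\<in>E. (D2 x (lf \<eta> x) ?Z + D x (\<eta> + br x \<eta>)) * u1 \<eta> x) + L x * Zu x)"
    unfolding R'_def L_def
    by (simp add: sum.distrib sum_subtractf sum_distrib_left sum_distrib_right mult_ac)
  moreover have "(\<Sum>k\<in>B. Rv' k x) = 2 * real (card B) * N2 x + 4 * (\<Sum>k\<in>B. \<Sum>\<eta>\<in>E. (x \<bullet> k) * u2 k \<eta> x * u1 \<eta> x)"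
    unfolding Rv'_def
    by (simp add: sum.distrib sum_distrib_left sum_distrib_right mult_ac)
  moreover have "2 * (\<Sum>\<xi>\<in>E. \<Sum>\<eta>\<in>E. (x \<bullet> \<xi>) * u2 \<xi> \<eta> x * u1 \<eta> x) + 4 * (\<Sum>k\<in>B. \<Sum>\<eta>\<in>E. (x \<bullet> k) * u2 k \<eta> x * u1 \<eta> x)
      = 2 * (\<Sum>\<eta>\<in>E. (D2 x (lf \<eta> x) ?Z + (1/2) * D x (br x \<eta>)) * u1 \<eta> x)"
  proof -
    have "(\<Sum>\<xi>\<in>E. \<Sum>\<eta>\<in>E. (x \<bullet> \<xi>) * u2 \<xi> \<eta> x * u1 \<eta> x) + 2 * (\<Sum>k\<in>B. \<Sum>\<eta>\<in>E. (x \<bullet> k) * u2 k \<eta> x * u1 \<eta> x)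
       = (\<Sum>\<eta>\<in>E. \<Sum>\<xi>\<in>E. (x \<bullet> \<xi>) * u2 \<xi> \<eta> x * u1 \<eta> x) + 2 * (\<Sum>\<eta>\<in>E. \<Sum>k\<in>B. (x \<bullet> k) * u2 k \<eta> x * u1 \<eta> x)"
      by (intro arg_cong2[where f="(+)"] arg_cong2[where f="(*)"] refl sum.swap)
    also have "\<dots> = (\<Sum>\<eta>\<in>E. ((\<Sum>\<xi>\<in>E. (x \<bullet> \<xi>) * u2 \<xi> \<eta> x) + 2 * (\<Sum>k\<in>B. (x \<bullet> k) * u2 k \<eta> x)) * u1 \<eta> x)"
      by (simp add: sum.distrib sum_distrib_left sum_distrib_right algebra_simps)
    finally show ?thesis unfolding A by simp
  qed
  \<comment> \<open>X_\<eta> applied to \<open>Zu\<close> exceeds the dilation field applied to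
    X_\<eta> u by X_\<eta> u, since \<open>\<eta> + (1/2) *\<^sub>R br x \<eta>\<close> is
    \<open>lf \<eta> x\<close>.\<close>
  moreover have "(\<Sum>\<eta>\<in>E. (D2 x (lf \<eta> x) ?Z + D x (\<eta> + br x \<eta>)) * u1 \<eta> x)
      = (\<Sum>\<eta>\<in>E. (D2 x (lf \<eta> x) ?Z + (1/2) * D x (br x \<eta>)) * u1 \<eta> x) + N2 x"
    unfolding N2_def sum.distrib[symmetric]
    by (intro sum.cong refl)
       (simp add: u1_def lf_def blinfun.add_right blinfun.scaleR_right power2_eq_square algebra_simps)
  ultimately show ?thesis by (simp add: algebra_simps)
qed

text \<open>Both u and \<open>\<phi>\<close> vanish on the boundary, so \<open>D p\<close> is a
  multiple of the conormal. With this multiple k frozen, u - k \<open>\<phi>\<close> vanishes there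
  too and has zero differential at p, so the second-order lemma applies to it. Up to normalisation k
  is the normal derivative of u.\<close>

lemma boundary_values:
  assumes p: "p \<in> frontier \<Omega>" and dd: "defining_derivs \<Omega> U \<phi> Dp D2p" and pU: "p \<in> U" "\<phi> p = 0"
  obtains k where "D p = k *\<^sub>R Dp p" "\<forall>a. Dp p a = 0 \<longrightarrow> D2 p a a = k * D2p p a a"
proof -
  note oU = defining_derivsD(1)[OF dd] and cDp = defining_derivsD(2)[OF dd] and cD2p = defining_derivsD(3)[OF dd]
    and c\<phi> = defining_derivsD(4)[OF dd] and \<phi> = defining_derivsD(5)[OF dd] and D2p = defining_derivsD(6)[OF dd]
  obtain n where n: "Dp p n = -1" by (rule blinfun_normalized_direction[OF defining_derivsD(7)[OF dd pU(1)]])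
  have "bounded (D ` closure \<Omega>)"
    using bdd by (intro compact_imp_bounded compact_continuous_image cD) simp
  then obtain M where M: "\<forall>y\<in>D ` closure \<Omega>. norm y \<le> M" unfolding bounded_iff ..
  have ker: "D p a = 0" if a: "Dp p a = 0" for a
  proof (rule boundary_first_order[OF op dd pU(1) p pU(2) a, where w=u])
    show "continuous_on (closure \<Omega> \<inter> U) u" "continuous_on (closure \<Omega> \<inter> U) D"
      using cu cD by (auto intro: continuous_on_subset)
    show "norm (D x) \<le> M" if "x \<in> \<Omega> \<inter> U" for x
      using M closure_subset[of \<Omega>] that by blast
  qed (use u u0 in auto)
  have k: "D p = (- D p n) *\<^sub>R Dp p" by (rule blinfun_proportional[OF n ker])
  define k where "k = - D p n"
  have "D2 p a a = k * D2p p a a" if a: "Dp p a = 0" for a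
  proof -
    have "(D2 p - k *\<^sub>R D2p p) a a = 0"
    proof (rule boundary_second_order[OF op dd pU(1) p pU(2) a, where w="\<lambda>x. u x - k * \<phi> x" and Dw="\<lambda>x. D x - k *\<^sub>R Dp x"
          and D2w="\<lambda>x. D2 x - k *\<^sub>R D2p x"])
      fix x assume x: "x \<in> \<Omega> \<inter> U"
      then have x': "x \<in> \<Omega>" "x \<in> U" by auto
      show "((\<lambda>x. u x - k * \<phi> x) has_derivative blinfun_apply (D x - k *\<^sub>R Dp x)) (at x)"
        by (rule has_derivative_eq_rhs[OF has_derivative_diff[OF u[OF x'(1)] has_derivative_mult_right[OF \<phi>[OF x'(2)]]]])
           (simp add: fun_eq_iff blinfun.diff_left blinfun.scaleR_left)
      show "((\<lambda>x. D x - k *\<^sub>R Dp x) has_derivative blinfun_apply (D2 x - k *\<^sub>R D2p x)) (at x)"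
        by (rule has_derivative_eq_rhs[OF has_derivative_diff[OF D[OF x'(1)] has_derivative_scaleR_right[OF D2p[OF x'(2)]]]])
           (simp add: fun_eq_iff blinfun.diff_left blinfun.scaleR_left)
    next
      have s: "closure \<Omega> \<inter> U \<subseteq> closure \<Omega>" "closure \<Omega> \<inter> U \<subseteq> U" by auto
      show "continuous_on (closure \<Omega> \<inter> U) (\<lambda>x. u x - k * \<phi> x)"
        by (intro continuous_intros continuous_on_subset[OF cu s(1)] continuous_on_subset[OF c\<phi> s(2)])
      show "continuous_on (closure \<Omega> \<inter> U) (\<lambda>x. D x - k *\<^sub>R Dp x)"
        by (intro continuous_intros continuous_on_subset[OF cD s(1)] continuous_on_subset[OF cDp s(2)])
      show "continuous_on (closure \<Omega> \<inter> U) (\<lambda>x. D2 x - k *\<^sub>R D2p x)"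
        by (intro continuous_intros continuous_on_subset[OF cD2 s(1)] continuous_on_subset[OF cD2p s(2)])
      show "D p - k *\<^sub>R Dp p = 0" using k by (simp add: k_def)
    next
      fix x assume x: "x \<in> frontier \<Omega> \<inter> U"
      have "\<phi> x = 0"
        by (rule local_defining_frontier_eq_0[OF op defining_derivs_local[OF dd]]) (use x in auto)
      then show "u x - k * \<phi> x = 0" using u0 x by simp
    qed
    then show ?thesis by (simp add: blinfun.diff_left blinfun.scaleR_left)
  qed
  then show ?thesis using k by (intro that[of k]) (simp_all add: k_def)
qed

section \<open>The combined field and its boundary flux\<close>

definition Y :: "real \<Rightarrow> 'a \<Rightarrow> 'a \<Rightarrow> real" where
  "Y K \<xi> x = (if \<xi> \<in> E then F \<xi> x + K * R \<xi> x else K * Rv \<xi> x)"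
definition Y' :: "real \<Rightarrow> 'a \<Rightarrow> 'a \<Rightarrow> real" where
  "Y' K \<xi> x = (if \<xi> \<in> E then F' \<xi> x + K * R' \<xi> x else K * Rv' \<xi> x)"

lemma E_B_disjoint: "E \<inter> B = {}"
proof -
  have "\<xi> \<notin> B" if "\<xi> \<in> E" for \<xi>
  proof
    assume "\<xi> \<in> B"
    then have "\<xi> \<bullet> \<xi> = 0" using V1_V2_orth[OF E_V1[OF that], of \<xi>] B(2) by auto
    then show False using E_norm[OF that] by simp
  qed
  then show ?thesis by blast
qed

lemma sum_frame_B: "(\<Sum>\<xi>\<in>E \<union> B. if \<xi> \<in> E then f \<xi> else g \<xi>) = (\<Sum>\<xi>\<in>E. f \<xi>) + (\<Sum>\<xi>\<in>B. g \<xi>)"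
proof -
  have "(\<Sum>\<xi>\<in>E \<union> B. if \<xi> \<in> E then f \<xi> else g \<xi>)
     = (\<Sum>\<xi>\<in>E. if \<xi> \<in> E then f \<xi> else g \<xi>) + (\<Sum>\<xi>\<in>B. if \<xi> \<in> E then f \<xi> else g \<xi>)"
    by (rule sum.union_disjoint) (use B(1) E_B_disjoint in auto)
  also have "(\<Sum>\<xi>\<in>B. if \<xi> \<in> E then f \<xi> else g \<xi>) = (\<Sum>\<xi>\<in>B. g \<xi>)"
    by (intro sum.cong refl if_not_P) (use E_B_disjoint in blast)
  finally show ?thesis by simp
qed

lemma span_frame_B: "span (E \<union> B) = UNIV"
proof -
  have "x \<in> span (E \<union> B)" for x
  proof -
    have "x = (\<Sum>\<xi>\<in>E. (x \<bullet> \<xi>) *\<^sub>R \<xi>) + (\<Sum>k\<in>B. (x \<bullet> k) *\<^sub>R k)"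
      unfolding B_expand hproj_E[symmetric] by simp
    also have "\<dots> \<in> span (E \<union> B)"
      by (intro span_add span_sum span_scale span_base) auto
    finally show ?thesis .
  qed
  then show ?thesis by blast
qed

lemma X_regular_add_mult:
  assumes "X_regular \<Omega> \<xi> f f'" "X_regular \<Omega> \<xi> g g'"
  shows "X_regular \<Omega> \<xi> (\<lambda>x. f x + c * g x) (\<lambda>x. f' x + c * g' x)"
  using X_regularD[OF assms(1)] X_regularD[OF assms(2)] unfolding X_regular_def
  by (intro conjI ballI continuous_intros has_X_add has_X_cmult) auto

lemma X_regular_zero: "X_regular \<Omega> \<xi> (\<lambda>x. 0) (\<lambda>x. 0)"
  unfolding X_regular_def by (simp add: has_X_const)

lemma Y_regular: "\<xi> \<in> E \<union> B \<Longrightarrow> X_regular \<Omega> \<xi> (Y K \<xi>) (Y' K \<xi>)"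
  using X_regular_add_mult[OF F_regular R_regular, of \<xi> K] X_regular_add_mult[OF X_regular_zero Rv_regular, of \<xi> K]
  by (cases "\<xi> \<in> E") (simp_all add: Y_def[abs_def] Y'_def[abs_def])

text \<open>When n is the horizontal conormal and \<open>X\<close> the frame, the vectors
  \<open>n \<xi> *\<^sub>R X \<eta> - n \<eta> *\<^sub>R X \<xi>\<close> are tangent to the
  boundary. The curvature numerator is thus determined by second derivatives on tangent vectors,
  which is all that \<open>boundary_values\<close> provides.\<close>

lemma tangential_trace:
  fixes b :: "'a \<Rightarrow>\<^sub>L 'a \<Rightarrow>\<^sub>L real" and n :: "'a \<Rightarrow> real" and X :: "'a \<Rightarrow> 'a"
  shows "(\<Sum>\<xi>\<in>E. \<Sum>\<eta>\<in>E. b (n \<xi> *\<^sub>R X \<eta> - n \<eta> *\<^sub>R X \<xi>) (n \<xi> *\<^sub>R X \<eta> - n \<eta> *\<^sub>R X \<xi>))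
    = 2 * ((\<Sum>\<xi>\<in>E. (n \<xi>)\<^sup>2) * (\<Sum>\<xi>\<in>E. b (X \<xi>) (X \<xi>)) - (\<Sum>\<xi>\<in>E. \<Sum>\<eta>\<in>E. n \<xi> * n \<eta> * b (X \<xi>) (X \<eta>)))"
proof -
  let ?d = "\<lambda>\<xi> \<eta>. (n \<xi>)\<^sup>2 * b (X \<eta>) (X \<eta>)" and ?m = "\<lambda>\<xi> \<eta>. n \<xi> * n \<eta> * b (X \<xi>) (X \<eta>)"
  have "b (n \<xi> *\<^sub>R X \<eta> - n \<eta> *\<^sub>R X \<xi>) (n \<xi> *\<^sub>R X \<eta> - n \<eta> *\<^sub>R X \<xi>)
     = ?d \<xi> \<eta> + ?d \<eta> \<xi> - ?m \<xi> \<eta> - ?m \<eta> \<xi>" for \<xi> \<eta>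
    by (simp add: blinfun.diff_right blinfun.diff_left blinfun.scaleR_left blinfun.scaleR_right power2_eq_square algebra_simps)
  then have "(\<Sum>\<xi>\<in>E. \<Sum>\<eta>\<in>E. b (n \<xi> *\<^sub>R X \<eta> - n \<eta> *\<^sub>R X \<xi>) (n \<xi> *\<^sub>R X \<eta> - n \<eta> *\<^sub>R X \<xi>))
     = (\<Sum>\<xi>\<in>E. \<Sum>\<eta>\<in>E. ?d \<xi> \<eta>) + (\<Sum>\<xi>\<in>E. \<Sum>\<eta>\<in>E. ?d \<eta> \<xi>) - (\<Sum>\<xi>\<in>E. \<Sum>\<eta>\<in>E. ?m \<xi> \<eta>) - (\<Sum>\<xi>\<in>E. \<Sum>\<eta>\<in>E. ?m \<eta> \<xi>)"
    by (simp only: sum.distrib sum_subtractf)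
  also have "(\<Sum>\<xi>\<in>E. \<Sum>\<eta>\<in>E. ?d \<eta> \<xi>) = (\<Sum>\<xi>\<in>E. \<Sum>\<eta>\<in>E. ?d \<xi> \<eta>)" by (rule sum.swap)
  also have "(\<Sum>\<xi>\<in>E. \<Sum>\<eta>\<in>E. ?m \<eta> \<xi>) = (\<Sum>\<xi>\<in>E. \<Sum>\<eta>\<in>E. ?m \<xi> \<eta>)" by (rule sum.swap)
  also have "(\<Sum>\<xi>\<in>E. \<Sum>\<eta>\<in>E. ?d \<xi> \<eta>) = (\<Sum>\<xi>\<in>E. (n \<xi>)\<^sup>2) * (\<Sum>\<xi>\<in>E. b (X \<xi>) (X \<xi>))" by (simp add: sum_product)
  finally show ?thesis by simp
qed

lemma hcurv_num_E:
  "hcurv_num D1 D2' p = (\<Sum>\<xi>\<in>E. (D1 (lf \<xi> p))\<^sup>2) * (\<Sum>\<xi>\<in>E. D2' (lf \<xi> p) (lf \<xi> p))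
     - (\<Sum>\<xi>\<in>E. \<Sum>\<eta>\<in>E. D1 (lf \<xi> p) * D1 (lf \<eta> p) * D2' (lf \<xi> p) (lf \<eta> p))"
  unfolding hcurv_num_def hnu_def
  by (simp only: sum_frame[of "\<lambda>\<xi>. (D1 (lf \<xi> p))\<^sup>2"] sum_frame[of "\<lambda>\<xi>. D2' (lf \<xi> p) (lf \<xi> p)"]
      sum_frame[of "\<lambda>\<eta>. D1 (lf _ p) * D1 (lf \<eta> p) * D2' (lf _ p) (lf \<eta> p)"]
      sum_frame[of "\<lambda>\<xi>. \<Sum>\<eta>\<in>E. D1 (lf \<xi> p) * D1 (lf \<eta> p) * D2' (lf \<xi> p) (lf \<eta> p)"])

text \<open>As the gradient is k times the conormal, the flux is a double sum with symmetric
  coefficients: the weights 2 and -1 add up to 1, and brackets drop out by antisymmetry. This is the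
  curvature numerator formed with \<open>D2 p\<close>, which the tangential trace exchanges for k
  times \<open>D2p\<close>.\<close>

lemma flux_F:
  fixes Dp :: "'a \<Rightarrow>\<^sub>L real" and D2p :: "'a \<Rightarrow>\<^sub>L 'a \<Rightarrow>\<^sub>L real"
  assumes k: "D p = k *\<^sub>R Dp" and tan: "\<And>a. Dp a = 0 \<Longrightarrow> D2 p a a = k * D2p a a"
  shows "(\<Sum>\<xi>\<in>E. F \<xi> p * Dp (lf \<xi> p)) = k\<^sup>2 * hcurv_num Dp D2p p"
proof -
  define n where "n \<xi> = Dp (lf \<xi> p)" for \<xi>
  have u1: "u1 \<xi> p = k * n \<xi>" for \<xi> by (simp add: u1_def k n_def blinfun.scaleR_left)
  have L: "L p = (\<Sum>\<xi>\<in>E. D2 p (lf \<xi> p) (lf \<xi> p))" by (simp add: L_def u2_def blinfun.zero_right)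
  let ?q = "\<lambda>\<xi> \<eta>. n \<xi> * n \<eta> * u2 \<xi> \<eta> p"
  have anti: "(\<Sum>\<xi>\<in>E. \<Sum>\<eta>\<in>E. n \<xi> * n \<eta> * D p (br \<xi> \<eta>)) = 0"
  proof -
    have "(\<Sum>\<xi>\<in>E. \<Sum>\<eta>\<in>E. n \<xi> * n \<eta> * D p (br \<xi> \<eta>)) = (\<Sum>\<xi>\<in>E. \<Sum>\<eta>\<in>E. n \<eta> * n \<xi> * D p (br \<eta> \<xi>))" by (rule sum.swap)
    also have "\<dots> = (\<Sum>\<xi>\<in>E. \<Sum>\<eta>\<in>E. - (n \<xi> * n \<eta> * D p (br \<xi> \<eta>)))"
    proof (intro sum.cong refl)
      fix \<xi> \<eta> show "n \<eta> * n \<xi> * D p (br \<eta> \<xi>) = - (n \<xi> * n \<eta> * D p (br \<xi> \<eta>))"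
        unfolding br_antisym[of \<eta> \<xi>] by (simp add: blinfun.minus_right)
    qed
    finally show ?thesis by (simp add: sum_negf)
  qed
  have q: "(\<Sum>\<xi>\<in>E. \<Sum>\<eta>\<in>E. ?q \<xi> \<eta>) = (\<Sum>\<xi>\<in>E. \<Sum>\<eta>\<in>E. n \<xi> * n \<eta> * D2 p (lf \<xi> p) (lf \<eta> p))"
  proof -
    have "(\<Sum>\<xi>\<in>E. \<Sum>\<eta>\<in>E. ?q \<xi> \<eta>) = (\<Sum>\<xi>\<in>E. \<Sum>\<eta>\<in>E. n \<xi> * n \<eta> * D2 p (lf \<xi> p) (lf \<eta> p))
      + (1/2) * (\<Sum>\<xi>\<in>E. \<Sum>\<eta>\<in>E. n \<xi> * n \<eta> * D p (br \<xi> \<eta>))"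
      unfolding sum_distrib_left sum.distrib[symmetric] by (intro sum.cong refl) (simp add: u2_def algebra_simps)
    then show ?thesis unfolding anti by simp
  qed
  have "(\<Sum>\<xi>\<in>E. F \<xi> p * Dp (lf \<xi> p)) = k * ((\<Sum>\<xi>\<in>E. (n \<xi>)\<^sup>2) * L p - 2 * (\<Sum>\<xi>\<in>E. \<Sum>\<eta>\<in>E. ?q \<eta> \<xi>) + (\<Sum>\<xi>\<in>E. \<Sum>\<eta>\<in>E. ?q \<xi> \<eta>))"
    unfolding F_def u1 n_def[symmetric]
    by (simp add: sum_distrib_left sum_distrib_right sum_subtractf sum.distrib algebra_simps power2_eq_square)
  also have "(\<Sum>\<xi>\<in>E. \<Sum>\<eta>\<in>E. ?q \<eta> \<xi>) = (\<Sum>\<xi>\<in>E. \<Sum>\<eta>\<in>E. ?q \<xi> \<eta>)" by (rule sum.swap)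
  finally have 1: "(\<Sum>\<xi>\<in>E. F \<xi> p * Dp (lf \<xi> p)) = k * ((\<Sum>\<xi>\<in>E. (n \<xi>)\<^sup>2) * L p - (\<Sum>\<xi>\<in>E. \<Sum>\<eta>\<in>E. n \<xi> * n \<eta> * D2 p (lf \<xi> p) (lf \<eta> p)))"
    unfolding q by simp
  let ?t = "\<lambda>\<xi> \<eta>. n \<xi> *\<^sub>R lf \<eta> p - n \<eta> *\<^sub>R lf \<xi> p"
  have "(\<Sum>\<xi>\<in>E. \<Sum>\<eta>\<in>E. D2 p (?t \<xi> \<eta>) (?t \<xi> \<eta>)) = (\<Sum>\<xi>\<in>E. \<Sum>\<eta>\<in>E. k * D2p (?t \<xi> \<eta>) (?t \<xi> \<eta>))"
    by (intro sum.cong refl tan) (simp add: n_def blinfun.diff_right blinfun.scaleR_right)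
  then have "(\<Sum>\<xi>\<in>E. \<Sum>\<eta>\<in>E. D2 p (?t \<xi> \<eta>) (?t \<xi> \<eta>)) = k * (\<Sum>\<xi>\<in>E. \<Sum>\<eta>\<in>E. D2p (?t \<xi> \<eta>) (?t \<xi> \<eta>))"
    by (simp only: sum_distrib_left)
  then have "2 * ((\<Sum>\<xi>\<in>E. (n \<xi>)\<^sup>2) * L p - (\<Sum>\<xi>\<in>E. \<Sum>\<eta>\<in>E. n \<xi> * n \<eta> * D2 p (lf \<xi> p) (lf \<eta> p)))
      = 2 * (k * hcurv_num Dp D2p p)"
    unfolding tangential_trace L hcurv_num_E n_def mult.left_commute[of k 2] .
  then have "(\<Sum>\<xi>\<in>E. (n \<xi>)\<^sup>2) * L p - (\<Sum>\<xi>\<in>E. \<Sum>\<eta>\<in>E. n \<xi> * n \<eta> * D2 p (lf \<xi> p) (lf \<eta> p)) = k * hcurv_num Dp D2p p"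
    by (subst (asm) mult_left_cancel) simp_all
  then show ?thesis unfolding 1 by (simp add: power2_eq_square)
qed

text \<open>With \<open>D p\<close> parallel to \<open>Dp\<close>, both parts of the field
  contribute multiples of the same product, with weights 1 and -2, whence the negative sign.\<close>

lemma flux_R:
  fixes Dp :: "'a \<Rightarrow>\<^sub>L real"
  assumes k: "D p = k *\<^sub>R Dp"
  shows "(\<Sum>\<xi>\<in>E. R \<xi> p * Dp (lf \<xi> p)) + (\<Sum>\<xi>\<in>B. Rv \<xi> p * Dp (lf \<xi> p))
     = - (k\<^sup>2 * (\<Sum>\<xi>\<in>E. (Dp (lf \<xi> p))\<^sup>2) * Dp (Zfield G p))"
proof -
  define n where "n \<xi> = Dp (lf \<xi> p)" for \<xi>
  have u1: "u1 \<xi> p = k * n \<xi>" for \<xi> by (simp add: u1_def k n_def blinfun.scaleR_left)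
  have Zu: "Zu p = k * Dp (Zfield G p)" by (simp add: Zu_def k blinfun.scaleR_left)
  have N: "N2 p = k\<^sup>2 * (\<Sum>\<xi>\<in>E. (n \<xi>)\<^sup>2)" by (simp add: N2_def u1 power_mult_distrib sum_distrib_left)
  have "Zfield G p = (\<Sum>\<xi>\<in>E. (p \<bullet> \<xi>) *\<^sub>R lf \<xi> p) + 2 *\<^sub>R (\<Sum>k\<in>B. (p \<bullet> k) *\<^sub>R k)"
    unfolding B_expand lf_sum[symmetric] hproj_E[symmetric] by (simp add: Zfield_eq lf_def)
  then have Z: "Dp (Zfield G p) = (\<Sum>\<xi>\<in>E. (p \<bullet> \<xi>) * n \<xi>) + 2 * (\<Sum>k\<in>B. (p \<bullet> k) * Dp k)"
    by (simp add: n_def blinfun.add_right blinfun.sum_right blinfun.scaleR_right)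
  have "(\<Sum>\<xi>\<in>E. R \<xi> p * n \<xi>) = (\<Sum>\<xi>\<in>E. (p \<bullet> \<xi>) * n \<xi>) * N2 p - 2 * Zu p * k * (\<Sum>\<xi>\<in>E. (n \<xi>)\<^sup>2)"
    unfolding R_def u1 by (simp add: sum_distrib_left sum_distrib_right sum_subtractf algebra_simps power2_eq_square)
  moreover have "(\<Sum>\<xi>\<in>B. Rv \<xi> p * Dp (lf \<xi> p)) = (\<Sum>\<xi>\<in>B. 2 * N2 p * ((p \<bullet> \<xi>) * Dp \<xi>))"
  proof (intro sum.cong refl)
    fix \<xi> assume "\<xi> \<in> B"
    then have "lf \<xi> p = \<xi>" using B(2) by auto
    then show "Rv \<xi> p * Dp (lf \<xi> p) = 2 * N2 p * ((p \<bullet> \<xi>) * Dp \<xi>)" by (simp add: Rv_def)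
  qed
  moreover have "\<dots> = 2 * N2 p * (\<Sum>\<xi>\<in>B. (p \<bullet> \<xi>) * Dp \<xi>)" by (simp only: sum_distrib_left)
  ultimately have "(\<Sum>\<xi>\<in>E. R \<xi> p * n \<xi>) + (\<Sum>\<xi>\<in>B. Rv \<xi> p * Dp (lf \<xi> p))
     = N2 p * Dp (Zfield G p) - 2 * Zu p * k * (\<Sum>\<xi>\<in>E. (n \<xi>)\<^sup>2)"
    unfolding Z by (simp add: algebra_simps)
  also have "\<dots> = - (k\<^sup>2 * (\<Sum>\<xi>\<in>E. (n \<xi>)\<^sup>2) * Dp (Zfield G p))"
    unfolding N Zu by (simp add: power2_eq_square)
  finally show ?thesis unfolding n_def .
qed

text \<open>
  The sign of a flux does not depend on the defining function, since any two of them have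
  positively proportional differentials on the boundary.
\<close>

lemma inward_fluxI:
  assumes "\<And>p. p \<in> frontier \<Omega> \<Longrightarrow> \<exists>U \<phi> Dp D2p. defining_derivs \<Omega> U \<phi> Dp D2p \<and> p \<in> U \<and> \<phi> p = 0 \<and>
      (\<Sum>\<xi>\<in>S. f \<xi> p * Dp p (lf \<xi> p)) \<le> 0"
  shows "inward_flux \<Omega> S f"
  unfolding inward_flux_def
proof (intro ballI allI impI)
  fix p V \<psi> assume p: "p \<in> frontier \<Omega>" and V: "local_defining \<Omega> p V \<psi>"
  obtain U \<phi> Dp D2p where U: "defining_derivs \<Omega> U \<phi> Dp D2p" "p \<in> U" "\<phi> p = 0"
    and le: "(\<Sum>\<xi>\<in>S. f \<xi> p * Dp p (lf \<xi> p)) \<le> 0"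
    using assms[OF p] by (elim exE conjE) (rule that)
  obtain D' D2' where D': "p \<in> V" "defining_derivs \<Omega> V \<psi> D' D2'" by (rule local_defining_derivs[OF V])
  obtain k where k: "k > 0" "D' p = k *\<^sub>R Dp p"
    by (rule defining_derivs_proportional[OF U(1) D'(2) U(2) D'(1) U(3) local_defining_frontier_eq_0[OF op V p]])
  have "(\<Sum>\<xi>\<in>S. f \<xi> p * frechet_derivative \<psi> (at p) (lf \<xi> p)) = k * (\<Sum>\<xi>\<in>S. f \<xi> p * Dp p (lf \<xi> p))"
    unfolding defining_derivsD(9)[OF D'(2,1)] k(2) by (simp add: blinfun.scaleR_left sum_distrib_left mult_ac)
  also have "\<dots> \<le> 0" using k(1) le by (rule mult_nonneg_nonpos[OF less_imp_le])
  finally show "(\<Sum>\<xi>\<in>S. f \<xi> p * frechet_derivative \<psi> (at p) (lf \<xi> p)) \<le> 0" .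
qed

lemma Y_flux:
  assumes M: "M > 0" and \<alpha>: "\<alpha> > 0"
    and H: "(SUP g\<in>Hcurv_dom G \<Omega>. ereal \<bar>Hcurv G \<Omega> g\<bar>) \<le> ereal M"
    and Z: "\<forall>g\<in>frontier \<Omega>. riem G g (Zfield G g) (outer_normal G \<Omega> g) \<ge> \<alpha> * angle_fun G \<Omega> g"
  shows "inward_flux \<Omega> (E \<union> B) (Y (M / \<alpha>))"
proof (rule inward_fluxI)
  fix p assume p: "p \<in> frontier \<Omega>"
  obtain U \<phi> Dp D2p where U: "local_defining \<Omega> p U \<phi>" "defining_derivs \<Omega> U \<phi> Dp D2p" "p \<in> U" "\<phi> p = 0"
    and h: "hcurv_num (Dp p) (D2p p) p \<le> M * (sqrt (\<Sum>i\<in>I. (hnu (Dp p) p i)\<^sup>2)) ^ 3"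
    and z: "\<alpha> * sqrt (\<Sum>i\<in>I. (hnu (Dp p) p i)\<^sup>2) \<le> Dp p (Zfield G p)"
    by (rule hcurv_num_bound[OF C2\<Omega> H Z p])
  obtain k where k: "D p = k *\<^sub>R Dp p" "\<forall>a. Dp p a = 0 \<longrightarrow> D2 p a a = k * D2p p a a"
    by (rule boundary_values[OF p U(2,3,4)])
  have fF: "(\<Sum>\<xi>\<in>E. F \<xi> p * Dp p (lf \<xi> p)) = k\<^sup>2 * hcurv_num (Dp p) (D2p p) p"
    by (rule flux_F[OF k(1)]) (use k(2) in simp)
  define q where "q = (\<Sum>\<xi>\<in>E. (Dp p (lf \<xi> p))\<^sup>2)"
  have q: "(\<Sum>i\<in>I. (hnu (Dp p) p i)\<^sup>2) = q" unfolding q_def hnu_def by (rule sum_frame)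
  have q0: "q \<ge> 0" by (simp add: q_def sum_nonneg)
  have "(\<Sum>\<xi>\<in>E \<union> B. Y (M / \<alpha>) \<xi> p * Dp p (lf \<xi> p))
     = (\<Sum>\<xi>\<in>E \<union> B. if \<xi> \<in> E then (F \<xi> p + M / \<alpha> * R \<xi> p) * Dp p (lf \<xi> p) else M / \<alpha> * Rv \<xi> p * Dp p (lf \<xi> p))"
    unfolding Y_def by (intro sum.cong refl) simp
  also have "\<dots> = (\<Sum>\<xi>\<in>E. (F \<xi> p + M / \<alpha> * R \<xi> p) * Dp p (lf \<xi> p)) + (\<Sum>\<xi>\<in>B. M / \<alpha> * Rv \<xi> p * Dp p (lf \<xi> p))"
    by (rule sum_frame_B)
  also have "\<dots> = (\<Sum>\<xi>\<in>E. F \<xi> p * Dp p (lf \<xi> p)) + M / \<alpha> * ((\<Sum>\<xi>\<in>E. R \<xi> p * Dp p (lf \<xi> p)) + (\<Sum>\<xi>\<in>B. Rv \<xi> p * Dp p (lf \<xi> p)))"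
    by (simp only: distrib_right distrib_left sum.distrib sum_distrib_left mult.assoc add.assoc)
  also have "\<dots> = k\<^sup>2 * hcurv_num (Dp p) (D2p p) p + M / \<alpha> * - (k\<^sup>2 * q * Dp p (Zfield G p))"
    unfolding fF flux_R[OF k(1)] q_def ..
  \<comment> \<open>Both bounds are M times \<open>k\<^sup>2 * sqrt q ^ 3\<close> in size; the
    weight \<open>M / \<alpha>\<close> is the value at which they cancel.\<close>
  also have "\<dots> \<le> k\<^sup>2 * (M * sqrt q ^ 3) + M / \<alpha> * - (k\<^sup>2 * q * (\<alpha> * sqrt q))"
    using h z M \<alpha> q0 unfolding q
    by (intro add_mono mult_left_mono le_imp_neg_le mult_nonneg_nonneg) auto
  also have "\<dots> = 0" using \<alpha> q0 by (simp add: power3_eq_cube)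
  finally have "(\<Sum>\<xi>\<in>E \<union> B. Y (M / \<alpha>) \<xi> p * Dp p (lf \<xi> p)) \<le> 0" .
  with U(2,3,4) show "\<exists>U \<phi> Dp D2p. defining_derivs \<Omega> U \<phi> Dp D2p \<and> p \<in> U \<and> \<phi> p = 0 \<and>
      (\<Sum>\<xi>\<in>E \<union> B. Y (M / \<alpha>) \<xi> p * Dp p (lf \<xi> p)) \<le> 0"
    by (intro exI conjI)
qed

section \<open>The integral inequalities for one function\<close>

lemma inward_flux_zero:
  assumes "\<And>\<xi> p. \<xi> \<in> S \<Longrightarrow> p \<in> frontier \<Omega> \<Longrightarrow> f \<xi> p = 0" shows "inward_flux \<Omega> S f"
  unfolding inward_flux_def using assms by (auto intro!: sum_nonpos)

lemma integral_Y:
  assumes "inward_flux \<Omega> (E \<union> B) (Y K)"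
  shows "(LINT x:\<Omega>|lborel. (L x)\<^sup>2 - S2 x + 3/4 * A2 x
     + K * ((real (card E) + 2 * real (card B) - 2) * N2 x - 2 * (Zu x * L x))) \<le> 0"
proof -
  have "(LINT x:\<Omega>|lborel. (\<Sum>\<xi>\<in>E \<union> B. Y' K \<xi> x)) \<le> 0"
    by (rule divergence_inequality[OF C2\<Omega> bdd _ span_frame_B Y_regular assms]) (use B(1) in simp_all)
  moreover have "(LINT x:\<Omega>|lborel. (\<Sum>\<xi>\<in>E \<union> B. Y' K \<xi> x)) = (LINT x:\<Omega>|lborel. (L x)\<^sup>2 - S2 x + 3/4 * A2 x
     + K * ((real (card E) + 2 * real (card B) - 2) * N2 x - 2 * (Zu x * L x)))"
  proof (rule set_lebesgue_integral_cong)
    show "\<Omega> \<in> sets lborel" using op by simp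
    show "\<forall>x. x \<in> \<Omega> \<longrightarrow> (\<Sum>\<xi>\<in>E \<union> B. Y' K \<xi> x) = (L x)\<^sup>2 - S2 x + 3/4 * A2 x
     + K * ((real (card E) + 2 * real (card B) - 2) * N2 x - 2 * (Zu x * L x))"
    proof (intro allI impI)
      fix x assume x: "x \<in> \<Omega>"
      have "(\<Sum>\<xi>\<in>E \<union> B. Y' K \<xi> x) = (\<Sum>\<xi>\<in>E. F' \<xi> x + K * R' \<xi> x) + (\<Sum>\<xi>\<in>B. K * Rv' \<xi> x)"
        unfolding Y'_def by (rule sum_frame_B)
      also have "\<dots> = (\<Sum>\<xi>\<in>E. F' \<xi> x) + K * ((\<Sum>\<xi>\<in>E. R' \<xi> x) + (\<Sum>\<xi>\<in>B. Rv' \<xi> x))"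
        by (simp only: sum.distrib sum_distrib_left distrib_left add.assoc)
      finally show "(\<Sum>\<xi>\<in>E \<union> B. Y' K \<xi> x) = (L x)\<^sup>2 - S2 x + 3/4 * A2 x
         + K * ((real (card E) + 2 * real (card B) - 2) * N2 x - 2 * (Zu x * L x))"
        unfolding F_divergence[OF x] R_divergence[OF x] .
    qed
  qed
  ultimately show ?thesis by simp
qed

text \<open>The integrand is the divergence of u times its horizontal gradient, a field that
  vanishes on the boundary and so has inward flux in the weak sense.\<close>

lemma integral_energy: "(LINT x:\<Omega>|lborel. N2 x + u x * L x) \<le> 0"
proof -
  let ?f = "\<lambda>\<xi> x. if \<xi> \<in> E then u x * u1 \<xi> x else 0"
  let ?f' = "\<lambda>\<xi> x. if \<xi> \<in> E then u1 \<xi> x * u1 \<xi> x + u2 \<xi> \<xi> x * u x else 0"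
  have reg: "X_regular \<Omega> \<xi> (?f \<xi>) (?f' \<xi>)" if "\<xi> \<in> E \<union> B" for \<xi>
  proof (cases "\<xi> \<in> E")
    case True
    have "X_regular \<Omega> \<xi> (\<lambda>x. u x * u1 \<xi> x) (\<lambda>x. u1 \<xi> x * u1 \<xi> x + u2 \<xi> \<xi> x * u x)"
      unfolding X_regular_def by (intro conjI ballI continuous_intros cu cu1 cu2 has_X_mult X_u X_u1)
    then show ?thesis using True by simp
  qed (simp add: X_regular_zero)
  have "(LINT x:\<Omega>|lborel. (\<Sum>\<xi>\<in>E \<union> B. ?f' \<xi> x)) \<le> 0"
    by (rule divergence_inequality[OF C2\<Omega> bdd _ span_frame_B reg inward_flux_zero]) (use B(1) u0 in simp_all)
  moreover have "(\<Sum>\<xi>\<in>E \<union> B. ?f' \<xi> x) = N2 x + u x * L x" for x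
    unfolding sum_frame_B N2_def L_def by (simp add: sum.distrib sum_distrib_left power2_eq_square mult.commute)
  ultimately show ?thesis by simp
qed

text \<open>The integrand is the divergence of u^2 times the coordinate along \<open>\<xi>\<close>,
  a field in that single direction; the coordinate has derivative 1 along it. On a bounded set this
  controls u by X_\<xi> u.\<close>

lemma integral_poincare:
  assumes \<xi>: "\<xi> \<in> E"
  shows "(LINT x:\<Omega>|lborel. (u x)\<^sup>2 + 2 * (x \<bullet> \<xi>) * u x * u1 \<xi> x) \<le> 0"
proof -
  let ?f = "\<lambda>\<eta> x. if \<eta> = \<xi> then (x \<bullet> \<xi>) * (u x * u x) else 0"
  let ?f' = "\<lambda>\<eta> x. if \<eta> = \<xi> then (u x)\<^sup>2 + 2 * (x \<bullet> \<xi>) * u x * u1 \<xi> x else 0"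
  have reg: "X_regular \<Omega> \<eta> (?f \<eta>) (?f' \<eta>)" if "\<eta> \<in> E \<union> B" for \<eta>
  proof (cases "\<eta> = \<xi>")
    case True
    have "X_regular \<Omega> \<xi> (\<lambda>x. (x \<bullet> \<xi>) * (u x * u x)) (\<lambda>x. (u x)\<^sup>2 + 2 * (x \<bullet> \<xi>) * u x * u1 \<xi> x)"
      unfolding X_regular_def
    proof (intro conjI ballI)
      show "continuous_on (closure \<Omega>) (\<lambda>x. (x \<bullet> \<xi>) * (u x * u x))"
        "continuous_on (closure \<Omega>) (\<lambda>x. (u x)\<^sup>2 + 2 * (x \<bullet> \<xi>) * u x * u1 \<xi> x)"
        by (intro continuous_intros cu cu1)+
      fix g assume g: "g \<in> \<Omega>"
      have "has_X \<xi> (\<lambda>x. (x \<bullet> \<xi>) * (u x * u x)) ((lf \<xi> g \<bullet> \<xi>) * (u g * u g) + (u1 \<xi> g * u g + u1 \<xi> g * u g) * (g \<bullet> \<xi>)) g"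
        by (intro has_X_mult X_coord X_u g)
      then show "has_X \<xi> (\<lambda>x. (x \<bullet> \<xi>) * (u x * u x)) ((u g)\<^sup>2 + 2 * (g \<bullet> \<xi>) * u g * u1 \<xi> g) g"
        unfolding lf_inner_E[OF \<xi>] by (simp add: power2_eq_square algebra_simps)
    qed
    then show ?thesis using True \<xi> by simp
  qed (simp add: X_regular_zero)
  have "(LINT x:\<Omega>|lborel. (\<Sum>\<eta>\<in>E \<union> B. ?f' \<eta> x)) \<le> 0"
    by (rule divergence_inequality[OF C2\<Omega> bdd _ span_frame_B reg inward_flux_zero]) (use B(1) u0 in simp_all)
  moreover have "(\<Sum>\<eta>\<in>E \<union> B. ?f' \<eta> x) = (u x)\<^sup>2 + 2 * (x \<bullet> \<xi>) * u x * u1 \<xi> x" for x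
    using \<xi> B(1) by (simp add: sum.delta)
  ultimately show ?thesis by simp
qed

text \<open>Here t, s, l, n, z, v, w, y stand for \<open>A2\<close>, \<open>S2\<close>,
  \<open>L\<close>, \<open>N2\<close>, \<open>Zu\<close>, u, X_\<xi> u and the coordinate along
  \<open>\<xi>\<close>, and q for the factor of \<open>N2\<close> in the Rellich divergence. The
  integrands of the three inequalities are added with weights 1, 1 and 1/(4r). Of 3t/4 a quarter of
  t absorbs z, leaving t/2; n pays 1/4 for z and 1/2 for w; the v^2/(4r) from the Poincare term is
  consumed in equal halves by v l and y v w.\<close>

lemma pointwise_estimate:
  fixes a b c K r n l s t z v w y q :: real
  assumes c: "c > 0" and zc: "z\<^sup>2 \<le> c * (n + t)" and K: "K \<ge> 0" and q: "q \<ge> 0" and n: "n \<ge> 0"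
    and sl: "s \<le> l\<^sup>2" and y: "y\<^sup>2 \<le> r" and w: "w\<^sup>2 \<le> n" and r: "r > 0"
  shows "1/2 * t - (4 * c * K\<^sup>2 + 2 * r) * l\<^sup>2
     \<le> (l\<^sup>2 - s + 3/4 * t + K * (q * n - 2 * (z * l))) + (n + v * l) + 1 / (4 * r) * (v\<^sup>2 + 2 * y * v * w)"
proof -
  \<comment> \<open>Young's inequality with weight 1/(4c), so that z^2 costs a quarter of n +
    t.\<close>
  have 1: "2 * (K * (z * l)) \<le> 1/4 * (n + t) + 4 * c * K\<^sup>2 * l\<^sup>2"
  proof -
    have "0 \<le> (z / (2 * c) - 2 * K * l)\<^sup>2 * c" using c by simp
    also have "\<dots> = z\<^sup>2 / c / 4 - 2 * (K * (z * l)) + 4 * c * K\<^sup>2 * l\<^sup>2"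
      using c by (simp add: power2_eq_square field_simps)
    finally have "2 * (K * (z * l)) \<le> z\<^sup>2 / c / 4 + 4 * c * K\<^sup>2 * l\<^sup>2" by simp
    moreover have "z\<^sup>2 / c / 4 \<le> 1/4 * (n + t)"
      using zc c by (simp add: pos_divide_le_eq mult.commute)
    ultimately show ?thesis by (rule order_trans[OF _ add_right_mono])
  qed
  have 2: "- (v * l) \<le> v\<^sup>2 / (8 * r) + 2 * r * l\<^sup>2"
  proof -
    have "0 \<le> (v / (4 * r) + l)\<^sup>2 * (2 * r)" using r by simp
    also have "\<dots> = v\<^sup>2 / (8 * r) + v * l + 2 * r * l\<^sup>2"
      using r by (simp add: power2_eq_square field_simps)
    finally show ?thesis by simp
  qed
  have 3: "- (1 / (4 * r) * (2 * y * v * w)) \<le> v\<^sup>2 / (8 * r) + 1/2 * n"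
  proof -
    have "0 \<le> (v + 2 * (y * w))\<^sup>2" by simp
    also have "\<dots> = v\<^sup>2 + 4 * (y * v * w) + 4 * (y\<^sup>2 * w\<^sup>2)" by (simp add: power2_eq_square algebra_simps)
    also have "y\<^sup>2 * w\<^sup>2 \<le> r * n" using y w r by (intro mult_mono) auto
    finally have "- (4 * (y * v * w)) \<le> v\<^sup>2 + 4 * (r * n)" by simp
    then have "- (4 * (y * v * w)) / (8 * r) \<le> (v\<^sup>2 + 4 * (r * n)) / (8 * r)"
      using r by (intro divide_right_mono) auto
    then show ?thesis using r by (simp add: field_simps)
  qed
  have 4: "1 / (4 * r) * (v\<^sup>2 + 2 * y * v * w) = v\<^sup>2 / (8 * r) + v\<^sup>2 / (8 * r) + 1 / (4 * r) * (2 * y * v * w)"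
    using r by (simp add: field_simps)
  have 5: "K * (q * n - 2 * (z * l)) = K * q * n - 2 * (K * (z * l))" "0 \<le> K * q * n"
    using K q n by (simp_all add: algebra_simps)
  have 6: "(4 * c * K\<^sup>2 + 2 * r) * l\<^sup>2 = 4 * c * K\<^sup>2 * l\<^sup>2 + 2 * r * l\<^sup>2" by (rule distrib_right)
  have lin: "1/2 * t - (b1 + b2) \<le> m - s + 3/4 * t + (b3 - 2 * b4) + (n + b5) + (b6 + b6 + b7)"
    if "2 * b4 \<le> 1/4 * (n + t) + b1" "- b5 \<le> b6 + b2" "- b7 \<le> b6 + 1/2 * n" "0 \<le> b3" "s \<le> m"
    for b1 b2 b3 b4 b5 b6 b7 m :: real
    using that n by argo
  show ?thesis unfolding 4 5(1) 6 by (rule lin[OF 1 2 3 5(2) sl])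
qed

lemma commutator_estimate:
  assumes M: "M > 0" and \<alpha>: "\<alpha> > 0"
    and H: "(SUP g\<in>Hcurv_dom G \<Omega>. ereal \<bar>Hcurv G \<Omega> g\<bar>) \<le> ereal M"
    and Z: "\<forall>g\<in>frontier \<Omega>. riem G g (Zfield G g) (outer_normal G \<Omega> g) \<ge> \<alpha> * angle_fun G \<Omega> g"
    and conv: "\<And>x. x \<in> \<Omega> \<Longrightarrow> S2 x \<le> (L x)\<^sup>2"
    and c: "c > 0" "\<And>x. x \<in> \<Omega> \<Longrightarrow> (Zu x)\<^sup>2 \<le> c * (N2 x + A2 x)"
    and r: "r > 0" "\<And>x. x \<in> \<Omega> \<Longrightarrow> (norm x)\<^sup>2 \<le> r"
  shows "(LINT x:\<Omega>|lborel. A2 x) \<le> 2 * (4 * c * (M / \<alpha>)\<^sup>2 + 2 * r) * (LINT x:\<Omega>|lborel. (L x)\<^sup>2)"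
proof -
  let ?K = "M / \<alpha>" and ?q = "real (card E) + 2 * real (card B) - 2"
  obtain \<xi> where \<xi>: "\<xi> \<in> E" using E_nonempty by blast
  let ?a = "\<lambda>x. (L x)\<^sup>2 - S2 x + 3/4 * A2 x + ?K * (?q * N2 x - 2 * (Zu x * L x))"
  let ?b = "\<lambda>x. N2 x + u x * L x"
  let ?d = "\<lambda>x. (u x)\<^sup>2 + 2 * (x \<bullet> \<xi>) * u x * u1 \<xi> x"
  let ?k = "4 * c * ?K\<^sup>2 + 2 * r"
  note int = set_integrable_closure[OF op bdd]
  have ia: "set_integrable lborel \<Omega> ?a" and ib: "set_integrable lborel \<Omega> ?b" and id: "set_integrable lborel \<Omega> ?d"
    and iA: "set_integrable lborel \<Omega> A2" and iL: "set_integrable lborel \<Omega> (\<lambda>x. (L x)\<^sup>2)"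
    by (intro int continuous_intros cont_ops cu cu1)+
  \<comment> \<open>The second layer of a step-two group is nontrivial, so the factor of
    \<open>N2\<close> in the Rellich divergence is nonnegative and that term has the right sign to
    be discarded.\<close>
  have "card B \<ge> 1" using B(1,3) by (simp add: Suc_le_eq card_gt_0_iff)
  then have q: "?q \<ge> 0" by simp
  have pw: "1/2 * A2 x - ?k * (L x)\<^sup>2 \<le> ?a x + ?b x + 1 / (4 * r) * ?d x" if x: "x \<in> \<Omega>" for x
  proof (rule pointwise_estimate[OF c(1) c(2)[OF x] _ q _ conv[OF x] _ _ r(1)])
    show "?K \<ge> 0" using M \<alpha> by simp
    show "N2 x \<ge> 0" by (simp add: N2_def sum_nonneg)
    have "norm \<xi> = 1" using E_norm[OF \<xi>] by (simp add: norm_eq_sqrt_inner)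
    then have "\<bar>x \<bullet> \<xi>\<bar> \<le> norm x" using Cauchy_Schwarz_ineq2[of x \<xi>] by simp
    then have "(x \<bullet> \<xi>)\<^sup>2 \<le> (norm x)\<^sup>2" by (subst power2_le_iff_abs_le) simp_all
    then show "(x \<bullet> \<xi>)\<^sup>2 \<le> r" using r(2)[OF x] by simp
    show "(u1 \<xi> x)\<^sup>2 \<le> N2 x" unfolding N2_def by (rule member_le_sum[OF \<xi>]) auto
  qed
  have "1/2 * (LINT x:\<Omega>|lborel. A2 x) - ?k * (LINT x:\<Omega>|lborel. (L x)\<^sup>2)
      = (LINT x:\<Omega>|lborel. 1/2 * A2 x - ?k * (L x)\<^sup>2)"
    using iA iL by (subst set_integral_diff(2)) (auto intro: set_integrable_mult_right)
  also have "\<dots> \<le> (LINT x:\<Omega>|lborel. ?a x + ?b x + 1 / (4 * r) * ?d x)"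
    by (rule set_integral_mono[OF _ _ pw])
       (intro set_integral_add set_integral_diff set_integrable_mult_right impI iA iL ia ib id)+
  also have "\<dots> = (LINT x:\<Omega>|lborel. ?a x) + (LINT x:\<Omega>|lborel. ?b x) + 1 / (4 * r) * (LINT x:\<Omega>|lborel. ?d x)"
    unfolding set_integral_add(2)[OF set_integral_add(1)[OF ia ib] set_integrable_mult_right[OF id]]
      set_integral_add(2)[OF ia ib] set_integral_mult_right ..
  also have "\<dots> \<le> 0"
    using integral_Y[OF Y_flux[OF M \<alpha> H Z]] integral_energy integral_poincare[OF \<xi>] r(1)
    by (intro add_nonpos_nonpos mult_nonneg_nonpos) auto
  finally have "(LINT x:\<Omega>|lborel. A2 x) \<le> 2 * (?k * (LINT x:\<Omega>|lborel. (L x)\<^sup>2))" by argo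
  then show ?thesis by (simp only: mult.assoc)
qed

end

section \<open>From the definitions to the locale: vertical basis and third derivatives\<close>

context carnot2
begin

lemma vertical_basis:
  obtains B where "finite B" "B \<subseteq> V2 G" "B \<noteq> {}" "\<forall>k\<in>B. k \<bullet> k = 1"
    "\<forall>g. (\<Sum>k\<in>B. (g \<bullet> k) *\<^sub>R k) = g - hproj g"
proof -
  obtain B where B: "B \<subseteq> V2 G" "pairwise orthogonal B" "\<forall>x\<in>B. norm x = 1" "independent B" "span B = V2 G"
    using orthonormal_basis_subspace[OF subspace_V2] by metis
  have fin: "finite B" using B(4) by (rule independent_imp_finite)
  show ?thesis
  proof (rule that[OF fin B(1)])
    show "B \<noteq> {}"
    proof
      assume "B = {}"
      then have "V2 G = {0}" using B(5) by (simp only: span_empty)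
      then show False using V2_nontrivial by simp
    qed
    show "\<forall>k\<in>B. k \<bullet> k = 1" using B(3) by (simp add: norm_eq_1)
    show "\<forall>g. (\<Sum>k\<in>B. (g \<bullet> k) *\<^sub>R k) = g - hproj g"
    proof
      fix g
      have "(\<Sum>k\<in>B. ((g - hproj g) \<bullet> k) *\<^sub>R k) = g - hproj g"
        by (rule orthonormal_basis_expand[OF B(2) bspec[OF B(3)] _ fin]) (simp_all only: B(5) vproj_V2)
      moreover have "(g - hproj g) \<bullet> k = g \<bullet> k" if "k \<in> B" for k
        using V1_V2_orth[OF hproj_V1, of k g] B(1) that by (auto simp: inner_diff_left)
      ultimately show "(\<Sum>k\<in>B. (g \<bullet> k) *\<^sub>R k) = g - hproj g" by simp
    qed
  qed
qed

text \<open>Membership in the class of order 3 provides the derivative of X_j X_k u along X_i with a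
  continuous extension. Inside \<Omega> the function X_j X_k u coincides with the expression in
  \<open>D2\<close>, and derivatives along flows depend only on values near the point.\<close>

lemma third_derivative:
  fixes D2 :: "'a \<Rightarrow> 'a \<Rightarrow>\<^sub>L 'a \<Rightarrow>\<^sub>L real"
  assumes op: "open \<Omega>" and \<Gamma>: "Gamma_closure G 3 \<Omega> u"
    and u: "\<And>x. x \<in> \<Omega> \<Longrightarrow> (u has_derivative blinfun_apply (D x)) (at x)"
    and D: "\<And>x. x \<in> \<Omega> \<Longrightarrow> (D has_derivative blinfun_apply (D2 x)) (at x)"
    and E: "\<xi> \<in> E" "\<eta> \<in> E" "\<zeta> \<in> E"
  shows "\<exists>f. continuous_on (closure \<Omega>) f \<and>
    (\<forall>g\<in>\<Omega>. has_X \<xi> (\<lambda>x. D2 x (lf \<eta> x) (lf \<zeta> x) + (1/2) * D x (br \<eta> \<zeta>)) (f g) g)"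
proof -
  obtain i j k where ijk: "i \<in> I" "j \<in> I" "k \<in> I" "\<xi> = e i" "\<eta> = e j" "\<zeta> = e k" using E by blast
  have "i \<in> {1..hdim G} \<and> set [j, k] \<subseteq> {1..hdim G} \<and> length (i # [j, k]) \<le> 3"
    using ijk(1-3) by (simp add: I_def)
  then have "(\<forall>g\<in>\<Omega>. X_exists G i (X_iter G [j, k] u) g) \<and>
      (\<exists>f. continuous_on (closure \<Omega>) f \<and> (\<forall>g\<in>\<Omega>. f g = X_iter G (i # [j, k]) u g))"
    by (rule \<Gamma>[unfolded Gamma_closure_def, THEN conjunct2, THEN spec[of _ i], THEN spec[of _ "[j, k]"], THEN mp])
  then obtain f where ex: "\<And>g. g \<in> \<Omega> \<Longrightarrow> X_exists G i (X G j (X G k u)) g"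
    and f: "continuous_on (closure \<Omega>) f" "\<And>g. g \<in> \<Omega> \<Longrightarrow> f g = X G i (X G j (X G k u)) g"
    by auto
  have "has_X (e i) (\<lambda>x. D2 x (lf \<eta> x) (lf \<zeta> x) + (1/2) * D x (br \<eta> \<zeta>)) (f g) g" if g: "g \<in> \<Omega>" for g
  proof -
    have "has_X (e i) (X G j (X G k u)) (f g) g"
      using ex[OF g] unfolding f(2)[OF g] X_exists_def has_X_def X_def[of G i] gmul_flow
      by (simp add: DERIV_deriv_iff_real_differentiable)
    then show ?thesis
      using has_X_cong_open[OF op g, of "X G j (X G k u)" "\<lambda>x. D2 x (lf \<eta> x) (lf \<zeta> x) + (1/2) * D x (br \<eta> \<zeta>)" "e i"]
        X_X_has_derivative[OF op _ u D] ijk by simp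
  qed
  then show ?thesis using f(1) ijk(4) by blast
qed

end

theorem theorem1p8:
  fixes G :: "'a::euclidean_space carnot" and \<Omega> :: "'a set" and M \<alpha> :: real
  assumes "carnot_step2 G"
    and "C2_open_set \<Omega>" and "bounded \<Omega>"
    and "M > 0" and "\<alpha> > 0"
    and "(SUP g\<in>Hcurv_dom G \<Omega>. ereal \<bar>Hcurv G \<Omega> g\<bar>) \<le> ereal M"
    and "\<forall>g\<in>frontier \<Omega>. riem G g (Zfield G g) (outer_normal G \<Omega> g) \<ge> \<alpha> * angle_fun G \<Omega> g"
  shows "\<exists>C>0. \<forall>u :: 'a \<Rightarrow> real.
           Gamma_closure G 3 \<Omega> u \<and> C2_closure \<Omega> u \<and> H2_convex_on G \<Omega> u \<and>
           (\<forall>g\<in>frontier \<Omega>. u g = 0) \<longrightarrow>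
           (\<Sum>i=1..hdim G. \<Sum>j=1..hdim G. (LINT g:\<Omega>|lborel. (X_comm G i j u g)\<^sup>2))
             \<le> C * (LINT g:\<Omega>|lborel. (hlap G u g)\<^sup>2)"
proof -
  interpret carnot2 G by (rule carnot2.intro[OF assms(1)])
  have op: "open \<Omega>" using assms(2) by (simp add: C2_open_set_def)
  obtain B where B: "finite B" "B \<subseteq> V2 G" "B \<noteq> {}" "\<forall>k\<in>B. k \<bullet> k = 1"
    "\<forall>g. (\<Sum>k\<in>B. (g \<bullet> k) *\<^sub>R k) = g - hproj g" by (rule vertical_basis)
  obtain c where c: "c > 0" "\<forall>g\<in>\<Omega>. \<forall>D :: 'a \<Rightarrow>\<^sub>L real. (blinfun_apply D (Zfield G g))\<^sup>2
      \<le> c * ((\<Sum>\<xi>\<in>E. (blinfun_apply D (lf \<xi> g))\<^sup>2) + (\<Sum>\<xi>\<in>E. \<Sum>\<eta>\<in>E. (blinfun_apply D (br \<xi> \<eta>))\<^sup>2))"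
    using Zfield_bound[OF assms(3)] by (elim exE conjE) (rule that)
  obtain b where b: "\<forall>g\<in>\<Omega>. norm g \<le> b" using assms(3) unfolding bounded_iff ..
  define r where "r = b\<^sup>2 + 1"
  have r: "r > 0" by (simp add: r_def add_nonneg_pos)
  have rb: "(norm g)\<^sup>2 \<le> r" if "g \<in> \<Omega>" for g
    using power_mono[of "norm g" b 2] b that by (simp add: r_def)
  \<comment> \<open>Fixed before u: it depends on the group and the domain through c and r, and on
    \<open>M / \<alpha>\<close>. It doubles the coefficient of the pointwise estimate, which retains
    half of \<open>A2\<close>.\<close>
  let ?C = "2 * (4 * c * (M / \<alpha>)\<^sup>2 + 2 * r)"
  show ?thesis
  proof (intro exI[of _ ?C] conjI allI impI)
    show "?C > 0" using c(1) r by (simp add: add_nonneg_pos)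
    fix u :: "'a \<Rightarrow> real"
    assume hu: "Gamma_closure G 3 \<Omega> u \<and> C2_closure \<Omega> u \<and> H2_convex_on G \<Omega> u \<and> (\<forall>g\<in>frontier \<Omega>. u g = 0)"
    then obtain D :: "'a \<Rightarrow> 'a \<Rightarrow>\<^sub>L real" and D2 :: "'a \<Rightarrow> 'a \<Rightarrow>\<^sub>L 'a \<Rightarrow>\<^sub>L real" where
      cu: "continuous_on (closure \<Omega>) u" and hD: "\<forall>x\<in>\<Omega>. (u has_derivative blinfun_apply (D x)) (at x)"
      "\<forall>x\<in>\<Omega>. (D has_derivative blinfun_apply (D2 x)) (at x)"
      "continuous_on (closure \<Omega>) D" "continuous_on (closure \<Omega>) D2"
      unfolding C2_closure_def by blast
    \<comment> \<open>The extensions of third derivatives exist separately for each triple of frame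
      vectors; a choice among them yields the function that the locale expects.\<close>
    define P where "P \<xi> \<eta> \<zeta> f \<longleftrightarrow> continuous_on (closure \<Omega>) f \<and>
      (\<forall>g\<in>\<Omega>. has_X \<xi> (\<lambda>x. D2 x (lf \<eta> x) (lf \<zeta> x) + (1/2) * D x (br \<eta> \<zeta>)) (f g) g)" for \<xi> \<eta> \<zeta> f
    define u3 where "u3 \<xi> \<eta> \<zeta> = (SOME f. P \<xi> \<eta> \<zeta> f)" for \<xi> \<eta> \<zeta>
    have u3: "P \<xi> \<eta> \<zeta> (u3 \<xi> \<eta> \<zeta>)" if "\<xi> \<in> E" "\<eta> \<in> E" "\<zeta> \<in> E" for \<xi> \<eta> \<zeta>
      unfolding u3_def
      by (rule someI_ex[of "P \<xi> \<eta> \<zeta>"], unfold P_def, rule third_derivative[where u=u, OF op _ _ _ that]) (use hu hD in simp_all)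
    interpret zero_boundary_function G \<Omega> u D D2 u3 B
      by (unfold_locales; (use assms hu hD cu B u3 in \<open>simp add: P_def\<close>)?)
    have X2: "X G i (X G j u) g = u2 (e i) (e j) g" if "g \<in> \<Omega>" for i j g
      unfolding u2_def by (rule X_X_has_derivative[OF op that]) (use hD that in simp_all)
    have lap: "hlap G u g = L g" if "g \<in> \<Omega>" for g
      unfolding hlap_def X2[OF that] L_def I_def[symmetric] by (rule sum_frame)
    have comm: "X_comm G i j u g = D g (br (e i) (e j))" if "g \<in> \<Omega>" for i j g
      unfolding X_comm_def X2[OF that] by (rule u2_diff[OF that])
    have sq: "hhess_sqnorm G u g = S2 g" if "g \<in> \<Omega>" for g
      unfolding hhess_sqnorm_def hhess_def X2[OF that] S2_def I_def[symmetric]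
      by (simp only: sum_frame[of "\<lambda>\<eta>. ((u2 (e _) \<eta> g + u2 \<eta> (e _) g) / 2)\<^sup>2"]
          sum_frame[of "\<lambda>\<xi>. \<Sum>\<eta>\<in>E. ((u2 \<xi> \<eta> g + u2 \<eta> \<xi> g) / 2)\<^sup>2"])
    have est: "(LINT x:\<Omega>|lborel. A2 x) \<le> ?C * (LINT x:\<Omega>|lborel. (L x)\<^sup>2)"
    proof (rule commutator_estimate[OF assms(4-7) _ c(1) _ r rb])
      show "S2 x \<le> (L x)\<^sup>2" if "x \<in> \<Omega>" for x
      proof -
        have "hhess_sqnorm G u x \<le> (hlap G u x)\<^sup>2" using hu that by (simp add: H2_convex_on_def)
        then show ?thesis unfolding lap[OF that] sq[OF that] .
      qed
      show "(Zu x)\<^sup>2 \<le> c * (N2 x + A2 x)" if "x \<in> \<Omega>" for x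
        using c(2) that unfolding Zu_def N2_def A2_def u1_def by blast
    qed
    have c2: "continuous_on (closure \<Omega>) (\<lambda>g. (D g (br \<xi> \<eta>))\<^sup>2)" for \<xi> \<eta>
      by (intro continuous_intros blinfun.continuous_on hD)
    have "(\<Sum>i=1..hdim G. \<Sum>j=1..hdim G. (LINT g:\<Omega>|lborel. (X_comm G i j u g)\<^sup>2))
       = (\<Sum>i\<in>I. \<Sum>j\<in>I. (LINT g:\<Omega>|lborel. (D g (br (e i) (e j)))\<^sup>2))"
      unfolding I_def
      by (intro sum.cong refl set_lebesgue_integral_cong) (use comm op in simp_all)
    also have "\<dots> = (\<Sum>\<xi>\<in>E. \<Sum>\<eta>\<in>E. (LINT g:\<Omega>|lborel. (D g (br \<xi> \<eta>))\<^sup>2))"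
      by (simp only: sum_frame[of "\<lambda>\<eta>. LINT g:\<Omega>|lborel. (D g (br (e _) \<eta>))\<^sup>2"]
          sum_frame[of "\<lambda>\<xi>. \<Sum>\<eta>\<in>E. LINT g:\<Omega>|lborel. (D g (br \<xi> \<eta>))\<^sup>2"])
    also have "\<dots> = (LINT g:\<Omega>|lborel. A2 g)"
      unfolding A2_def
      by (simp only: set_integral_finite_sum set_integrable_closure[OF op assms(3) c2])
    also note est
    also have "(LINT x:\<Omega>|lborel. (L x)\<^sup>2) = (LINT x:\<Omega>|lborel. (hlap G u x)\<^sup>2)"
      by (rule set_lebesgue_integral_cong) (use lap op in simp_all)
    finally show "(\<Sum>i=1..hdim G. \<Sum>j=1..hdim G. (LINT g:\<Omega>|lborel. (X_comm G i j u g)\<^sup>2))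
             \<le> ?C * (LINT g:\<Omega>|lborel. (hlap G u g)\<^sup>2)" .
  qed
qed

end
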